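(* Let $Y^{(1)}_{\alpha_1}$ and $Y^{(2)}_{\alpha_2}$ be two independent inverse stable subordinators with indices $\alpha_1,\alpha_2\in(0,1)$, let $\mathcal{G}$ be the $\sigma$-algebra they generate, let $\mu_{\boldsymbol{\alpha}}$ be the associated random product measure on $\mathbb{R}_+^2$, and let $\lambda>0$. A process (simple locally finite counting measure) $N_{\alpha_1,\alpha_2}$ on $\mathbb{R}_+^2$ is a fractional Poisson random field (FPRF) with parameter $\lambda$ if and only if it is an $\mathcal{F}^*$-doubly stochastic Poisson process with intensity $\lambda\, Y^{(1)}_{\alpha_1}\cdot Y^{(2)}_{\alpha_2}$ with respect to the filtration $\{\sigma(\mathcal{F}^X_{t_1,t_2},\mathcal{G}),\ t_1,t_2\in\mathbb{R}_+\}$, where $\mathcal{F}^X_{t_1,t_2}$ is the natural filtration of $X=N_{\alpha_1,\alpha_2}$. In other words, whenever $B_1,\ldots,B_n$ are disjoint bounded Borel sets in $\mathbb{R}_+\times\mathbb{R}_+$ and $x_1,\ldots,x_n$ are non-negative integers, $$\mathrm{P}\Big(\bigcap_{i=1}^n\{N_{\alpha_1,\alpha_2}(B_i)=x_i\}\,\Big|\,\mathcal{G}\Big)=\prod_{i=1}^n\frac{\exp(-\lambda\mu_{\boldsymbol{\alpha}}(B_i))\,(\lambda\mu_{\boldsymbol{\alpha}}(B_i))^{x_i}}{x_i!}.$$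
   Context: An inverse $\alpha$-stable subordinator, $\alpha\in(0,1)$, is $Y_\alpha(t)=\inf\{u\ge 0:L_\alpha(u)>t\}$ with $L_\alpha$ a Lévy subordinator with $\mathrm{E}e^{-sL_\alpha(t)}=e^{-ts^\alpha}$. Each $Y^{(i)}_{\alpha_i}$ defines a random measure $\mu_{\alpha_i}$ on $\mathbb{R}_+$ by $\mu_{\alpha_i}([0,t])=Y^{(i)}_{\alpha_i}(t)$. Put $\mathcal{G}_i=\sigma(Y^{(i)}_{\alpha_i}(t),t\ge0)$, $\mathcal{G}=\sigma(\mathcal{G}_1,\mathcal{G}_2)$, $\mu_{\boldsymbol{\alpha}}=\mu_{\alpha_1}\otimes\mu_{\alpha_2}$. A Poisson random field (PRF) with intensity $\lambda>0$ is a field $N(t_1,t_2)$ on $\mathbb{R}_+^2$ given by a homogeneous Poisson point process of intensity $\lambda$ with respect to Lebesgue measure. $N_{\alpha_1,\alpha_2}$ is an FPRF if $N_{\alpha_1,\alpha_2}(t_1,t_2)=N(Y^{(1)}_{\alpha_1}(t_1),Y^{(2)}_{\alpha_2}(t_2))$ with $N$ a PRF with intensity $\lambda$ independent of $(Y^{(1)}_{\alpha_1},Y^{(2)}_{\alpha_2})$; it is identified with the corresponding random counting measure, $N_{\alpha_1,\alpha_2}(t_1,t_2)=N_{\alpha_1,\alpha_2}([0,t_1]\times[0,t_2])$. For a two-parameter filtration $\{\mathcal{F}_{t_1,t_2}\}$ let $\mathcal{F}_{\infty,t_2}=\sigma(\mathcal{F}_{t_1,t_2},t_1>0)$, $\mathcal{F}_{t_1,\infty}=\sigma(\mathcal{F}_{t_1,t_2},t_2>0)$,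 and $\mathcal{F}^*_{s_1,s_2}=\mathcal{F}_{\infty,s_2}\vee\mathcal{F}_{s_1,\infty}$. For $s_1\le t_1$, $s_2\le t_2$ let $\Delta_{s_1,s_2}X(t_1,t_2)=X(t_1,t_2)-X(t_1,s_2)-X(s_1,t_2)+X(s_1,s_2)$. An adapted counting measure $X$ is an $\mathcal{F}^*$-doubly stochastic Poisson process with intensity $\lambda Y^{(1)}_{\alpha_1}\cdot Y^{(2)}_{\alpha_2}$ with respect to $\mathcal{F}_{t_1,t_2}=\sigma(\mathcal{F}^X_{t_1,t_2},\mathcal{G})$ if for all $s_1\le t_1$, $s_2\le t_2$, conditionally on $\mathcal{F}^*_{s_1,s_2}$, the increment $\Delta_{s_1,s_2}X(t_1,t_2)$ has a Poisson law with ($\mathcal{G}$-measurable) mean $\lambda\mu_{\boldsymbol{\alpha}}((s_1,t_1]\times(s_2,t_2])$.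
   Formalization: The F*-doubly stochastic Poisson property additionally requires that X vanish a.s. on the coordinate axes, X(t,0)=X(0,t)=0; without this the equivalence fails, e.g. for an FPRF plus a unit mass at (0,1), which no increment over (s1,t1]×(s2,t2] sees. *)

theory Defs
  imports "HOL-Probability.Probability"
begin

section \<open>Generated sigma-algebras and two-parameter filtrations\<close>

definition sigma_gen :: "'a set \<Rightarrow> 'i set \<Rightarrow> ('i \<Rightarrow> 'a \<Rightarrow> real) \<Rightarrow> 'a measure" where
  "sigma_gen \<Omega> I Z = sigma \<Omega> {Z i -` A \<inter> \<Omega> | i A. i \<in> I \<and> A \<in> sets borel}"

definition sigma_join :: "'a set \<Rightarrow> 'a measure \<Rightarrow> 'a measure \<Rightarrow> 'a measure" where
  "sigma_join \<Omega> F G = sigma \<Omega> (sets F \<union> sets G)"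

text \<open>All indices are real numbers; only values at nonnegative parameters matter.\<close>

definition filtration2 :: "'a measure \<Rightarrow> (real \<Rightarrow> real \<Rightarrow> 'a measure) \<Rightarrow> bool" where
  "filtration2 M F \<longleftrightarrow>
     (\<forall>t1\<ge>0. \<forall>t2\<ge>0. subalgebra M (F t1 t2)) \<and>
     (\<forall>s1\<ge>0. \<forall>s2\<ge>0. \<forall>t1\<ge>s1. \<forall>t2\<ge>s2. sets (F s1 s2) \<subseteq> sets (F t1 t2))"

text \<open>The sigma-algebras \<open>F\<^bsub>\<infinity>,t2\<^esub>\<close>, \<open>F\<^bsub>t1,\<infinity>\<^esub>\<close> and \<open>F\<^sup>*\<^bsub>s1,s2\<^esub>\<close>.\<close>

definition F_inf_left :: "'a measure \<Rightarrow> (real \<Rightarrow> real \<Rightarrow> 'a measure) \<Rightarrow> real \<Rightarrow> 'a measure" where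
  "F_inf_left M F t2 = sigma (space M) (\<Union>t1\<in>{0<..}. sets (F t1 t2))"

definition F_inf_right :: "'a measure \<Rightarrow> (real \<Rightarrow> real \<Rightarrow> 'a measure) \<Rightarrow> real \<Rightarrow> 'a measure" where
  "F_inf_right M F t1 = sigma (space M) (\<Union>t2\<in>{0<..}. sets (F t1 t2))"

definition F_star :: "'a measure \<Rightarrow> (real \<Rightarrow> real \<Rightarrow> 'a measure) \<Rightarrow> real \<Rightarrow> real \<Rightarrow> 'a measure" where
  "F_star M F s1 s2 = sigma_join (space M) (F_inf_left M F s2) (F_inf_right M F s1)"

definition cprob :: "'a measure \<Rightarrow> 'a measure \<Rightarrow> 'a set \<Rightarrow> 'a \<Rightarrow> real" where
  "cprob M F E = real_cond_exp M F (indicator E)"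

text \<open>Written out rather than taken from \<^const>\<open>poisson_pmf\<close>, which is specified for
  positive rates only; mean 0 gives the point mass at 0.\<close>

definition poisson_weight :: "real \<Rightarrow> nat \<Rightarrow> real" where
  "poisson_weight m k = exp (- m) * m ^ k / fact k"

section \<open>Inverse stable subordinators\<close>

text \<open>Path properties hold almost surely; existence of left limits is implied by monotonicity.\<close>

definition levy_subordinator :: "'a measure \<Rightarrow> (real \<Rightarrow> 'a \<Rightarrow> real) \<Rightarrow> bool" where
  "levy_subordinator M L \<longleftrightarrow>
     (\<forall>t\<ge>0. L t \<in> borel_measurable M) \<and>
     (AE \<omega> in M. L 0 \<omega> = 0 \<and> mono_on {0..} (\<lambda>t. L t \<omega>) \<and>
        (\<forall>t\<ge>0. continuous (at_right t) (\<lambda>u. L u \<omega>))) \<and>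
     (\<forall>n (t :: nat \<Rightarrow> real). 0 \<le> t 0 \<and> mono t \<longrightarrow>
        prob_space.indep_vars M (\<lambda>_. borel) (\<lambda>i \<omega>. L (t (Suc i)) \<omega> - L (t i) \<omega>) {..<n}) \<and>
     (\<forall>s\<ge>0. \<forall>h\<ge>0. distr M borel (\<lambda>\<omega>. L (s + h) \<omega> - L s \<omega>) = distr M borel (L h))"

definition stable_subordinator :: "'a measure \<Rightarrow> real \<Rightarrow> (real \<Rightarrow> 'a \<Rightarrow> real) \<Rightarrow> bool" where
  "stable_subordinator M \<alpha> L \<longleftrightarrow> levy_subordinator M L \<and>
     (\<forall>t\<ge>0. \<forall>s\<ge>0. (\<integral>\<omega>. exp (- s * L t \<omega>) \<partial>M) = exp (- t * s powr \<alpha>))"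

text \<open>The set in the infimum is almost surely nonempty for all \<open>t\<close>, since \<open>L\<close> is almost
  surely unbounded.\<close>

definition inverse_stable_subordinator ::
  "'a measure \<Rightarrow> real \<Rightarrow> (real \<Rightarrow> 'a \<Rightarrow> real) \<Rightarrow> bool" where
  "inverse_stable_subordinator M \<alpha> Y \<longleftrightarrow>
     (\<forall>t\<ge>0. Y t \<in> borel_measurable M) \<and>
     (\<exists>L. stable_subordinator M \<alpha> L \<and>
        (AE \<omega> in M. \<forall>t\<ge>0. Y t \<omega> = Inf {u. 0 \<le> u \<and> L u \<omega> > t}))"

definition sigma_process :: "'a measure \<Rightarrow> (real \<Rightarrow> 'a \<Rightarrow> real) \<Rightarrow> 'a measure" where
  "sigma_process M Y = sigma_gen (space M) {0..} Y"

definition sigma_pair ::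
  "'a measure \<Rightarrow> (real \<Rightarrow> 'a \<Rightarrow> real) \<Rightarrow> (real \<Rightarrow> 'a \<Rightarrow> real) \<Rightarrow> 'a measure" where
  "sigma_pair M Y1 Y2 = sigma_join (space M) (sigma_process M Y1) (sigma_process M Y2)"

text \<open>The Stieltjes measure on \<open>[0,\<infinity>)\<close> giving mass \<open>Y t \<omega>\<close> to \<open>[0,t]\<close>; extending the path by
  \<open>0\<close> to negative times makes a possible atom at \<open>0\<close> count.\<close>

definition path_measure :: "(real \<Rightarrow> 'a \<Rightarrow> real) \<Rightarrow> 'a \<Rightarrow> real measure" where
  "path_measure Y \<omega> =
     restrict_space (interval_measure (\<lambda>t. if t < 0 then 0 else Y t \<omega>)) {0..}"

definition product_path_measure ::
  "(real \<Rightarrow> 'a \<Rightarrow> real) \<Rightarrow> (real \<Rightarrow> 'a \<Rightarrow> real) \<Rightarrow> 'a \<Rightarrow> (real \<times> real) measure" where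
  "product_path_measure Y1 Y2 \<omega> = path_measure Y1 \<omega> \<Otimes>\<^sub>M path_measure Y2 \<omega>"

section \<open>Point processes on the quadrant\<close>

definition quadrant :: "(real \<times> real) set" where
  "quadrant = {0..} \<times> {0..}"

definition bounded_borel_sets :: "(real \<times> real) set set" where
  "bounded_borel_sets = {B. B \<in> sets borel \<and> B \<subseteq> quadrant \<and> bounded B}"

definition counting_process :: "'a measure \<Rightarrow> ('a \<Rightarrow> (real \<times> real) measure) \<Rightarrow> bool" where
  "counting_process M X \<longleftrightarrow>
     (\<forall>\<omega>\<in>space M. sets (X \<omega>) = sets (restrict_space borel quadrant)) \<and>
     (\<forall>\<omega>\<in>space M. \<forall>B\<in>bounded_borel_sets. \<exists>k::nat. emeasure (X \<omega>) B = of_nat k) \<and>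
     (\<forall>B\<in>bounded_borel_sets. (\<lambda>\<omega>. emeasure (X \<omega>) B) \<in> borel_measurable M)"

definition simple_counting_process ::
  "'a measure \<Rightarrow> ('a \<Rightarrow> (real \<times> real) measure) \<Rightarrow> bool" where
  "simple_counting_process M X \<longleftrightarrow> counting_process M X \<and>
     (\<forall>\<omega>\<in>space M. \<forall>p\<in>quadrant. emeasure (X \<omega>) {p} \<le> 1)"

definition count_field :: "('a \<Rightarrow> (real \<times> real) measure) \<Rightarrow> real \<Rightarrow> real \<Rightarrow> 'a \<Rightarrow> real" where
  "count_field X t1 t2 \<omega> = measure (X \<omega>) ({0..t1} \<times> {0..t2})"

definition increment ::
  "('a \<Rightarrow> (real \<times> real) measure) \<Rightarrow> real \<Rightarrow> real \<Rightarrow> real \<Rightarrow> real \<Rightarrow> 'a \<Rightarrow> real" where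
  "increment X s1 s2 t1 t2 \<omega> =
     count_field X t1 t2 \<omega> - count_field X t1 s2 \<omega> - count_field X s1 t2 \<omega> + count_field X s1 s2 \<omega>"

definition sigma_count_field :: "'a measure \<Rightarrow> ('a \<Rightarrow> (real \<times> real) measure) \<Rightarrow> 'a measure" where
  "sigma_count_field M X = sigma_gen (space M) quadrant (\<lambda>(t1, t2). count_field X t1 t2)"

definition natural_filtration ::
  "'a measure \<Rightarrow> ('a \<Rightarrow> (real \<times> real) measure) \<Rightarrow> real \<Rightarrow> real \<Rightarrow> 'a measure" where
  "natural_filtration M X t1 t2 =
     sigma_gen (space M) ({0..t1} \<times> {0..t2}) (\<lambda>(u1, u2). count_field X u1 u2)"

section \<open>Fractional Poisson random fields and doubly stochastic Poisson processes\<close>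

definition poisson_random_field ::
  "'a measure \<Rightarrow> real \<Rightarrow> ('a \<Rightarrow> (real \<times> real) measure) \<Rightarrow> bool" where
  "poisson_random_field M lam N \<longleftrightarrow> counting_process M N \<and>
     (\<forall>B\<in>bounded_borel_sets. \<forall>k.
        measure M {\<omega> \<in> space M. measure (N \<omega>) B = real k} =
          poisson_weight (lam * measure lborel B) k) \<and>
     (\<forall>n (B :: nat \<Rightarrow> (real \<times> real) set).
        (\<forall>i<n. B i \<in> bounded_borel_sets) \<and> disjoint_family_on B {..<n} \<longrightarrow>
        prob_space.indep_vars M (\<lambda>_. borel) (\<lambda>i \<omega>. measure (N \<omega>) (B i)) {..<n})"

definition fractional_poisson_random_field ::
  "'a measure \<Rightarrow> (real \<Rightarrow> 'a \<Rightarrow> real) \<Rightarrow> (real \<Rightarrow> 'a \<Rightarrow> real) \<Rightarrow> real \<Rightarrow>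
    ('a \<Rightarrow> (real \<times> real) measure) \<Rightarrow> bool" where
  "fractional_poisson_random_field M Y1 Y2 lam X \<longleftrightarrow>
     (\<exists>N. poisson_random_field M lam N \<and>
        prob_space.indep_set M (sets (sigma_count_field M N)) (sets (sigma_pair M Y1 Y2)) \<and>
        (AE \<omega> in M. \<forall>t1\<ge>0. \<forall>t2\<ge>0. count_field X t1 t2 \<omega> = count_field N (Y1 t1 \<omega>) (Y2 t2 \<omega>) \<omega>))"

text \<open>\<open>lam\<close> times the random measure \<open>\<mu>\<close> is the intensity. The last clause is the usual
  convention that a two-parameter process vanishes on the axes. It is not implied by the law of the
  increments over \<open>(s1,t1] \<times> (s2,t2]\<close> with \<open>s1, s2 \<ge> 0\<close>, which do not see points on the axes.\<close>

definition doubly_stochastic_poisson_star ::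
  "'a measure \<Rightarrow> (real \<Rightarrow> real \<Rightarrow> 'a measure) \<Rightarrow> real \<Rightarrow> ('a \<Rightarrow> (real \<times> real) measure) \<Rightarrow>
    ('a \<Rightarrow> (real \<times> real) measure) \<Rightarrow> bool" where
  "doubly_stochastic_poisson_star M F lam \<mu> X \<longleftrightarrow>
     filtration2 M F \<and>
     (\<forall>t1\<ge>0. \<forall>t2\<ge>0. count_field X t1 t2 \<in> borel_measurable (F t1 t2)) \<and>
     (\<forall>s1\<ge>0. \<forall>s2\<ge>0. \<forall>t1\<ge>s1. \<forall>t2\<ge>s2. \<forall>k. AE \<omega> in M.
        cprob M (F_star M F s1 s2) {\<omega>' \<in> space M. increment X s1 s2 t1 t2 \<omega>' = real k} \<omega> =
          poisson_weight (lam * measure (\<mu> \<omega>) ({s1<..t1} \<times> {s2<..t2})) k) \<and>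
     (AE \<omega> in M. \<forall>t\<ge>0. count_field X t 0 \<omega> = 0 \<and> count_field X 0 t \<omega> = 0)"

text \<open>The filtration \<open>\<sigma>(F\<^sup>X\<^bsub>t1,t2\<^esub>, G)\<close>.\<close>

definition enlarged_filtration ::
  "'a measure \<Rightarrow> 'a measure \<Rightarrow> ('a \<Rightarrow> (real \<times> real) measure) \<Rightarrow> real \<Rightarrow> real \<Rightarrow> 'a measure" where
  "enlarged_filtration M G X t1 t2 = sigma_join (space M) (natural_filtration M X t1 t2) G"

end

theory Submission
  imports Defs
begin

text \<open>All three conditions are equivalent to a conditional Poisson property given \<open>G\<close> for the
  counts in the cells of dyadic grids. The link is that this property extends from dyadic cells to
  arbitrary disjoint \<^emph>\<open>random\<close> sets, that is, to sections of sets that are measurable for the product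
  of \<open>G\<close> and the Borel sets: such a set is approximated by unions of cells with \<open>G\<close>-measurable
  selection, in mean with respect to the weighted measure \<open>(X + \<mu>) / (1 + X(Q) + \<mu>(Q))\<close>, and then
  counts converge almost surely along a subsequence.

  If \<open>X\<close> is the time change of a Poisson field \<open>N\<close>, the cell counts of \<open>X\<close> are counts of \<open>N\<close> in random
  rectangles. Conversely \<open>N\<close> is recovered on the same probability space as the image of \<open>X\<close> under
  \<open>(t1, t2) \<mapsto> (Y1(t1), Y2(t2))\<close>, which maps \<open>\<mu>\<close> to Lebesgue measure because the inverse subordinators
  are continuous and onto; nothing is lost since \<open>X\<close> almost surely has no points over the flat
  stretches of \<open>Y1\<close> and \<open>Y2\<close>. The martingale-type
  condition with \<open>F\<^sup>*\<close> gives the joint law of the cells by induction along a linear order.\<close>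

text \<open>Division by \<open>1 + X(Q) + \<mu>(Q)\<close> makes approximation in mean possible
  without any moment bound: the weighted mass lies in [0,1], and for a fixed outcome it tends to 0
  exactly when both masses do. Both are needed, since the counts enter one side of the Poisson
  identity and the means the other. Counts are integers, so almost sure convergence makes them
  eventually equal to their limit; nothing weaker would pass through the discontinuous indicator of
  a value.

  Random sets cannot be avoided: a time change turns fixed rectangles into rectangles with
  G-measurable corners. A set whose cells are selected by events of G is a fixed union of cells on
  suitable events of G, and there Poisson weights can be convolved.

  The paths of the subordinators are regular only almost surely, while G is not completed. They are
  therefore replaced by versions that are regular for every outcome and still measurable for the
  process, continued by the identity to negative times so that they map the line onto
  itself.\<close>

section \<open>Poisson weights\<close>

lemma poisson_weight_nonneg: "0 \<le> m \<Longrightarrow> 0 \<le> poisson_weight m k"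
  by (simp add: poisson_weight_def)

lemma poisson_weight_0: "poisson_weight 0 k = (if k = 0 then 1 else 0)"
  by (simp add: poisson_weight_def)

lemma poisson_weight_sums: "poisson_weight m sums 1"
proof -
  have "(\<lambda>k. exp (- m) * (m ^ k /\<^sub>R fact k)) sums (exp (- m) * exp m)"
    by (intro sums_mult exp_converges)
  then show ?thesis
    by (simp add: poisson_weight_def[abs_def] divide_inverse mult.assoc mult.commute[of "inverse _"] flip: exp_add)
qed

lemma poisson_weight_le_1: "0 \<le> m \<Longrightarrow> poisson_weight m k \<le> 1"
  using sum_le_suminf[OF sums_summable[OF poisson_weight_sums[of m]], of "{k}"]
    poisson_weight_nonneg[of m] sums_unique[OF poisson_weight_sums[of m]] by simp

lemma poisson_weight_measurable [measurable]: "(\<lambda>m. poisson_weight m k) \<in> borel_measurable borel"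
  unfolding poisson_weight_def by measurable

lemma continuous_poisson_weight: "isCont (\<lambda>m. poisson_weight m k) m"
  unfolding poisson_weight_def by (intro continuous_intros) auto

text \<open>The binomial theorem in disguise; this convolution identity is what allows cells to be
  merged into larger sets.\<close>

lemma poisson_weight_add:
  "(\<Sum>i\<le>n. poisson_weight a i * poisson_weight b (n - i)) = poisson_weight (a + b) n"
proof -
  have "(\<Sum>i\<le>n. poisson_weight a i * poisson_weight b (n - i))
      = (\<Sum>i\<le>n. exp (- (a + b)) / fact n * (of_nat (n choose i) * a ^ i * b ^ (n - i)))"
    by (intro sum.cong refl) (simp add: poisson_weight_def exp_add exp_diff exp_minus binomial_fact field_simps)
  also have "\<dots> = poisson_weight (a + b) n"
    unfolding poisson_weight_def binomial_ring by (simp add: sum_distrib_left sum_divide_distrib mult.assoc)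
  finally show ?thesis .
qed

lemma sum_Nats: "(\<And>i. i \<in> I \<Longrightarrow> f i \<in> \<nat>) \<Longrightarrow> sum f I \<in> (\<nat> :: 'b::semiring_1 set)"
  by (induction I rule: infinite_finite_induct) auto

section \<open>The conditional Poisson property of a finite family of counts\<close>

text \<open>The indicator of the event that all counts in \<open>I\<close> take the prescribed
  values, written as a product so that single coordinates can be split off in the same way as in
  \<open>poisson_prod\<close>.\<close>

definition count_ind :: "'i set \<Rightarrow> ('i \<Rightarrow> 'a \<Rightarrow> real) \<Rightarrow> ('i \<Rightarrow> nat) \<Rightarrow> 'a \<Rightarrow> real" where
  "count_ind I K x \<omega> = (\<Prod>c\<in>I. indicator {real (x c)} (K c \<omega>))"

definition poisson_prod :: "'i set \<Rightarrow> ('i \<Rightarrow> 'a \<Rightarrow> real) \<Rightarrow> ('i \<Rightarrow> nat) \<Rightarrow> 'a \<Rightarrow> real" where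
  "poisson_prod I V x \<omega> = (\<Prod>c\<in>I. poisson_weight (V c \<omega>) (x c))"

text \<open>Given G the counts \<open>K\<close> are independent Poisson variables with means
  \<open>V\<close>. Testing against events of G avoids choosing versions of conditional expectations
  and lets limits pass under the integral.\<close>

definition cond_poisson ::
  "'a measure \<Rightarrow> 'a measure \<Rightarrow> 'i set \<Rightarrow> ('i \<Rightarrow> 'a \<Rightarrow> real) \<Rightarrow> ('i \<Rightarrow> 'a \<Rightarrow> real) \<Rightarrow> bool" where
  "cond_poisson M G I K V \<longleftrightarrow> (\<forall>A\<in>sets G. \<forall>x.
     (\<integral>\<omega>. indicator A \<omega> * count_ind I K x \<omega> \<partial>M) = (\<integral>\<omega>. indicator A \<omega> * poisson_prod I V x \<omega> \<partial>M))"

lemma count_ind_nonneg: "0 \<le> count_ind I K x \<omega>"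
  by (simp add: count_ind_def prod_nonneg)

lemma count_ind_le_1: "count_ind I K x \<omega> \<le> 1"
  unfolding count_ind_def by (intro prod_le_1) (auto simp: indicator_def)

lemma poisson_prod_nonneg: "(\<And>c. c \<in> I \<Longrightarrow> 0 \<le> V c \<omega>) \<Longrightarrow> 0 \<le> poisson_prod I V x \<omega>"
  by (simp add: poisson_prod_def prod_nonneg poisson_weight_nonneg)

lemma poisson_prod_le_1: "(\<And>c. c \<in> I \<Longrightarrow> 0 \<le> V c \<omega>) \<Longrightarrow> poisson_prod I V x \<omega> \<le> 1"
  unfolding poisson_prod_def by (intro prod_le_1) (auto simp: poisson_weight_nonneg poisson_weight_le_1)

lemma count_ind_measurable [measurable (raw)]:
  "(\<And>c. c \<in> I \<Longrightarrow> K c \<in> borel_measurable M) \<Longrightarrow> count_ind I K x \<in> borel_measurable M"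
  unfolding count_ind_def[abs_def] by measurable

lemma poisson_prod_measurable [measurable (raw)]:
  "(\<And>c. c \<in> I \<Longrightarrow> V c \<in> borel_measurable M) \<Longrightarrow> poisson_prod I V x \<in> borel_measurable M"
  unfolding poisson_prod_def[abs_def] by measurable

lemma count_ind_cong: "(\<And>c. c \<in> I \<Longrightarrow> K c \<omega> = K' c \<omega>) \<Longrightarrow> count_ind I K x \<omega> = count_ind I K' x \<omega>"
  by (simp add: count_ind_def)

lemma poisson_prod_cong: "(\<And>c. c \<in> I \<Longrightarrow> V c \<omega> = V' c \<omega>) \<Longrightarrow> poisson_prod I V x \<omega> = poisson_prod I V' x \<omega>"
  by (simp add: poisson_prod_def)

lemma cond_poisson_reindex:
  assumes h: "bij_betw h J I" and cp: "cond_poisson M G J (\<lambda>j. K (h j)) (\<lambda>j. V (h j))"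
  shows "cond_poisson M G I K V"
proof -
  have "count_ind I K x = count_ind J (\<lambda>j. K (h j)) (\<lambda>j. x (h j))"
    "poisson_prod I V x = poisson_prod J (\<lambda>j. V (h j)) (\<lambda>j. x (h j))" for x
    unfolding count_ind_def[abs_def] poisson_prod_def[abs_def] using h
    by (simp_all add: prod.reindex_bij_betw[symmetric])
  then show ?thesis
    using cp by (simp add: cond_poisson_def)
qed

lemma count_ind_eq_indicator:
  assumes "finite I"
  shows "count_ind I K x \<omega> = (if \<forall>c\<in>I. K c \<omega> = real (x c) then 1 else 0)"
  unfolding count_ind_def using assms by (induction I rule: finite_induct) (auto simp: indicator_def)

locale cond_prob = prob_space M for M :: "'a measure" +
  fixes G :: "'a measure"
  assumes subalgG: "subalgebra M G"

sublocale cond_prob \<subseteq> finite_measure_subalgebra M G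
  by unfold_locales (rule subalgG)

context cond_prob
begin

lemma G_sets: "A \<in> sets G \<Longrightarrow> A \<in> sets M"
  using subalgG by (auto simp: subalgebra_def)

lemma G_space: "space G = space M"
  using subalgG by (auto simp: subalgebra_def)

lemma G_measurable: "f \<in> borel_measurable G \<Longrightarrow> f \<in> borel_measurable M"
  by (rule measurable_from_subalg[OF subalgG])

lemma sets_pair_G: "S \<in> sets (G \<Otimes>\<^sub>M borel) \<Longrightarrow> S \<in> sets (M \<Otimes>\<^sub>M (borel :: (real \<times> real) measure))"
  unfolding sets_pair_measure G_space
  by (erule sigma_sets_mono'[THEN subsetD, rotated]) (auto intro: G_sets)

lemma integrable_unit:
  fixes f :: "'a \<Rightarrow> real"
  assumes "f \<in> borel_measurable M" "\<And>\<omega>. \<omega> \<in> space M \<Longrightarrow> 0 \<le> f \<omega>" "\<And>\<omega>. \<omega> \<in> space M \<Longrightarrow> f \<omega> \<le> 1"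
  shows "integrable M f"
  by (rule integrable_const_bound[where B = 1]) (use assms in auto)

lemma unit_mult_count_poisson:
  fixes g :: "'a \<Rightarrow> real"
  assumes [measurable]: "g \<in> borel_measurable M"
    and g: "\<And>\<omega>. \<omega> \<in> space M \<Longrightarrow> 0 \<le> g \<omega>" "\<And>\<omega>. \<omega> \<in> space M \<Longrightarrow> g \<omega> \<le> 1"
    and [measurable]: "\<And>c. c \<in> I \<Longrightarrow> K c \<in> borel_measurable M" "\<And>c. c \<in> J \<Longrightarrow> V c \<in> borel_measurable M"
    and V: "\<And>c \<omega>. c \<in> J \<Longrightarrow> \<omega> \<in> space M \<Longrightarrow> 0 \<le> V c \<omega>"
  shows "integrable M (\<lambda>\<omega>. g \<omega> * count_ind I K x \<omega>)"
    and "integrable M (\<lambda>\<omega>. g \<omega> * poisson_prod J V y \<omega>)"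
  using g V
  by (auto intro!: integrable_unit mult_nonneg_nonneg mult_le_one count_ind_nonneg count_ind_le_1
      poisson_prod_nonneg poisson_prod_le_1)

text \<open>Both integrands are bounded by 1, so dominated convergence applies. On the left the
  counts must be eventually equal to their limit, because the indicator of a value is not
  continuous; on the right convergence suffices, because Poisson weights are continuous in the
  mean.\<close>

lemma cond_poisson_limit:
  fixes I :: "'i set"
  assumes I: "finite I"
    and cp: "\<And>n. cond_poisson M G I (K n) (V n)"
    and [measurable]: "\<And>n c. c \<in> I \<Longrightarrow> K n c \<in> borel_measurable M" "\<And>n c. c \<in> I \<Longrightarrow> V n c \<in> borel_measurable M"
      "\<And>c. c \<in> I \<Longrightarrow> K' c \<in> borel_measurable M" "\<And>c. c \<in> I \<Longrightarrow> V' c \<in> borel_measurable M"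
    and V: "\<And>n c \<omega>. c \<in> I \<Longrightarrow> \<omega> \<in> space M \<Longrightarrow> 0 \<le> V n c \<omega>"
    and limK: "\<And>c. c \<in> I \<Longrightarrow> AE \<omega> in M. \<forall>\<^sub>F n in sequentially. K n c \<omega> = K' c \<omega>"
    and limV: "\<And>c. c \<in> I \<Longrightarrow> AE \<omega> in M. (\<lambda>n. V n c \<omega>) \<longlonglongrightarrow> V' c \<omega>"
  shows "cond_poisson M G I K' V'"
  unfolding cond_poisson_def
proof (intro ballI allI)
  fix A and x :: "'i \<Rightarrow> nat" assume "A \<in> sets G"
  then have [measurable]: "A \<in> sets M" by (rule G_sets)
  have "AE \<omega> in M. \<forall>c\<in>I. \<forall>\<^sub>F n in sequentially. K n c \<omega> = K' c \<omega>"
    using limK I by (simp add: AE_finite_all)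
  then have 1: "AE \<omega> in M. (\<lambda>n. indicator A \<omega> * count_ind I (K n) x \<omega>) \<longlonglongrightarrow> indicator A \<omega> * count_ind I K' x \<omega>"
  proof eventually_elim
    case (elim \<omega>)
    then have "\<forall>\<^sub>F n in sequentially. \<forall>c\<in>I. K n c \<omega> = K' c \<omega>"
      using I by (simp add: eventually_ball_finite)
    then have "\<forall>\<^sub>F n in sequentially. indicator A \<omega> * count_ind I (K n) x \<omega> = indicator A \<omega> * count_ind I K' x \<omega>"
      by eventually_elim (simp add: count_ind_def)
    then show ?case by (rule tendsto_eventually)
  qed
  have "AE \<omega> in M. \<forall>c\<in>I. (\<lambda>n. V n c \<omega>) \<longlonglongrightarrow> V' c \<omega>"
    using limV I by (simp add: AE_finite_all)
  then have 2: "AE \<omega> in M. (\<lambda>n. indicator A \<omega> * poisson_prod I (V n) x \<omega>) \<longlonglongrightarrow> indicator A \<omega> * poisson_prod I V' x \<omega>"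
    unfolding poisson_prod_def
    by eventually_elim (auto intro!: tendsto_intros isCont_tendsto_compose[OF continuous_poisson_weight])
  have b: "AE \<omega> in M. norm (indicator A \<omega> * count_ind I (K n) x \<omega>) \<le> 1" for n
    using count_ind_nonneg[of I "K n" x] count_ind_le_1[of I "K n" x] by (auto simp: indicator_def)
  have c: "AE \<omega> in M. norm (indicator A \<omega> * poisson_prod I (V n) x \<omega>) \<le> 1" for n
    using poisson_prod_nonneg[of I "V n" _ x] poisson_prod_le_1[of I "V n" _ x] V by (auto simp: indicator_def)
  have "(\<lambda>n. \<integral>\<omega>. indicator A \<omega> * count_ind I (K n) x \<omega> \<partial>M) \<longlonglongrightarrow> (\<integral>\<omega>. indicator A \<omega> * count_ind I K' x \<omega> \<partial>M)"
    by (rule integral_dominated_convergence[where w = "\<lambda>_. 1"]) (use 1 b in auto)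
  moreover have "(\<lambda>n. \<integral>\<omega>. indicator A \<omega> * poisson_prod I (V n) x \<omega> \<partial>M) \<longlonglongrightarrow> (\<integral>\<omega>. indicator A \<omega> * poisson_prod I V' x \<omega> \<partial>M)"
    by (rule integral_dominated_convergence[where w = "\<lambda>_. 1"]) (use 2 c in auto)
  ultimately show "(\<integral>\<omega>. indicator A \<omega> * count_ind I K' x \<omega> \<partial>M) = (\<integral>\<omega>. indicator A \<omega> * poisson_prod I V' x \<omega> \<partial>M)"
    using cp \<open>A \<in> sets G\<close> by (auto simp: cond_poisson_def intro: LIMSEQ_unique)
qed

lemma cond_poisson_cong_AE:
  fixes I :: "'i set"
  assumes I: "finite I"
    and cp: "cond_poisson M G I K V"
    and "\<And>c. c \<in> I \<Longrightarrow> K c \<in> borel_measurable M" "\<And>c. c \<in> I \<Longrightarrow> V c \<in> borel_measurable M"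
      "\<And>c. c \<in> I \<Longrightarrow> K' c \<in> borel_measurable M" "\<And>c. c \<in> I \<Longrightarrow> V' c \<in> borel_measurable M"
    and "\<And>c \<omega>. c \<in> I \<Longrightarrow> \<omega> \<in> space M \<Longrightarrow> 0 \<le> V c \<omega>"
    and "\<And>c. c \<in> I \<Longrightarrow> AE \<omega> in M. K c \<omega> = K' c \<omega>"
    and "\<And>c. c \<in> I \<Longrightarrow> AE \<omega> in M. V c \<omega> = V' c \<omega>"
  shows "cond_poisson M G I K' V'"
proof (rule cond_poisson_limit[where K = "\<lambda>_. K" and V = "\<lambda>_. V"])
  show "AE \<omega> in M. (\<lambda>n. V c \<omega>) \<longlonglongrightarrow> V' c \<omega>" if "c \<in> I" for c
    using assms(9)[OF that] by eventually_elim simp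
qed (use assms in auto)

text \<open>Measurability of \<open>V\<close> with respect to G makes the product of weights a
  candidate for the conditional expectation, which its integrals over events of G then
  characterise.\<close>

lemma cond_poisson_iff_cond_exp:
  assumes [measurable]: "\<And>c. c \<in> I \<Longrightarrow> K c \<in> borel_measurable M" "\<And>c. c \<in> I \<Longrightarrow> V c \<in> borel_measurable G"
    and V: "\<And>c \<omega>. c \<in> I \<Longrightarrow> \<omega> \<in> space M \<Longrightarrow> 0 \<le> V c \<omega>"
  shows "cond_poisson M G I K V \<longleftrightarrow>
    (\<forall>x. AE \<omega> in M. real_cond_exp M G (count_ind I K x) \<omega> = poisson_prod I V x \<omega>)"
proof -
  have [measurable]: "V c \<in> borel_measurable M" if "c \<in> I" for c
    using that by (intro G_measurable) simp
  have int: "integrable M (count_ind I K x)" "integrable M (poisson_prod I V x)" for x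
    using unit_mult_count_poisson[of "\<lambda>_. 1" I K I V] V by simp_all
  show ?thesis
  proof safe
    fix x assume cp: "cond_poisson M G I K V"
    show "AE \<omega> in M. real_cond_exp M G (count_ind I K x) \<omega> = poisson_prod I V x \<omega>"
      using cp int by (intro real_cond_exp_charact) (auto simp: cond_poisson_def set_lebesgue_integral_def)
  next
    assume ce: "\<forall>x. AE \<omega> in M. real_cond_exp M G (count_ind I K x) \<omega> = poisson_prod I V x \<omega>"
    show "cond_poisson M G I K V"
      unfolding cond_poisson_def
    proof (intro ballI allI)
      fix A and x :: "'b \<Rightarrow> nat" assume A: "A \<in> sets G"
      then have [measurable]: "A \<in> sets M" by (rule G_sets)
      have "(\<integral>\<omega>. indicator A \<omega> * count_ind I K x \<omega> \<partial>M) = (\<integral>\<omega>. indicator A \<omega> * real_cond_exp M G (count_ind I K x) \<omega> \<partial>M)"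
        using real_cond_exp_intA[OF int(1) A] by (simp add: set_lebesgue_integral_def)
      also have "\<dots> = (\<integral>\<omega>. indicator A \<omega> * poisson_prod I V x \<omega> \<partial>M)"
        by (rule integral_cong_AE) (use ce in \<open>auto intro: AE_mp\<close>)
      finally show "(\<integral>\<omega>. indicator A \<omega> * count_ind I K x \<omega> \<partial>M) = (\<integral>\<omega>. indicator A \<omega> * poisson_prod I V x \<omega> \<partial>M)" .
    qed
  qed
qed

text \<open>G-measurable factors can be pulled out of a conditional expectation, so events of G may
  be replaced by weights in [0,1]. The typical weight is the Poisson factor of a further
  set.\<close>

lemma cond_poisson_weighted:
  fixes g :: "'a \<Rightarrow> real"
  assumes cp: "cond_poisson M G I K V"
    and [measurable]: "\<And>c. c \<in> I \<Longrightarrow> K c \<in> borel_measurable M" "\<And>c. c \<in> I \<Longrightarrow> V c \<in> borel_measurable G"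
    and V: "\<And>c \<omega>. c \<in> I \<Longrightarrow> \<omega> \<in> space M \<Longrightarrow> 0 \<le> V c \<omega>"
    and [measurable]: "g \<in> borel_measurable G"
    and g: "\<And>\<omega>. \<omega> \<in> space M \<Longrightarrow> 0 \<le> g \<omega>" "\<And>\<omega>. \<omega> \<in> space M \<Longrightarrow> g \<omega> \<le> 1"
  shows "(\<integral>\<omega>. g \<omega> * count_ind I K x \<omega> \<partial>M) = (\<integral>\<omega>. g \<omega> * poisson_prod I V x \<omega> \<partial>M)"
proof -
  have [measurable]: "V c \<in> borel_measurable M" if "c \<in> I" for c
    using that by (intro G_measurable) simp
  have [measurable]: "g \<in> borel_measurable M"
    by (rule G_measurable) simp
  have ce: "AE \<omega> in M. real_cond_exp M G (count_ind I K x) \<omega> = poisson_prod I V x \<omega>"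
    using cond_poisson_iff_cond_exp[of I K V] cp V by simp
  have "(\<integral>\<omega>. g \<omega> * count_ind I K x \<omega> \<partial>M) = (\<integral>\<omega>. g \<omega> * real_cond_exp M G (count_ind I K x) \<omega> \<partial>M)"
    using unit_mult_count_poisson[of g I K I V] g V
    by (intro real_cond_exp_intg(2)[symmetric]) auto
  also have "\<dots> = (\<integral>\<omega>. g \<omega> * poisson_prod I V x \<omega> \<partial>M)"
    by (rule integral_cong_AE) (use ce in \<open>auto intro: AE_mp\<close>)
  finally show ?thesis .
qed

text \<open>Sum over all values of the coordinate that is dropped. The indicators of the values sum
  to 1 because the count is a natural number, and the Poisson weights sum to 1 as well.\<close>

lemma cond_poisson_marginal:
  assumes I: "finite I" "a \<notin> I"
    and cp: "cond_poisson M G (insert a I) K V"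
    and [measurable]: "\<And>c. c \<in> insert a I \<Longrightarrow> K c \<in> borel_measurable M" "\<And>c. c \<in> insert a I \<Longrightarrow> V c \<in> borel_measurable M"
    and V: "\<And>c \<omega>. c \<in> insert a I \<Longrightarrow> \<omega> \<in> space M \<Longrightarrow> 0 \<le> V c \<omega>"
    and K: "\<And>\<omega>. \<omega> \<in> space M \<Longrightarrow> K a \<omega> \<in> \<nat>"
  shows "cond_poisson M G I K V"
  unfolding cond_poisson_def
proof (intro ballI allI)
  fix A and x :: "'b \<Rightarrow> nat" assume A: "A \<in> sets G"
  then have [measurable]: "A \<in> sets M" by (rule G_sets)
  let ?f = "\<lambda>k \<omega>. indicator A \<omega> * count_ind (insert a I) K (x(a := k)) \<omega>"
  let ?g = "\<lambda>k \<omega>. indicator A \<omega> * poisson_prod (insert a I) V (x(a := k)) \<omega>"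
  have f: "?f k \<omega> = indicator A \<omega> * count_ind I K x \<omega> * indicator {real k} (K a \<omega>)" for k \<omega>
    using I by (auto simp: count_ind_def intro!: prod.cong)
  have g: "?g k \<omega> = indicator A \<omega> * poisson_prod I V x \<omega> * poisson_weight (V a \<omega>) k" for k \<omega>
    using I by (auto simp: poisson_prod_def intro!: prod.cong)
  have fs: "(\<lambda>n. \<Sum>k<n. ?f k \<omega>) \<longlonglongrightarrow> indicator A \<omega> * count_ind I K x \<omega>" if "\<omega> \<in> space M" for \<omega>
  proof -
    obtain m where m: "K a \<omega> = real m" using K[OF \<open>\<omega> \<in> space M\<close>] by (auto elim: Nats_cases)
    have "(\<lambda>k. indicator {real k} (K a \<omega>) :: real) = (\<lambda>k. if k = m then 1 else 0)"
      by (auto simp: m fun_eq_iff)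
    then have "(\<lambda>k. indicator {real k} (K a \<omega>) :: real) sums 1"
      using sums_single[of m "\<lambda>_. 1 :: real"] by simp
    from sums_mult[OF this, of "indicator A \<omega> * count_ind I K x \<omega>"] show ?thesis
      by (simp add: sums_def f)
  qed
  have gs: "(\<lambda>n. \<Sum>k<n. ?g k \<omega>) \<longlonglongrightarrow> indicator A \<omega> * poisson_prod I V x \<omega>" for \<omega>
    using sums_mult[OF poisson_weight_sums, of "indicator A \<omega> * poisson_prod I V x \<omega>" "V a \<omega>"]
    unfolding sums_def g by simp
  have fint: "integrable M (?f k)" and gint: "integrable M (?g k)" for k
    using V by (auto intro!: unit_mult_count_poisson[where V = V and J = "insert a I" and K = K and I = "insert a I"])
  \<comment> \<open>Partial sums with nonnegative terms stay below their limit, which gives the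
    constant 1 as a dominating function.\<close>
  have fb: "norm (\<Sum>k<n. ?f k \<omega>) \<le> 1" if "\<omega> \<in> space M" for n \<omega>
  proof -
    have "0 \<le> (\<Sum>k<n. ?f k \<omega>)" by (intro sum_nonneg) (auto simp: count_ind_nonneg)
    moreover have "(\<Sum>k<n. ?f k \<omega>) \<le> indicator A \<omega> * count_ind I K x \<omega>"
      by (rule incseq_le[OF incseq_SucI fs[OF that]]) (subst sum.lessThan_Suc, simp add: count_ind_nonneg)
    moreover have "indicator A \<omega> * count_ind I K x \<omega> \<le> 1"
      by (auto simp: count_ind_le_1 indicator_def)
    ultimately show ?thesis by simp
  qed
  have gb: "norm (\<Sum>k<n. ?g k \<omega>) \<le> 1" if "\<omega> \<in> space M" for n \<omega>
  proof -
    have nn: "0 \<le> ?g k \<omega>" for k using V that by (auto simp: indicator_def intro!: poisson_prod_nonneg)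
    have "0 \<le> (\<Sum>k<n. ?g k \<omega>)" using nn by (intro sum_nonneg) 
    moreover have "(\<Sum>k<n. ?g k \<omega>) \<le> indicator A \<omega> * poisson_prod I V x \<omega>"
      by (rule incseq_le[OF incseq_SucI gs]) (simp only: sum.lessThan_Suc le_add_same_cancel1 nn)
    moreover have "indicator A \<omega> * poisson_prod I V x \<omega> \<le> 1"
      using V that by (auto simp: indicator_def intro!: poisson_prod_le_1)
    ultimately show ?thesis by simp
  qed
  have "(\<lambda>n. \<integral>\<omega>. (\<Sum>k<n. ?f k \<omega>) \<partial>M) \<longlonglongrightarrow> (\<integral>\<omega>. indicator A \<omega> * count_ind I K x \<omega> \<partial>M)"
    by (rule integral_dominated_convergence[where w = "\<lambda>_. 1"]) (use fs fb in auto)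
  moreover have "(\<lambda>n. \<integral>\<omega>. (\<Sum>k<n. ?g k \<omega>) \<partial>M) \<longlonglongrightarrow> (\<integral>\<omega>. indicator A \<omega> * poisson_prod I V x \<omega> \<partial>M)"
    by (rule integral_dominated_convergence[where w = "\<lambda>_. 1"]) (use gs gb in auto)
  moreover have "(\<integral>\<omega>. (\<Sum>k<n. ?f k \<omega>) \<partial>M) = (\<integral>\<omega>. (\<Sum>k<n. ?g k \<omega>) \<partial>M)" for n
    unfolding Bochner_Integration.integral_sum[OF fint] Bochner_Integration.integral_sum[OF gint]
    using cp A by (intro sum.cong) (auto simp: cond_poisson_def)
  ultimately show "(\<integral>\<omega>. indicator A \<omega> * count_ind I K x \<omega> \<partial>M) = (\<integral>\<omega>. indicator A \<omega> * poisson_prod I V x \<omega> \<partial>M)"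
    by (auto intro: LIMSEQ_unique)
qed

text \<open>The cells in \<open>I1\<close> are distributed among the random sets \<open>j\<close>,
  where \<open>A j c\<close> is the event of G that \<open>c\<close> is allotted to
  \<open>j\<close>; the cells in \<open>I2\<close> remain coordinates of their own. Cells are moved
  into the sets one at a time. To treat a new cell it is first made a separate coordinate, which
  enlarges \<open>I2\<close>, and then summed out by convolution; hence the induction runs over
  arbitrary \<open>I2\<close>, \<open>B\<close>, \<open>x\<close> and \<open>y\<close>.\<close>

lemma cond_poisson_merge:
  fixes A :: "'j \<Rightarrow> 'i \<Rightarrow> 'a set" and N v :: "'i \<Rightarrow> 'a \<Rightarrow> real"
  assumes I1: "finite I1" and I2: "finite I2" and dis: "I1 \<inter> I2 = {}"
    and cp: "cond_poisson M G (I1 \<union> I2) N v"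
    and mN: "\<And>c. c \<in> I1 \<union> I2 \<Longrightarrow> N c \<in> borel_measurable M"
    and mv: "\<And>c. c \<in> I1 \<union> I2 \<Longrightarrow> v c \<in> borel_measurable M"
    and v: "\<And>c \<omega>. c \<in> I1 \<union> I2 \<Longrightarrow> \<omega> \<in> space M \<Longrightarrow> 0 \<le> v c \<omega>"
    and N: "\<And>c \<omega>. c \<in> I1 \<union> I2 \<Longrightarrow> \<omega> \<in> space M \<Longrightarrow> N c \<omega> \<in> \<nat>"
    and J: "finite J" and A: "\<And>j c. j \<in> J \<Longrightarrow> c \<in> I1 \<Longrightarrow> A j c \<in> sets G"
    and disA: "\<And>j j' c. j \<in> J \<Longrightarrow> j' \<in> J \<Longrightarrow> c \<in> I1 \<Longrightarrow> j \<noteq> j' \<Longrightarrow> A j c \<inter> A j' c = {}"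
    and B: "B \<in> sets G"
  shows "(\<integral>\<omega>. indicator B \<omega> * (count_ind J (\<lambda>j \<omega>. \<Sum>c\<in>I1. indicator (A j c) \<omega> * N c \<omega>) x \<omega> * count_ind I2 N y \<omega>) \<partial>M)
    = (\<integral>\<omega>. indicator B \<omega> * (poisson_prod J (\<lambda>j \<omega>. \<Sum>c\<in>I1. indicator (A j c) \<omega> * v c \<omega>) x \<omega> * poisson_prod I2 v y \<omega>) \<partial>M)"
  using I1 I2 dis cp mN mv v N A disA B
proof (induction I1 arbitrary: I2 B x y rule: finite_induct)
  case empty
  \<comment> \<open>Without cells every set has count 0 and mean 0, and the Poisson law with mean 0
    is the point mass at 0.\<close>
  have [simp]: "count_ind J (\<lambda>_ _. 0) x = (poisson_prod J (\<lambda>_ _. 0) x :: 'a \<Rightarrow> real)" for x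
    by (auto simp: count_ind_def[abs_def] poisson_prod_def[abs_def] poisson_weight_0 fun_eq_iff intro!: prod.cong)
  show ?case
  proof (cases "\<forall>j\<in>J. x j = 0")
    case True
    then have [simp]: "poisson_prod J (\<lambda>_ _. 0) x \<omega> = 1" for \<omega>
      by (simp add: poisson_prod_def poisson_weight_0)
    show ?thesis using empty.prems(3,10) by (simp add: cond_poisson_def)
  next
    case False
    then have [simp]: "poisson_prod J (\<lambda>_ _. 0) x \<omega> = 0" for \<omega>
      using J by (auto simp: poisson_prod_def poisson_weight_0)
    show ?thesis by simp
  qed
next
  case (insert a F)
  note [measurable] = insert.prems(4,5)
  have Am [measurable]: "A j c \<in> sets M" if "j \<in> J" "c \<in> insert a F" for j c
    using insert.prems(8)[OF that] by (rule G_sets)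
  define K where "K F j \<omega> = (\<Sum>c\<in>F. indicator (A j c) \<omega> * N c \<omega>)" for F j \<omega>
  define W where "W F j \<omega> = (\<Sum>c\<in>F. indicator (A j c) \<omega> * v c \<omega>)" for F j \<omega>
  have KW: "K (insert a F) j \<omega> = indicator (A j a) \<omega> * N a \<omega> + K F j \<omega>"
    "W (insert a F) j \<omega> = indicator (A j a) \<omega> * v a \<omega> + W F j \<omega>" for j \<omega>
    by (simp_all only: K_def W_def sum.insert[OF insert.hyps])
  have mK: "K F j \<in> borel_measurable M" "W F j \<in> borel_measurable M"
    "K (insert a F) j \<in> borel_measurable M" "W (insert a F) j \<in> borel_measurable M" if "j \<in> J" for j
    using that insert.prems(4,5) Am unfolding K_def[abs_def] W_def[abs_def]
    by (auto intro!: borel_measurable_sum borel_measurable_times borel_measurable_indicator)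
  have W0: "0 \<le> W F j \<omega>" "0 \<le> W (insert a F) j \<omega>" if "\<omega> \<in> space M" for j \<omega>
    unfolding W_def using insert.prems(6) that by (auto intro!: sum_nonneg)
  define f where "f C F x I y \<omega> = indicator C \<omega> * (count_ind J (K F) x \<omega> * count_ind I N y \<omega>)" for C F x I y \<omega>
  define g where "g C F x I y \<omega> = indicator C \<omega> * (poisson_prod J (W F) x \<omega> * poisson_prod I v y \<omega>)" for C F x I y \<omega>
  have int: "integrable M (f C F' x I y)" "integrable M (g C F' x I y)"
    if "C \<in> sets M" "I \<subseteq> insert a (F \<union> I2)" "F' \<in> {F, insert a F}" for C F' x I y
  proof -
    have [measurable]: "N c \<in> borel_measurable M" "v c \<in> borel_measurable M" if "c \<in> I" for c
      using that \<open>I \<subseteq> insert a (F \<union> I2)\<close> by auto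
    have [measurable]: "K F' j \<in> borel_measurable M" "W F' j \<in> borel_measurable M" if "j \<in> J" for j
      using that \<open>F' \<in> {F, insert a F}\<close> mK by auto
    have [measurable]: "C \<in> sets M" by fact
    have "0 \<le> v c \<omega>" if "c \<in> I" "\<omega> \<in> space M" for c \<omega>
      using that \<open>I \<subseteq> insert a (F \<union> I2)\<close> insert.prems(6) by auto
    moreover have "0 \<le> W F' j \<omega>" if "\<omega> \<in> space M" for j \<omega>
      using that W0 \<open>F' \<in> {F, insert a F}\<close> by auto
    ultimately show "integrable M (f C F' x I y)" "integrable M (g C F' x I y)"
      unfolding f_def[abs_def] g_def[abs_def]
      by (auto intro!: integrable_unit mult_nonneg_nonneg mult_le_one count_ind_nonneg count_ind_le_1
          poisson_prod_nonneg poisson_prod_le_1)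
  qed
  have IH: "(\<integral>\<omega>. f C F x I y \<omega> \<partial>M) = (\<integral>\<omega>. g C F x I y \<omega> \<partial>M)"
    if "finite I" "F \<inter> I = {}" "cond_poisson M G (F \<union> I) N v" "I \<subseteq> insert a (F \<union> I2)" "C \<in> sets G" for C I x y
    unfolding f_def g_def K_def W_def using that insert.prems
    by (intro insert.IH) auto
  have piece: "(\<integral>\<omega>. f (B \<inter> A j a) (insert a F) x I2 y \<omega> \<partial>M) = (\<integral>\<omega>. g (B \<inter> A j a) (insert a F) x I2 y \<omega> \<partial>M)"
    if j: "j \<in> J" for j
  proof -
    have other: "indicator (A j' a) \<omega> = (0::real)" if "\<omega> \<in> A j a" "j' \<in> J" "j' \<noteq> j" for \<omega> j'
      using insert.prems(9)[of j j' a] j that by (auto simp: indicator_def)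
    have Kj: "K (insert a F) j' \<omega> = K F j' \<omega>" "W (insert a F) j' \<omega> = W F j' \<omega>"
      if "\<omega> \<in> A j a" "j' \<in> J" "j' \<noteq> j" for \<omega> j'
      using other[OF that] by (simp_all add: KW)
    have Kj2: "K (insert a F) j \<omega> = N a \<omega> + K F j \<omega>" "W (insert a F) j \<omega> = v a \<omega> + W F j \<omega>" if "\<omega> \<in> A j a" for \<omega>
      using that by (simp_all add: KW)
    have a2: "a \<notin> I2" using insert.prems(2) by auto
    have cf: "count_ind (insert a I2) N (y(a := i)) \<omega> = indicator {real i} (N a \<omega>) * count_ind I2 N y \<omega>" for i \<omega>
      using a2 insert.prems(1) by (auto simp: count_ind_def intro!: prod.cong)
    have cg: "poisson_prod (insert a I2) v (y(a := i)) \<omega> = poisson_weight (v a \<omega>) i * poisson_prod I2 v y \<omega>" for i \<omega>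
      using a2 insert.prems(1) by (auto simp: poisson_prod_def intro!: prod.cong)
    have Jf: "count_ind J H x' \<omega> = indicator {real (x' j)} (H j \<omega>) * count_ind (J - {j}) H x' \<omega>" for H x' \<omega>
      unfolding count_ind_def using J j by (rule prod.remove)
    have Jg: "poisson_prod J H x' \<omega> = poisson_weight (H j \<omega>) (x' j) * poisson_prod (J - {j}) H x' \<omega>" for H x' \<omega>
      unfolding poisson_prod_def using J j by (rule prod.remove)
    \<comment> \<open>On \<open>A j a\<close> the cell \<open>a\<close> belongs to \<open>j\<close>
      and, by disjointness, to no other set. Splitting by its count \<open>i\<close> turns
      \<open>a\<close> into a coordinate of \<open>I2\<close> and leaves \<open>x j - i\<close> for
      the other cells of \<open>j\<close>; since \<open>i\<close> runs only up to
      \<open>x j\<close>, this subtraction never truncates.\<close>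
    have feq: "f (B \<inter> A j a) (insert a F) x I2 y \<omega>
        = (\<Sum>i\<le>x j. f (B \<inter> A j a) F (x(j := x j - i)) (insert a I2) (y(a := i)) \<omega>)" if "\<omega> \<in> space M" for \<omega>
    proof (cases "\<omega> \<in> B \<inter> A j a")
      case True
      obtain m where m: "N a \<omega> = real m" using insert.prems(7)[of a \<omega>] \<open>\<omega> \<in> space M\<close> by (auto elim: Nats_cases)
      have 1: "count_ind (J - {j}) (K (insert a F)) x \<omega> = count_ind (J - {j}) (K F) (x(j := i)) \<omega>" for i
        using True Kj by (auto simp: count_ind_def intro!: prod.cong)
      have "(\<Sum>i\<le>x j. indicator {real (x j - i)} (K F j \<omega>) * indicator {real i} (N a \<omega>) :: real)
          = (\<Sum>i\<le>x j. if i = m then indicator {real (x j - m)} (K F j \<omega>) else 0)"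
        by (intro sum.cong) (auto simp: m)
      also have "\<dots> = indicator {real (x j)} (K (insert a F) j \<omega>)"
      proof -
        \<comment> \<open>That the remaining count is nonnegative is needed when \<open>m\<close>
          exceeds \<open>x j\<close>: then both sides must vanish.\<close>
        obtain k where k: "K F j \<omega> = real k"
        proof -
          have "K F j \<omega> \<in> \<nat>"
            unfolding K_def using insert.prems(7) \<open>\<omega> \<in> space M\<close>
            by (intro sum_Nats) (auto simp: indicator_def)
          then show ?thesis using that by (auto elim: Nats_cases)
        qed
        show ?thesis using True by (auto simp: Kj2 m k indicator_def)
      qed
      finally have 2: "indicator {real (x j)} (K (insert a F) j \<omega>)
          = (\<Sum>i\<le>x j. indicator {real (x j - i)} (K F j \<omega>) * indicator {real i} (N a \<omega>) :: real)" ..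
      have "f (B \<inter> A j a) (insert a F) x I2 y \<omega>
          = (\<Sum>i\<le>x j. indicator {real (x j - i)} (K F j \<omega>) * indicator {real i} (N a \<omega>))
            * (count_ind (J - {j}) (K (insert a F)) x \<omega> * count_ind I2 N y \<omega>)"
        using True by (simp only: f_def Jf 2[symmetric] indicator_simps mult.assoc mult_1_left)
      also have "\<dots> = (\<Sum>i\<le>x j. f (B \<inter> A j a) F (x(j := x j - i)) (insert a I2) (y(a := i)) \<omega>)"
        unfolding sum_distrib_right
        by (rule sum.cong[OF refl], unfold f_def Jf cf 1[symmetric] fun_upd_same indicator_simps(1)[OF True]) (simp only: mult_ac mult_1_left mult_1_right)
      finally show ?thesis .
    qed (simp add: f_def)
    have geq: "g (B \<inter> A j a) (insert a F) x I2 y \<omega>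
        = (\<Sum>i\<le>x j. g (B \<inter> A j a) F (x(j := x j - i)) (insert a I2) (y(a := i)) \<omega>)" for \<omega>
    proof (cases "\<omega> \<in> B \<inter> A j a")
      case True
      have 1: "poisson_prod (J - {j}) (W (insert a F)) x \<omega> = poisson_prod (J - {j}) (W F) (x(j := i)) \<omega>" for i
        using True Kj by (auto simp: poisson_prod_def intro!: prod.cong)
      have 2: "poisson_weight (W (insert a F) j \<omega>) (x j)
          = (\<Sum>i\<le>x j. poisson_weight (v a \<omega>) i * poisson_weight (W F j \<omega>) (x j - i))"
        using True by (simp add: Kj2 poisson_weight_add)
      have "g (B \<inter> A j a) (insert a F) x I2 y \<omega>
          = (\<Sum>i\<le>x j. poisson_weight (v a \<omega>) i * poisson_weight (W F j \<omega>) (x j - i))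
            * (poisson_prod (J - {j}) (W (insert a F)) x \<omega> * poisson_prod I2 v y \<omega>)"
        using True by (simp only: g_def Jg 2[symmetric] indicator_simps mult.assoc mult_1_left)
      also have "\<dots> = (\<Sum>i\<le>x j. g (B \<inter> A j a) F (x(j := x j - i)) (insert a I2) (y(a := i)) \<omega>)"
        unfolding sum_distrib_right
        by (rule sum.cong[OF refl], unfold g_def Jg cg 1[symmetric] fun_upd_same indicator_simps(1)[OF True]) (simp only: mult_ac mult_1_left mult_1_right)
      finally show ?thesis .
    qed (simp add: g_def)
    have C: "B \<inter> A j a \<in> sets G" using insert.prems(8,10) j by auto
    have "(\<integral>\<omega>. f (B \<inter> A j a) (insert a F) x I2 y \<omega> \<partial>M)
        = (\<integral>\<omega>. (\<Sum>i\<le>x j. f (B \<inter> A j a) F (x(j := x j - i)) (insert a I2) (y(a := i)) \<omega>) \<partial>M)"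
      by (rule Bochner_Integration.integral_cong) (simp_all add: feq)
    also have "\<dots> = (\<Sum>i\<le>x j. \<integral>\<omega>. f (B \<inter> A j a) F (x(j := x j - i)) (insert a I2) (y(a := i)) \<omega> \<partial>M)"
      using C by (intro Bochner_Integration.integral_sum int) (auto intro: G_sets)
    also have "\<dots> = (\<Sum>i\<le>x j. \<integral>\<omega>. g (B \<inter> A j a) F (x(j := x j - i)) (insert a I2) (y(a := i)) \<omega> \<partial>M)"
      proof (intro sum.cong refl IH)
      show "finite (insert a I2)" "F \<inter> insert a I2 = {}" "insert a I2 \<subseteq> insert a (F \<union> I2)" "B \<inter> A j a \<in> sets G"
        using insert.prems(1,2) insert.hyps C by auto
      show "cond_poisson M G (F \<union> insert a I2) N v"
        using insert.prems(3) by simp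
    qed
    also have "\<dots> = (\<integral>\<omega>. (\<Sum>i\<le>x j. g (B \<inter> A j a) F (x(j := x j - i)) (insert a I2) (y(a := i)) \<omega>) \<partial>M)"
      using C by (intro Bochner_Integration.integral_sum[symmetric] int) (auto intro: G_sets)
    also have "\<dots> = (\<integral>\<omega>. g (B \<inter> A j a) (insert a F) x I2 y \<omega> \<partial>M)"
      by (simp add: geq)
    finally show ?thesis .
  qed
  \<comment> \<open>Where the cell \<open>a\<close> is allotted to no set, its count is discarded by
    passing to a marginal. Together with the pieces \<open>B \<inter> A j a\<close> this partitions
    \<open>B\<close>.\<close>
  define R where "R = B - (\<Union>j\<in>J. A j a)"
  have R: "R \<in> sets G"
    unfolding R_def using insert.prems(8,10) J by (intro sets.Diff sets.finite_UN) auto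
  have rest: "(\<integral>\<omega>. f R (insert a F) x I2 y \<omega> \<partial>M) = (\<integral>\<omega>. g R (insert a F) x I2 y \<omega> \<partial>M)"
  proof -
    have eq: "K (insert a F) j \<omega> = K F j \<omega>" "W (insert a F) j \<omega> = W F j \<omega>" if "\<omega> \<in> R" "j \<in> J" for j \<omega>
      using that by (simp_all add: KW R_def)
    have "f R (insert a F) x I2 y \<omega> = f R F x I2 y \<omega>" "g R (insert a F) x I2 y \<omega> = g R F x I2 y \<omega>" for \<omega>
      using eq by (auto simp: f_def g_def indicator_def intro!: count_ind_cong poisson_prod_cong)
    moreover have "cond_poisson M G (F \<union> I2) N v"
      proof (rule cond_poisson_marginal[of _ a])
      show "finite (F \<union> I2)" "a \<notin> F \<union> I2"
        using insert.prems(1,2) insert.hyps by auto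
      show "cond_poisson M G (insert a (F \<union> I2)) N v"
        using insert.prems(3) by simp
    qed (use insert.prems(4,5,6,7) in \<open>simp_all\<close>)
    ultimately show ?thesis
      using IH[of I2 R] insert.prems(1,2) R by auto
  qed
  have split: "indicator B \<omega> = (\<Sum>j\<in>J. indicator (B \<inter> A j a) \<omega>) + (indicator R \<omega> :: real)" for \<omega>
  proof (cases "\<exists>j\<in>J. \<omega> \<in> A j a")
    case True
    then obtain j where j: "j \<in> J" "\<omega> \<in> A j a" by auto
    have "(\<Sum>j\<in>J. indicator (B \<inter> A j a) \<omega> :: real) = (\<Sum>j'\<in>J. if j' = j then indicator B \<omega> else 0)"
      using j insert.prems(9)[of j _ a] by (intro sum.cong) (auto simp: indicator_def)
    then show ?thesis using j J by (auto simp: R_def indicator_def)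
  next
    case False
    then show ?thesis by (auto simp: R_def indicator_def)
  qed
  have Bm: "B \<inter> A j a \<in> sets M" if "j \<in> J" for j
    using insert.prems(8,10) that by (intro G_sets) auto
  have "(\<integral>\<omega>. f B (insert a F) x I2 y \<omega> \<partial>M)
      = (\<Sum>j\<in>J. \<integral>\<omega>. f (B \<inter> A j a) (insert a F) x I2 y \<omega> \<partial>M) + (\<integral>\<omega>. f R (insert a F) x I2 y \<omega> \<partial>M)"
  proof -
    have "f B (insert a F) x I2 y \<omega> = (\<Sum>j\<in>J. f (B \<inter> A j a) (insert a F) x I2 y \<omega>) + f R (insert a F) x I2 y \<omega>" for \<omega>
      unfolding f_def split[of \<omega>] by (simp only: sum_distrib_right distrib_right)
    then have "(\<integral>\<omega>. f B (insert a F) x I2 y \<omega> \<partial>M)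
        = (\<integral>\<omega>. (\<Sum>j\<in>J. f (B \<inter> A j a) (insert a F) x I2 y \<omega>) + f R (insert a F) x I2 y \<omega> \<partial>M)"
      by simp
    moreover have i: "integrable M (f (B \<inter> A j a) (insert a F) x I2 y)" if "j \<in> J" for j
      using Bm[OF that] by (intro int) auto
    moreover have "integrable M (f R (insert a F) x I2 y)"
      using G_sets[OF R] by (intro int) auto
    ultimately show ?thesis
      by (simp add: Bochner_Integration.integral_add Bochner_Integration.integral_sum Bochner_Integration.integrable_sum)
  qed
  also have "\<dots> = (\<Sum>j\<in>J. \<integral>\<omega>. g (B \<inter> A j a) (insert a F) x I2 y \<omega> \<partial>M) + (\<integral>\<omega>. g R (insert a F) x I2 y \<omega> \<partial>M)"
    using piece rest by simp
  also have "\<dots> = (\<integral>\<omega>. g B (insert a F) x I2 y \<omega> \<partial>M)"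
  proof -
    have "g B (insert a F) x I2 y \<omega> = (\<Sum>j\<in>J. g (B \<inter> A j a) (insert a F) x I2 y \<omega>) + g R (insert a F) x I2 y \<omega>" for \<omega>
      unfolding g_def split[of \<omega>] by (simp only: sum_distrib_right distrib_right)
    then have "(\<integral>\<omega>. g B (insert a F) x I2 y \<omega> \<partial>M)
        = (\<integral>\<omega>. (\<Sum>j\<in>J. g (B \<inter> A j a) (insert a F) x I2 y \<omega>) + g R (insert a F) x I2 y \<omega> \<partial>M)"
      by simp
    moreover have i: "integrable M (g (B \<inter> A j a) (insert a F) x I2 y)" if "j \<in> J" for j
      using Bm[OF that] by (intro int) auto
    moreover have "integrable M (g R (insert a F) x I2 y)"
      using G_sets[OF R] by (intro int) auto
    ultimately show ?thesis
      by (simp add: Bochner_Integration.integral_add Bochner_Integration.integral_sum Bochner_Integration.integrable_sum)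
  qed
  finally show ?case
    by (simp only: f_def g_def K_def[abs_def] W_def[abs_def])
qed

end

section \<open>Kernels of finite measures and sections of product-measurable sets\<close>

definition finite_kernel :: "'a measure \<Rightarrow> ('a \<Rightarrow> (real \<times> real) measure) \<Rightarrow> bool" where
  "finite_kernel M R \<longleftrightarrow> (\<forall>\<omega>\<in>space M. finite_measure (R \<omega>) \<and> sets (R \<omega>) = sets borel) \<and>
     (\<forall>B\<in>sets borel. (\<lambda>\<omega>. measure (R \<omega>) B) \<in> borel_measurable M)"

lemma finite_kernelD:
  assumes "finite_kernel M R" "\<omega> \<in> space M"
  shows "finite_measure (R \<omega>)" "sets (R \<omega>) = sets borel" "space (R \<omega>) = UNIV"
  using assms sets_eq_imp_space_eq[of "R \<omega>" borel] by (auto simp: finite_kernel_def)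

lemma section_borel: "S \<in> sets (M \<Otimes>\<^sub>M borel) \<Longrightarrow> Pair \<omega> -` S \<in> sets borel"
  by (rule sets_Pair1)

text \<open>Random sets are sections of product-measurable sets. A Dynkin argument starts from
  rectangles; finiteness turns complements into differences.\<close>

lemma finite_kernel_section_measurable:
  assumes R: "finite_kernel M R" and S: "S \<in> sets (M \<Otimes>\<^sub>M borel)"
  shows "(\<lambda>\<omega>. measure (R \<omega>) (Pair \<omega> -` S)) \<in> borel_measurable M"
proof -
  let ?E = "{a \<times> b |a b. a \<in> sets M \<and> b \<in> sets (borel :: (real \<times> real) measure)}"
  have mem: "S \<in> sigma_sets (space M \<times> UNIV) ?E"
    using S by (simp add: sets_pair_measure)
  have cl: "?E \<subseteq> Pow (space M \<times> UNIV)" using sets.space_closed[of M] by auto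
  from Int_stable_pair_measure_generator[of M borel] cl mem show ?thesis
  proof (induction rule: sigma_sets_induct_disjoint)
    case (basic S)
    then obtain A B where AB: "S = A \<times> B" "A \<in> sets M" "B \<in> sets borel" by auto
    have "(\<lambda>\<omega>. measure (R \<omega>) (Pair \<omega> -` S)) = (\<lambda>\<omega>. if \<omega> \<in> A then measure (R \<omega>) B else 0)"
      by (auto simp: AB fun_eq_iff)
    moreover have "(\<lambda>\<omega>. measure (R \<omega>) B) \<in> borel_measurable M"
      using R AB by (simp add: finite_kernel_def)
    ultimately show ?case using AB(2) by simp
  next
    case (compl S)
    then have S: "S \<in> sets (M \<Otimes>\<^sub>M borel)" by (simp add: sets_pair_measure)
    have "(\<lambda>\<omega>. measure (R \<omega>) UNIV - measure (R \<omega>) (Pair \<omega> -` S)) \<in> borel_measurable M"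
      using compl R by (intro borel_measurable_diff) (auto simp: finite_kernel_def)
    also have "?this \<longleftrightarrow> ?case"
    proof (rule measurable_cong)
      fix \<omega> assume w: "\<omega> \<in> space M"
      then interpret finite_measure "R \<omega>" using R by (simp add: finite_kernel_def)
      have "Pair \<omega> -` (space M \<times> UNIV - S) = UNIV - Pair \<omega> -` S" using w by auto
      then show "measure (R \<omega>) UNIV - measure (R \<omega>) (Pair \<omega> -` S) = measure (R \<omega>) (Pair \<omega> -` (space M \<times> UNIV - S))"
        using finite_measure_compl[of "Pair \<omega> -` S"] finite_kernelD[OF R w] section_borel[OF S] by simp
    qed
    finally show ?case .
  next
    case (union S)
    have S: "S i \<in> sets (M \<Otimes>\<^sub>M borel)" for i using union(2) by (auto simp: sets_pair_measure)
    have "(\<lambda>\<omega>. \<Sum>i. measure (R \<omega>) (Pair \<omega> -` S i)) \<in> borel_measurable M"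
      using union by (intro borel_measurable_suminf) auto
    also have "?this \<longleftrightarrow> ?case"
    proof (rule measurable_cong)
      fix \<omega> assume w: "\<omega> \<in> space M"
      then interpret finite_measure "R \<omega>" using R by (simp add: finite_kernel_def)
      have "disjoint_family (\<lambda>i. Pair \<omega> -` S i)"
        using union(1) by (auto simp: disjoint_family_on_def)
      then have "(\<lambda>i. measure (R \<omega>) (Pair \<omega> -` S i)) sums measure (R \<omega>) (\<Union>i. Pair \<omega> -` S i)"
        using finite_kernelD[OF R w] section_borel[OF S] by (intro finite_measure_UNION) auto
      then show "(\<Sum>i. measure (R \<omega>) (Pair \<omega> -` S i)) = measure (R \<omega>) (Pair \<omega> -` (\<Union>i. S i))"
        by (simp add: vimage_UN sums_iff)
    qed
    finally show ?case .
  qed auto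
qed

subsection \<open>Dyadic cells\<close>

text \<open>Rounding up gives each cell the form \<open>((c-1)/2^n, c/2^n]\<close> in both
  coordinates, open on the left like the rectangles of the increments.\<close>

definition idx :: "nat \<Rightarrow> real \<times> real \<Rightarrow> int \<times> int" where
  "idx n p = (\<lceil>2 ^ n * fst p\<rceil>, \<lceil>2 ^ n * snd p\<rceil>)"

text \<open>For every integer \<open>k\<close>, negative ones included, \<open>(k + 1) div 2\<close>
  is \<open>k/2\<close> rounded up, which is the index of the surrounding cell one level
  below.\<close>

definition coarsen :: "int \<times> int \<Rightarrow> int \<times> int" where
  "coarsen c = ((fst c + 1) div 2, (snd c + 1) div 2)"

lemma idx_vimage_borel [measurable, simp]: "idx n -` S \<in> sets borel"
proof -
  have cell: "idx n -` {c} \<in> sets borel" for c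
  proof -
    have [measurable]: "(\<lambda>p :: real \<times> real. 2 ^ n * fst p) \<in> borel_measurable borel" "(\<lambda>p :: real \<times> real. 2 ^ n * snd p) \<in> borel_measurable borel"
      by (intro borel_measurable_continuous_onI continuous_intros)+
    have "{p \<in> space borel. real_of_int (fst c) - 1 < 2 ^ n * fst p \<and> 2 ^ n * fst p \<le> real_of_int (fst c)
        \<and> real_of_int (snd c) - 1 < 2 ^ n * snd p \<and> 2 ^ n * snd p \<le> real_of_int (snd c)} \<in> sets (borel :: (real \<times> real) measure)"
      by measurable
    also have "{p \<in> space borel. real_of_int (fst c) - 1 < 2 ^ n * fst p \<and> 2 ^ n * fst p \<le> real_of_int (fst c)
        \<and> real_of_int (snd c) - 1 < 2 ^ n * snd p \<and> 2 ^ n * snd p \<le> real_of_int (snd c)} = idx n -` {c}"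
      by (auto simp: idx_def ceiling_eq_iff prod_eq_iff)
    finally show ?thesis .
  qed
  have "idx n -` S = (\<Union>c\<in>S. idx n -` {c})" by auto
  also have "\<dots> \<in> sets borel" using cell by (intro sets.countable_UN') auto
  finally show ?thesis .
qed

lemma idx_onto: "\<exists>p. idx n p = c"
  by (rule exI[of _ "(of_int (fst c) / 2 ^ n, of_int (snd c) / 2 ^ n)"]) (simp add: idx_def)

lemma ceiling_half: "\<lceil>x::real\<rceil> = (\<lceil>2 * x\<rceil> + 1) div 2"
  by (rule ceiling_unique) linarith+

lemma idx_coarsen: "idx n p = coarsen (idx (Suc n) p)"
  unfolding idx_def coarsen_def using ceiling_half[of "2 ^ n * fst p"] ceiling_half[of "2 ^ n * snd p"]
  by (simp add: mult.assoc)

text \<open>Random unions of level-\<open>n\<close> cells, in which the cell \<open>c\<close> is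
  present exactly on the event \<open>A c\<close> of G.\<close>

definition dyadic_level :: "'a measure \<Rightarrow> nat \<Rightarrow> ('a \<times> real \<times> real) set set" where
  "dyadic_level G n = {{(\<omega>, p). \<omega> \<in> A (idx n p)} |A. \<forall>c. A c \<in> sets G}"

definition dyadic_sets :: "'a measure \<Rightarrow> ('a \<times> real \<times> real) set set" where
  "dyadic_sets G = (\<Union>n. dyadic_level G n)"

text \<open>All subcells of a cell inherit its selecting event.\<close>

lemma dyadic_level_mono: "m \<le> n \<Longrightarrow> dyadic_level G m \<subseteq> dyadic_level G n"
proof (induction rule: dec_induct)
  case (step n)
  have "D \<in> dyadic_level G (Suc n)" if D: "D \<in> dyadic_level G n" for D
  proof -
    obtain A where A: "\<And>c. A c \<in> sets G" "D = {(\<omega>, p). \<omega> \<in> A (idx n p)}"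
      using D by (auto simp: dyadic_level_def)
    have "D = {(\<omega>, p). \<omega> \<in> A (coarsen (idx (Suc n) p))}"
      unfolding A(2) idx_coarsen[of n] ..
    then show ?thesis
      unfolding dyadic_level_def mem_Collect_eq using A(1) by (intro exI[of _ "\<lambda>c. A (coarsen c)"] conjI allI)
  qed
  with step show ?case by blast
qed simp

lemma dyadic_level_compl: "D \<in> dyadic_level G n \<Longrightarrow> space G \<times> UNIV - D \<in> dyadic_level G n"
  unfolding dyadic_level_def
  by clarify (rule_tac x = "\<lambda>c. space G - A c" in exI, auto)

lemma dyadic_level_Un: "D \<in> dyadic_level G n \<Longrightarrow> E \<in> dyadic_level G n \<Longrightarrow> D \<union> E \<in> dyadic_level G n"
  unfolding dyadic_level_def
  by clarify (rule_tac x = "\<lambda>c. A c \<union> Aa c" in exI, auto)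

lemma dyadic_level_Diff: "D \<in> dyadic_level G n \<Longrightarrow> E \<in> dyadic_level G n \<Longrightarrow> D - E \<in> dyadic_level G n"
  unfolding dyadic_level_def
  by clarify (rule_tac x = "\<lambda>c. A c - Aa c" in exI, auto)

lemma dyadic_level_empty: "{} \<in> dyadic_level G n"
  unfolding dyadic_level_def by (auto intro!: exI[of _ "\<lambda>_. {}"])

lemma dyadic_level_UN:
  "finite I \<Longrightarrow> (\<And>i. i \<in> I \<Longrightarrow> D i \<in> dyadic_level G n) \<Longrightarrow> (\<Union>i\<in>I. D i) \<in> dyadic_level G n"
  by (induction I rule: finite_induct) (auto simp: dyadic_level_empty dyadic_level_Un)

lemma dyadic_sets_common_level:
  assumes "finite I" "\<And>i. i \<in> I \<Longrightarrow> D i \<in> dyadic_sets G"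
  shows "\<exists>n. \<forall>i\<in>I. D i \<in> dyadic_level G n"
proof -
  have "\<forall>i\<in>I. \<exists>n. D i \<in> dyadic_level G n"
    using assms(2) by (simp add: dyadic_sets_def)
  from bchoice[OF this] obtain n where n: "\<And>i. i \<in> I \<Longrightarrow> D i \<in> dyadic_level G (n i)"
    by blast
  have "D i \<in> dyadic_level G (Max (n ` I))" if "i \<in> I" for i
    using n[OF that] dyadic_level_mono[of "n i" "Max (n ` I)" G] that assms(1) by auto
  then show ?thesis by blast
qed

lemma dyadic_sets_measurable: "D \<in> dyadic_sets G \<Longrightarrow> D \<in> sets (G \<Otimes>\<^sub>M borel)"
proof -
  assume "D \<in> dyadic_sets G"
  then obtain n A where A: "\<And>c. A c \<in> sets G" "D = {(\<omega>, p). \<omega> \<in> A (idx n p)}"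
    by (auto simp: dyadic_sets_def dyadic_level_def)
  then have "D = (\<Union>c. A c \<times> idx n -` {c})" by auto
  also have "\<dots> \<in> sets (G \<Otimes>\<^sub>M borel)"
    using A(1) by (intro sets.countable_UN' pair_measureI) auto
  finally show ?thesis .
qed

text \<open>Borel sets are generated by lower left quadrants. Such a quadrant is a countable
  intersection of unions of cells, because two reals are ordered exactly if their indices are
  ordered at every level.\<close>

lemma dyadic_sets_generate:
  "sets (G \<Otimes>\<^sub>M (borel :: (real \<times> real) measure)) \<subseteq> sigma_sets (space G \<times> UNIV) (dyadic_sets G)"
proof -
  have sub: "dyadic_sets G \<subseteq> Pow (space G \<times> UNIV)"
    using dyadic_sets_measurable[of _ G] sets.sets_into_space[of _ "G \<Otimes>\<^sub>M borel"] by (auto simp: space_pair_measure)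
  interpret S: sigma_algebra "space G \<times> UNIV" "sigma_sets (space G \<times> UNIV) (dyadic_sets G)"
    by (rule sigma_algebra_sigma_sets[OF sub])
  have cell: "A \<times> idx n -` C \<in> dyadic_sets G" if "A \<in> sets G" for A n C
    using that unfolding dyadic_sets_def dyadic_level_def
    by (auto intro!: exI[of _ n] exI[of _ "\<lambda>c. if c \<in> C then A else {}"] split: if_splits)
  have rect: "A \<times> B \<in> sigma_sets (space G \<times> UNIV) (dyadic_sets G)" if A: "A \<in> sets G" and B: "B \<in> sets borel" for A and B :: "(real \<times> real) set"
  proof -
    have "B \<in> sigma_sets UNIV (range (\<lambda>a. {..a}))"
      using B by (subst (asm) borel_eq_atMost) simp
    then show ?thesis
    proof (induction B rule: sigma_sets.induct)
      case (Basic B)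
      then obtain a b where ab: "B = {..(a, b)}" by auto
      have le: "x \<le> y \<longleftrightarrow> (\<forall>n. \<lceil>2 ^ n * x\<rceil> \<le> \<lceil>2 ^ n * y\<rceil>)" for x y :: real
      proof safe
        assume *: "\<forall>n. \<lceil>2 ^ n * x\<rceil> \<le> \<lceil>2 ^ n * y\<rceil>"
        show "x \<le> y"
        proof (rule ccontr)
          assume "\<not> x \<le> y"
          \<comment> \<open>At this level the two points are more than one cell width apart, so
            their indices differ.\<close>
          then obtain n :: nat where n: "1 / (x - y) < 2 ^ n"
            using real_arch_pow[of 2 "1 / (x - y)"] by auto
          then have "2 ^ n * x > 2 ^ n * y + 1"
            using \<open>\<not> x \<le> y\<close> by (simp add: field_simps)
          then show False using *[rule_format, of n] by linarith
        qed
      qed (simp add: ceiling_mono)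
      have "A \<times> B = (\<Inter>n. A \<times> idx n -` {(i, j). i \<le> \<lceil>2 ^ n * a\<rceil> \<and> j \<le> \<lceil>2 ^ n * b\<rceil>})"
        using le by (auto simp: ab idx_def)
      also have "\<dots> \<in> sigma_sets (space G \<times> UNIV) (dyadic_sets G)"
        using cell[OF A] by (intro S.countable_INT) auto
      finally show ?case .
    next
      case Empty
      then show ?case by (simp add: sigma_sets.Empty)
    next
      case (Compl B)
      have "A \<times> (UNIV - B) = A \<times> idx 0 -` UNIV - A \<times> B" by auto
      also have "\<dots> \<in> sigma_sets (space G \<times> UNIV) (dyadic_sets G)"
        using Compl.IH sigma_sets.Basic[OF cell[OF A, of 0 UNIV]] by (intro S.Diff)
      finally show ?case .
    next
      case (Union B)
      have "A \<times> (\<Union>i. B i) = (\<Union>i. A \<times> B i)" by auto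
      then show ?case using Union.IH by (auto intro: sigma_sets.Union)
    qed
  qed
  show ?thesis
    using rect unfolding sets_pair_measure space_borel by (intro sigma_sets_mono) auto
qed

section \<open>Approximation of random sets by dyadic ones\<close>

locale cox_kernels = cond_prob +
  fixes Z V :: "'a \<Rightarrow> (real \<times> real) measure"
  assumes Z: "finite_kernel M Z" and VG: "finite_kernel G V"
begin

lemma V: "finite_kernel M V"
  using VG G_space by (auto simp: finite_kernel_def intro: G_measurable)

text \<open>The normalised total mass, kept as a plain set function: monotonicity, finite
  subadditivity and continuity along sequences decreasing to the empty set are enough. The summand 1
  keeps the denominator positive.\<close>

definition \<rho> :: "'a \<Rightarrow> (real \<times> real) set \<Rightarrow> real" where
  "\<rho> \<omega> B = (measure (Z \<omega>) B + measure (V \<omega>) B) / (1 + (measure (Z \<omega>) UNIV + measure (V \<omega>) UNIV))"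

lemma \<rho>_nonneg: "0 \<le> \<rho> \<omega> B"
  by (simp add: \<rho>_def)

lemma \<rho>_le_1: "\<omega> \<in> space M \<Longrightarrow> \<rho> \<omega> B \<le> 1"
proof -
  assume w: "\<omega> \<in> space M"
  interpret Z: finite_measure "Z \<omega>" using finite_kernelD[OF Z w] by simp
  interpret V: finite_measure "V \<omega>" using finite_kernelD[OF V w] by simp
  have "measure (Z \<omega>) B \<le> measure (Z \<omega>) UNIV" "measure (V \<omega>) B \<le> measure (V \<omega>) UNIV"
    using Z.bounded_measure[of B] V.bounded_measure[of B] finite_kernelD[OF Z w] finite_kernelD[OF V w] by simp_all
  then show ?thesis
    unfolding \<rho>_def by (subst divide_le_eq_1_pos) (auto intro: add_pos_nonneg)
qed

lemma \<rho>_mono: "\<omega> \<in> space M \<Longrightarrow> A \<subseteq> B \<Longrightarrow> B \<in> sets borel \<Longrightarrow> \<rho> \<omega> A \<le> \<rho> \<omega> B"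
proof -
  assume w: "\<omega> \<in> space M" and AB: "A \<subseteq> B" "B \<in> sets borel"
  interpret Z: finite_measure "Z \<omega>" using finite_kernelD[OF Z w] by simp
  interpret V: finite_measure "V \<omega>" using finite_kernelD[OF V w] by simp
  show ?thesis
    unfolding \<rho>_def using AB finite_kernelD[OF Z w] finite_kernelD[OF V w]
    by (intro divide_right_mono add_mono Z.finite_measure_mono V.finite_measure_mono) auto
qed

lemma \<rho>_Un_le: "\<omega> \<in> space M \<Longrightarrow> A \<in> sets borel \<Longrightarrow> B \<in> sets borel \<Longrightarrow> \<rho> \<omega> (A \<union> B) \<le> \<rho> \<omega> A + \<rho> \<omega> B"
proof -
  assume w: "\<omega> \<in> space M" and AB: "A \<in> sets borel" "B \<in> sets borel"
  interpret Z: finite_measure "Z \<omega>" using finite_kernelD[OF Z w] by simp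
  interpret V: finite_measure "V \<omega>" using finite_kernelD[OF V w] by simp
  have "measure (Z \<omega>) (A \<union> B) \<le> measure (Z \<omega>) A + measure (Z \<omega>) B"
    "measure (V \<omega>) (A \<union> B) \<le> measure (V \<omega>) A + measure (V \<omega>) B"
    using AB finite_kernelD[OF Z w] finite_kernelD[OF V w] by (auto intro!: measure_Un_le)
  then show ?thesis
    unfolding \<rho>_def add_divide_distrib[symmetric] by (intro divide_right_mono) auto
qed

lemma \<rho>_UN_le:
  assumes "finite I" "\<omega> \<in> space M" "\<And>i. i \<in> I \<Longrightarrow> A i \<in> sets borel"
  shows "\<rho> \<omega> (\<Union>i\<in>I. A i) \<le> (\<Sum>i\<in>I. \<rho> \<omega> (A i))"
  using assms
proof (induction I rule: finite_induct)
  case (insert a I)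
  have "\<rho> \<omega> (A a \<union> (\<Union>i\<in>I. A i)) \<le> \<rho> \<omega> (A a) + \<rho> \<omega> (\<Union>i\<in>I. A i)"
    using insert by (intro \<rho>_Un_le) auto
  then show ?case using insert by simp
qed (simp add: \<rho>_def)

lemma \<rho>_decseq:
  assumes w: "\<omega> \<in> space M" and "\<And>n. A n \<in> sets borel" "decseq A" "(\<Inter>n. A n) = {}"
  shows "(\<lambda>n. \<rho> \<omega> (A n)) \<longlonglongrightarrow> 0"
proof -
  interpret Z: finite_measure "Z \<omega>" using finite_kernelD[OF Z w] by simp
  interpret V: finite_measure "V \<omega>" using finite_kernelD[OF V w] by simp
  have "(\<lambda>n. measure (Z \<omega>) (A n)) \<longlonglongrightarrow> 0" "(\<lambda>n. measure (V \<omega>) (A n)) \<longlonglongrightarrow> 0"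
    using Z.finite_Lim_measure_decseq[of A] V.finite_Lim_measure_decseq[of A] assms
      finite_kernelD[OF Z w] finite_kernelD[OF V w] by auto
  then have "(\<lambda>n. \<rho> \<omega> (A n)) \<longlonglongrightarrow> (0 + 0) / (1 + (measure (Z \<omega>) UNIV + measure (V \<omega>) UNIV))"
    unfolding \<rho>_def by (intro tendsto_intros) (auto simp: add_nonneg_eq_0_iff add_pos_nonneg intro!: less_imp_neq[symmetric])
  then show ?thesis by simp
qed

lemma \<rho>_measurable [measurable]:
  "S \<in> sets (G \<Otimes>\<^sub>M borel) \<Longrightarrow> (\<lambda>\<omega>. \<rho> \<omega> (Pair \<omega> -` S)) \<in> borel_measurable M"
proof -
  assume "S \<in> sets (G \<Otimes>\<^sub>M borel)"
  then have S: "S \<in> sets (M \<Otimes>\<^sub>M borel)" by (rule sets_pair_G)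
  have U: "(\<lambda>\<omega>. measure (Z \<omega>) UNIV) \<in> borel_measurable M" "(\<lambda>\<omega>. measure (V \<omega>) UNIV) \<in> borel_measurable M"
    using Z V by (auto simp: finite_kernel_def)
  note [measurable] = finite_kernel_section_measurable[OF Z S] finite_kernel_section_measurable[OF V S] U
  show ?thesis unfolding \<rho>_def by measurable
qed

lemma integrable_\<rho>: "S \<in> sets (G \<Otimes>\<^sub>M borel) \<Longrightarrow> integrable M (\<lambda>\<omega>. \<rho> \<omega> (Pair \<omega> -` S))"
  by (intro integrable_unit) (auto simp: \<rho>_nonneg \<rho>_le_1)

text \<open>Approximable sets form a sigma-algebra containing the dyadic sets. Complements have the
  same symmetric difference, and a countable union is cut to a finite one, whose dyadic approximants
  again have a common level.\<close>

lemma dyadic_approx: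
  assumes S: "S \<in> sets (G \<Otimes>\<^sub>M borel)" and "\<epsilon> > 0"
  shows "\<exists>D\<in>dyadic_sets G. (\<integral>\<omega>. \<rho> \<omega> (Pair \<omega> -` ((S - D) \<union> (D - S))) \<partial>M) < \<epsilon>"
proof -
  have sigma_in: "S \<in> sets (G \<Otimes>\<^sub>M borel)" if "S \<in> sigma_sets (space G \<times> UNIV) (dyadic_sets G)" for S
    using that sets.sigma_sets_subset[of "dyadic_sets G" "G \<Otimes>\<^sub>M borel"] dyadic_sets_measurable
    by (auto simp: space_pair_measure)
  have "S \<in> sigma_sets (space G \<times> UNIV) (dyadic_sets G)"
    using S dyadic_sets_generate by blast
  then show ?thesis
    using \<open>\<epsilon> > 0\<close>
  proof (induction S arbitrary: \<epsilon> rule: sigma_sets.induct)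
    case (Basic S)
    then show ?case by (intro bexI[of _ S]) (auto simp: \<rho>_def)
  next
    case Empty
    have "{} \<in> dyadic_sets G" using dyadic_level_empty by (auto simp: dyadic_sets_def)
    then show ?case using Empty by (intro bexI[of _ "{}"]) (auto simp: \<rho>_def)
  next
    case (Compl S)
    then obtain D where D: "D \<in> dyadic_sets G" "(\<integral>\<omega>. \<rho> \<omega> (Pair \<omega> -` ((S - D) \<union> (D - S))) \<partial>M) < \<epsilon>"
      by blast
    have "S \<subseteq> space G \<times> UNIV" "D \<subseteq> space G \<times> UNIV"
      using sigma_in[OF Compl.hyps] dyadic_sets_measurable[OF D(1)] sets.sets_into_space
      by (fastforce simp: space_pair_measure)+
    then have "(space G \<times> UNIV - S - (space G \<times> UNIV - D)) \<union> (space G \<times> UNIV - D - (space G \<times> UNIV - S))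
        = (S - D) \<union> (D - S)" by auto
    moreover have "space G \<times> UNIV - D \<in> dyadic_sets G"
      using D(1) dyadic_level_compl by (auto simp: dyadic_sets_def)
    ultimately show ?case using D(2) by (intro bexI[of _ "space G \<times> UNIV - D"]) simp_all
  next
    case (Union S)
    have Sm [measurable]: "S i \<in> sets (G \<Otimes>\<^sub>M borel)" for i using sigma_in[OF Union.hyps] .
    \<comment> \<open>The part of the union missed by the first \<open>n\<close> sets; it decreases
      to the empty set, so its mean weighted mass tends to 0.\<close>
    define T where "T n = (\<Union>i. S i) - (\<Union>i<n. S i)" for n
    have Tm [measurable]: "T n \<in> sets (G \<Otimes>\<^sub>M borel)" for n unfolding T_def by measurable
    have "(\<lambda>n. \<integral>\<omega>. \<rho> \<omega> (Pair \<omega> -` T n) \<partial>M) \<longlonglongrightarrow> (\<integral>\<omega>. 0 \<partial>M)"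
    proof (rule integral_dominated_convergence[where w = "\<lambda>_. 1"])
      show "AE \<omega> in M. (\<lambda>n. \<rho> \<omega> (Pair \<omega> -` T n)) \<longlonglongrightarrow> 0"
      proof (rule AE_I2, rule \<rho>_decseq)
        show "Pair \<omega> -` T n \<in> sets borel" for n \<omega> using section_borel[OF Tm] .
        show "decseq (\<lambda>n. Pair \<omega> -` T n)" for \<omega>
          by (rule decseq_SucI) (auto simp: T_def less_Suc_eq)
        show "(\<Inter>n. Pair \<omega> -` T n) = {}" for \<omega>
          by (auto simp: T_def)
      qed
    qed (auto simp: \<rho>_nonneg \<rho>_le_1)
    then have "(\<lambda>n. \<integral>\<omega>. \<rho> \<omega> (Pair \<omega> -` T n) \<partial>M) \<longlonglongrightarrow> 0" by simp
    then have "\<forall>\<^sub>F n in sequentially. (\<integral>\<omega>. \<rho> \<omega> (Pair \<omega> -` T n) \<partial>M) < \<epsilon> / 2"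
      using \<open>\<epsilon> > 0\<close> by (intro order_tendstoD) auto
    then obtain n where n: "(\<integral>\<omega>. \<rho> \<omega> (Pair \<omega> -` T n) \<partial>M) < \<epsilon> / 2"
      by (auto simp: eventually_sequentially)
    \<comment> \<open>The \<open>n\<close> errors add up to at most \<open>\<epsilon> / 2\<close>;
      \<open>Suc n\<close> keeps the bound meaningful for \<open>n = 0\<close>.\<close>
    have "\<forall>i. \<exists>D. D \<in> dyadic_sets G \<and> (\<integral>\<omega>. \<rho> \<omega> (Pair \<omega> -` ((S i - D) \<union> (D - S i))) \<partial>M) < \<epsilon> / (2 * Suc n)"
    proof
      fix i
      show "\<exists>D. D \<in> dyadic_sets G \<and> (\<integral>\<omega>. \<rho> \<omega> (Pair \<omega> -` ((S i - D) \<union> (D - S i))) \<partial>M) < \<epsilon> / (2 * Suc n)"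
        using Union.IH[of "\<epsilon> / (2 * Suc n)" i] \<open>\<epsilon> > 0\<close> by (auto simp: Bex_def)
    qed
    from choice[OF this] obtain D where D: "\<And>i. D i \<in> dyadic_sets G"
      "\<And>i. (\<integral>\<omega>. \<rho> \<omega> (Pair \<omega> -` ((S i - D i) \<union> (D i - S i))) \<partial>M) < \<epsilon> / (2 * Suc n)"
      by blast
    have Dm [measurable]: "D i \<in> sets (G \<Otimes>\<^sub>M borel)" for i using dyadic_sets_measurable[OF D(1)] .
    define E where "E = (\<Union>i<n. D i)"
    have E: "E \<in> dyadic_sets G"
    proof -
      obtain m where "\<forall>i\<in>{..<n}. D i \<in> dyadic_level G m"
        using dyadic_sets_common_level[of "{..<n}" D G] D(1) by auto
      then show ?thesis unfolding E_def dyadic_sets_def by (auto intro!: exI[of _ m] dyadic_level_UN)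
    qed
    have [measurable]: "E \<in> sets (G \<Otimes>\<^sub>M borel)" using dyadic_sets_measurable[OF E] .
    have le: "\<rho> \<omega> (Pair \<omega> -` (((\<Union>i. S i) - E) \<union> (E - (\<Union>i. S i))))
        \<le> \<rho> \<omega> (Pair \<omega> -` T n) + (\<Sum>i<n. \<rho> \<omega> (Pair \<omega> -` ((S i - D i) \<union> (D i - S i))))" if w: "\<omega> \<in> space M" for \<omega>
    proof -
      have b: "Pair \<omega> -` ((S i - D i) \<union> (D i - S i)) \<in> sets borel" "Pair \<omega> -` T n \<in> sets borel" for i
        by (rule section_borel[of _ G]; measurable)+
      have "\<rho> \<omega> (Pair \<omega> -` (((\<Union>i. S i) - E) \<union> (E - (\<Union>i. S i))))
          \<le> \<rho> \<omega> (Pair \<omega> -` T n \<union> (\<Union>i<n. Pair \<omega> -` ((S i - D i) \<union> (D i - S i))))"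
        using b by (intro \<rho>_mono[OF w] sets.Un sets.finite_UN) (auto simp: T_def E_def)
      also have "\<dots> \<le> \<rho> \<omega> (Pair \<omega> -` T n) + \<rho> \<omega> (\<Union>i<n. Pair \<omega> -` ((S i - D i) \<union> (D i - S i)))"
        using b by (intro \<rho>_Un_le[OF w] sets.finite_UN) auto
      also have "\<dots> \<le> \<rho> \<omega> (Pair \<omega> -` T n) + (\<Sum>i<n. \<rho> \<omega> (Pair \<omega> -` ((S i - D i) \<union> (D i - S i))))"
        using b by (intro add_left_mono \<rho>_UN_le[OF _ w]) auto
      finally show ?thesis .
    qed
    have i: "integrable M (\<lambda>\<omega>. \<rho> \<omega> (Pair \<omega> -` T n))"
      "integrable M (\<lambda>\<omega>. \<rho> \<omega> (Pair \<omega> -` ((S i - D i) \<union> (D i - S i))))"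
      "integrable M (\<lambda>\<omega>. \<rho> \<omega> (Pair \<omega> -` (((\<Union>i. S i) - E) \<union> (E - (\<Union>i. S i)))))" for i
      by (rule integrable_\<rho>; measurable)+
    have "(\<integral>\<omega>. \<rho> \<omega> (Pair \<omega> -` (((\<Union>i. S i) - E) \<union> (E - (\<Union>i. S i)))) \<partial>M)
        \<le> (\<integral>\<omega>. \<rho> \<omega> (Pair \<omega> -` T n) + (\<Sum>i<n. \<rho> \<omega> (Pair \<omega> -` ((S i - D i) \<union> (D i - S i)))) \<partial>M)"
      by (intro integral_mono i Bochner_Integration.integrable_add Bochner_Integration.integrable_sum le)
    also have "\<dots> = (\<integral>\<omega>. \<rho> \<omega> (Pair \<omega> -` T n) \<partial>M) + (\<Sum>i<n. \<integral>\<omega>. \<rho> \<omega> (Pair \<omega> -` ((S i - D i) \<union> (D i - S i))) \<partial>M)"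
      by (simp only: Bochner_Integration.integral_add Bochner_Integration.integrable_sum Bochner_Integration.integral_sum i)
    also have "(\<Sum>i<n. \<integral>\<omega>. \<rho> \<omega> (Pair \<omega> -` ((S i - D i) \<union> (D i - S i))) \<partial>M) \<le> (\<Sum>i<n. \<epsilon> / (2 * Suc n))"
      using D(2) by (intro sum_mono less_imp_le)
    also have "\<dots> \<le> \<epsilon> / 2" using \<open>\<epsilon> > 0\<close> by (simp add: field_simps)
    finally show ?case using n E by (intro bexI[of _ E]) auto
  qed
qed

text \<open>At a common level the sets are given by events selecting cells, so
  \<open>cond_poisson_merge\<close> applies with no cells kept apart.\<close>

lemma dyadic_cond_poisson:
  fixes k :: nat and I :: "nat \<Rightarrow> (int \<times> int) set"
  assumes I: "\<And>n. finite (I n)"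
    and Zint: "\<And>\<omega> B. \<omega> \<in> space M \<Longrightarrow> B \<in> sets borel \<Longrightarrow> measure (Z \<omega>) B \<in> \<nat>"
    and supp: "\<And>n \<omega>. \<omega> \<in> space M \<Longrightarrow> measure (Z \<omega>) (- (idx n -` I n)) = 0"
      "\<And>n \<omega>. \<omega> \<in> space M \<Longrightarrow> measure (V \<omega>) (- (idx n -` I n)) = 0"
    and cells: "\<And>n. cond_poisson M G (I n) (\<lambda>c \<omega>. measure (Z \<omega>) (idx n -` {c})) (\<lambda>c \<omega>. measure (V \<omega>) (idx n -` {c}))"
    and D: "\<And>j. j < k \<Longrightarrow> D j \<in> dyadic_sets G" and dis: "disjoint_family_on D {..<k}"
  shows "cond_poisson M G {..<k} (\<lambda>j \<omega>. measure (Z \<omega>) (Pair \<omega> -` D j)) (\<lambda>j \<omega>. measure (V \<omega>) (Pair \<omega> -` D j))"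
proof -
  obtain n where n: "\<And>j. j < k \<Longrightarrow> D j \<in> dyadic_level G n"
    using dyadic_sets_common_level[of "{..<k}" D G] D by auto
  have "\<forall>j. \<exists>A. j < k \<longrightarrow> (\<forall>c. A c \<in> sets G) \<and> D j = {(\<omega>, p). \<omega> \<in> A (idx n p)}"
    using n unfolding dyadic_level_def by blast
  from choice[OF this] obtain A where A: "\<And>j c. j < k \<Longrightarrow> A j c \<in> sets G"
    "\<And>j. j < k \<Longrightarrow> D j = {(\<omega>, p). \<omega> \<in> A j (idx n p)}"
    by blast
  \<comment> \<open>Every cell contains a point, so events that select the same cell for two
    disjoint sets cannot overlap.\<close>
  have disA: "A j c \<inter> A j' c = {}" if "j < k" "j' < k" "j \<noteq> j'" for j j' c
  proof -
    obtain p where p: "idx n p = c" using idx_onto by blast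
    have "D j \<inter> D j' = {}"
      using dis that by (auto simp: disjoint_family_on_def)
    moreover have "(\<omega>, p) \<in> D j \<inter> D j'" if "\<omega> \<in> A j c \<inter> A j' c" for \<omega>
      using that p unfolding A(2)[OF \<open>j < k\<close>] A(2)[OF \<open>j' < k\<close>] by simp
    ultimately show ?thesis by blast
  qed
  \<comment> \<open>The masses vanish off the finitely many cells in \<open>I n\<close>, which makes
    the sum over cells finite.\<close>
  have decomp: "measure (R \<omega>) (Pair \<omega> -` D j) = (\<Sum>c\<in>I n. indicator (A j c) \<omega> * measure (R \<omega>) (idx n -` {c}))"
    if R: "finite_kernel M R" and w: "\<omega> \<in> space M" and 0: "measure (R \<omega>) (- (idx n -` I n)) = 0" and j: "j < k" for R \<omega> j
  proof -
    interpret R: finite_measure "R \<omega>" using finite_kernelD[OF R w] by simp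
    note sR [simp] = finite_kernelD(2,3)[OF R w]
    have b: "Pair \<omega> -` D j \<in> sets borel"
      using dyadic_sets_measurable[OF D[OF j]] by (rule section_borel)
    have "measure (R \<omega>) (Pair \<omega> -` D j) = measure (R \<omega>) (Pair \<omega> -` D j \<inter> idx n -` I n) + measure (R \<omega>) (Pair \<omega> -` D j - idx n -` I n)"
      using b by (subst R.finite_measure_Union[symmetric]) (auto simp: Int_Diff_Un)
    also have "measure (R \<omega>) (Pair \<omega> -` D j - idx n -` I n) = 0"
      using R.finite_measure_mono[of "Pair \<omega> -` D j - idx n -` I n" "- (idx n -` I n)"] 0 b
      by (auto simp: Compl_eq_Diff_UNIV intro!: antisym sets.Diff)
    also have "Pair \<omega> -` D j \<inter> idx n -` I n = (\<Union>c\<in>{c\<in>I n. \<omega> \<in> A j c}. idx n -` {c})"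
      by (auto simp: A(2)[OF j])
    also have "measure (R \<omega>) \<dots> = (\<Sum>c\<in>{c\<in>I n. \<omega> \<in> A j c}. measure (R \<omega>) (idx n -` {c}))"
      using I[of n] by (intro R.finite_measure_finite_Union) (auto simp: disjoint_family_on_def)
    also have "\<dots> = (\<Sum>c\<in>I n. indicator (A j c) \<omega> * measure (R \<omega>) (idx n -` {c}))"
      using I[of n] by (intro sum.mono_neutral_cong_left) auto
    finally show ?thesis by simp
  qed
  show ?thesis
    unfolding cond_poisson_def
  proof (intro ballI allI)
    fix B and x :: "nat \<Rightarrow> nat" assume B: "B \<in> sets G"
    note Zd = decomp[OF Z _ supp(1)] and Vd = decomp[OF V _ supp(2)]
    have "(\<integral>\<omega>. indicator B \<omega> * count_ind {..<k} (\<lambda>j \<omega>. measure (Z \<omega>) (Pair \<omega> -` D j)) x \<omega> \<partial>M)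
      = (\<integral>\<omega>. indicator B \<omega> * (count_ind {..<k} (\<lambda>j \<omega>. \<Sum>c\<in>I n. indicator (A j c) \<omega> * measure (Z \<omega>) (idx n -` {c})) x \<omega>
          * count_ind {} (\<lambda>c \<omega>. measure (Z \<omega>) (idx n -` {c})) (\<lambda>_. 0) \<omega>) \<partial>M)"
      by (rule Bochner_Integration.integral_cong[OF refl])
        (auto simp: Zd count_ind_def[of "{}"] intro!: count_ind_cong)
    also have "\<dots> = (\<integral>\<omega>. indicator B \<omega> * (poisson_prod {..<k} (\<lambda>j \<omega>. \<Sum>c\<in>I n. indicator (A j c) \<omega> * measure (V \<omega>) (idx n -` {c})) x \<omega>
          * poisson_prod {} (\<lambda>c \<omega>. measure (V \<omega>) (idx n -` {c})) (\<lambda>_. 0) \<omega>) \<partial>M)"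
    proof (rule cond_poisson_merge)
      show "cond_poisson M G (I n \<union> {}) (\<lambda>c \<omega>. measure (Z \<omega>) (idx n -` {c})) (\<lambda>c \<omega>. measure (V \<omega>) (idx n -` {c}))"
        using cells[of n] by simp
      show "A j c \<inter> A j' c = {}" if "j \<in> {..<k}" "j' \<in> {..<k}" "c \<in> I n" "j \<noteq> j'" for j j' c
        using disA that by auto
    qed (use I Z V Zint A(1) B in \<open>auto simp: finite_kernel_def\<close>)
    also have "\<dots> = (\<integral>\<omega>. indicator B \<omega> * poisson_prod {..<k} (\<lambda>j \<omega>. measure (V \<omega>) (Pair \<omega> -` D j)) x \<omega> \<partial>M)"
      by (rule Bochner_Integration.integral_cong[OF refl])
        (auto simp: Vd poisson_prod_def[of "{}"] intro!: poisson_prod_cong)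
    finally show "(\<integral>\<omega>. indicator B \<omega> * count_ind {..<k} (\<lambda>j \<omega>. measure (Z \<omega>) (Pair \<omega> -` D j)) x \<omega> \<partial>M)
      = (\<integral>\<omega>. indicator B \<omega> * poisson_prod {..<k} (\<lambda>j \<omega>. measure (V \<omega>) (Pair \<omega> -` D j)) x \<omega> \<partial>M)" .
  qed
qed

text \<open>For a fixed outcome the normalising denominator is a positive constant, so multiplying
  by it recovers both masses of the symmetric difference.\<close>

lemma \<rho>_tendsto_0D:
  assumes w: "\<omega> \<in> space M" and b: "S \<in> sets borel" "\<And>n. D n \<in> sets borel"
    and lim: "(\<lambda>n. \<rho> \<omega> ((S - D n) \<union> (D n - S))) \<longlonglongrightarrow> 0"
  shows "(\<lambda>n. measure (Z \<omega>) (D n)) \<longlonglongrightarrow> measure (Z \<omega>) S"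
    and "(\<lambda>n. measure (V \<omega>) (D n)) \<longlonglongrightarrow> measure (V \<omega>) S"
proof -
  let ?C = "1 + (measure (Z \<omega>) UNIV + measure (V \<omega>) UNIV)"
  have C: "0 < ?C" by (simp add: add_pos_nonneg)
  have "(\<lambda>n. ?C * \<rho> \<omega> ((S - D n) \<union> (D n - S))) \<longlonglongrightarrow> 0"
    using tendsto_mult[OF tendsto_const[of ?C] lim] by simp
  moreover have "?C * \<rho> \<omega> B = measure (Z \<omega>) B + measure (V \<omega>) B" for B
    unfolding \<rho>_def using C by simp
  ultimately have lim': "(\<lambda>n. measure (Z \<omega>) ((S - D n) \<union> (D n - S)) + measure (V \<omega>) ((S - D n) \<union> (D n - S))) \<longlonglongrightarrow> 0"
    by simp
  have dist: "\<bar>measure R (D n) - measure R S\<bar> \<le> measure R ((S - D n) \<union> (D n - S))"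
    if "finite_measure R" "sets R = sets borel" for R n
  proof -
    interpret finite_measure R by fact
    have m: "S \<in> sets R" "D n \<in> sets R" "(S - D n) \<union> (D n - S) \<in> sets R"
      using b that by auto
    have "measure R (D n) \<le> measure R (S \<union> ((S - D n) \<union> (D n - S)))"
      using m by (intro finite_measure_mono sets.Un) auto
    also have "\<dots> \<le> measure R S + measure R ((S - D n) \<union> (D n - S))"
      using m by (intro measure_Un_le)
    finally have "measure R (D n) \<le> measure R S + measure R ((S - D n) \<union> (D n - S))" .
    moreover have "measure R S \<le> measure R (D n \<union> ((S - D n) \<union> (D n - S)))"
      using m by (intro finite_measure_mono sets.Un) auto
    moreover have "\<dots> \<le> measure R (D n) + measure R ((S - D n) \<union> (D n - S))"
      using m by (intro measure_Un_le)
    ultimately show ?thesis by linarith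
  qed
  have "(\<lambda>n. measure (Z \<omega>) (D n) - measure (Z \<omega>) S) \<longlonglongrightarrow> 0"
    by (rule Lim_null_comparison[OF _ lim'])
      (use dist[OF finite_kernelD(1,2)[OF Z w]] in \<open>auto intro!: always_eventually intro: order_trans add_increasing2\<close>)
  then show "(\<lambda>n. measure (Z \<omega>) (D n)) \<longlonglongrightarrow> measure (Z \<omega>) S" by (rule LIM_zero_cancel)
  have "(\<lambda>n. measure (V \<omega>) (D n) - measure (V \<omega>) S) \<longlonglongrightarrow> 0"
    by (rule Lim_null_comparison[OF _ lim'])
      (use dist[OF finite_kernelD(1,2)[OF V w]] in \<open>auto intro!: always_eventually intro: order_trans add_increasing\<close>)
  then show "(\<lambda>n. measure (V \<omega>) (D n)) \<longlonglongrightarrow> measure (V \<omega>) S" by (rule LIM_zero_cancel)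
qed

lemma Nats_tendsto_eventually_eq:
  fixes f :: "nat \<Rightarrow> real"
  assumes "\<And>n. f n \<in> \<nat>" "l \<in> \<nat>" "f \<longlonglongrightarrow> l"
  shows "\<forall>\<^sub>F n in sequentially. f n = l"
proof -
  have "\<forall>\<^sub>F n in sequentially. dist (f n) l < 1"
    using assms(3) by (rule tendstoD) simp
  then show ?thesis
  proof eventually_elim
    case (elim n)
    obtain a b where "f n = real a" "l = real b"
      using assms(1)[of n] assms(2) by (auto elim!: Nats_cases)
    then show ?case using elim by (simp add: dist_real_def)
  qed
qed

text \<open>Mean convergence of the dyadic approximants becomes almost sure convergence along a
  subsequence. The integer counts are then eventually equal to those of the limit sets, and
  \<open>cond_poisson_limit\<close> applies.\<close>

lemma cond_poisson_random_sets:
  fixes k :: nat and I :: "nat \<Rightarrow> (int \<times> int) set"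
  assumes I: "\<And>n. finite (I n)"
    and Zint: "\<And>\<omega> B. \<omega> \<in> space M \<Longrightarrow> B \<in> sets borel \<Longrightarrow> measure (Z \<omega>) B \<in> \<nat>"
    and supp: "\<And>n \<omega>. \<omega> \<in> space M \<Longrightarrow> measure (Z \<omega>) (- (idx n -` I n)) = 0"
      "\<And>n \<omega>. \<omega> \<in> space M \<Longrightarrow> measure (V \<omega>) (- (idx n -` I n)) = 0"
    and cells: "\<And>n. cond_poisson M G (I n) (\<lambda>c \<omega>. measure (Z \<omega>) (idx n -` {c})) (\<lambda>c \<omega>. measure (V \<omega>) (idx n -` {c}))"
    and S: "\<And>j. j < k \<Longrightarrow> S j \<in> sets (G \<Otimes>\<^sub>M borel)" and dis: "disjoint_family_on S {..<k}"
  shows "cond_poisson M G {..<k} (\<lambda>j \<omega>. measure (Z \<omega>) (Pair \<omega> -` S j)) (\<lambda>j \<omega>. measure (V \<omega>) (Pair \<omega> -` S j))"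
proof -
  have "\<forall>x :: nat \<times> nat. \<exists>D. snd x < k \<longrightarrow> D \<in> dyadic_sets G \<and>
      (\<integral>\<omega>. \<rho> \<omega> (Pair \<omega> -` ((S (snd x) - D) \<union> (D - S (snd x)))) \<partial>M) < 1 / Suc (fst x)"
  proof
    fix x :: "nat \<times> nat"
    show "\<exists>D. snd x < k \<longrightarrow> D \<in> dyadic_sets G \<and>
      (\<integral>\<omega>. \<rho> \<omega> (Pair \<omega> -` ((S (snd x) - D) \<union> (D - S (snd x)))) \<partial>M) < 1 / Suc (fst x)"
      using dyadic_approx[OF S, of "snd x" "1 / Suc (fst x)"] by (cases "snd x < k") auto
  qed
  from choice[OF this] obtain D' where D': "\<And>x. snd x < k \<Longrightarrow> D' x \<in> dyadic_sets G"
    "\<And>x. snd x < k \<Longrightarrow> (\<integral>\<omega>. \<rho> \<omega> (Pair \<omega> -` ((S (snd x) - D' x) \<union> (D' x - S (snd x)))) \<partial>M) < 1 / Suc (fst x)"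
    by blast
  define D where "D n j = D' (n, j)" for n j
  have D: "\<And>n j. j < k \<Longrightarrow> D n j \<in> dyadic_sets G"
    "\<And>n j. j < k \<Longrightarrow> (\<integral>\<omega>. \<rho> \<omega> (Pair \<omega> -` ((S j - D n j) \<union> (D n j - S j))) \<partial>M) < 1 / Suc n"
    using D'[of "(_, _)"] unfolding D_def by simp_all
  note Dm = dyadic_sets_measurable[OF D(1)]
  \<comment> \<open>Adding the errors of all sets yields a single subsequence \<open>r\<close> that
    serves every index.\<close>
  let ?u = "\<lambda>n \<omega>. \<Sum>j<k. \<rho> \<omega> (Pair \<omega> -` ((S j - D n j) \<union> (D n j - S j)))"
  have sd: "(S j - D n j) \<union> (D n j - S j) \<in> sets (G \<Otimes>\<^sub>M borel)" if "j < k" for j n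
    using S[OF that] Dm[OF that] by (intro sets.Un sets.Diff)
  have iu: "integrable M (?u n)" for n
    using sd by (intro Bochner_Integration.integrable_sum integrable_\<rho>) auto
  have "(\<lambda>n. \<integral>\<omega>. norm (?u n \<omega>) \<partial>M) \<longlonglongrightarrow> 0"
  proof (rule Lim_null_comparison)
    show "\<forall>\<^sub>F n in sequentially. norm (\<integral>\<omega>. norm (?u n \<omega>) \<partial>M) \<le> real k * (1 / Suc n)"
    proof (rule always_eventually, rule allI)
      fix n
      have "(\<integral>\<omega>. norm (?u n \<omega>) \<partial>M) = (\<integral>\<omega>. ?u n \<omega> \<partial>M)"
        by (intro Bochner_Integration.integral_cong refl) (simp only: real_norm_def, intro abs_of_nonneg sum_nonneg \<rho>_nonneg)
      also have "\<dots> = (\<Sum>j<k. \<integral>\<omega>. \<rho> \<omega> (Pair \<omega> -` ((S j - D n j) \<union> (D n j - S j))) \<partial>M)"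
        using sd by (intro Bochner_Integration.integral_sum integrable_\<rho>) auto
      also have "\<dots> \<le> (\<Sum>j<k. 1 / Suc n)"
        using D(2) by (intro sum_mono less_imp_le) auto
      finally show "norm (\<integral>\<omega>. norm (?u n \<omega>) \<partial>M) \<le> real k * (1 / Suc n)"
        by (simp add: abs_of_nonneg)
    qed
    show "(\<lambda>n. real k * (1 / Suc n)) \<longlonglongrightarrow> 0"
      using tendsto_mult[OF tendsto_const[of "real k"] LIMSEQ_Suc[OF lim_1_over_n]] by simp
  qed
  from tendsto_L1_AE_subseq[OF iu this] obtain r where
    r: "strict_mono r" "AE \<omega> in M. (\<lambda>n. ?u (r n) \<omega>) \<longlonglongrightarrow> 0" by blast
  \<comment> \<open>The approximants may overlap, whereas merging needs disjoint sets; earlier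
    approximants are subtracted.\<close>
  define E where "E n j = D (r n) j - (\<Union>i<j. D (r n) i)" for n j
  have E: "E n j \<in> dyadic_sets G" if "j < k" for n j
  proof -
    obtain m where "\<forall>i\<in>{..<k}. D (r n) i \<in> dyadic_level G m"
      using dyadic_sets_common_level[of "{..<k}" "D (r n)" G] D(1) by auto
    then show ?thesis
      using that unfolding E_def dyadic_sets_def
      by (auto intro!: exI[of _ m] dyadic_level_Diff dyadic_level_UN)
  qed
  have disE: "disjoint_family_on (E n) {..<k}" for n
    unfolding disjoint_family_on_def
  proof (intro ballI impI)
    fix i j :: nat assume "i \<noteq> j"
    then consider "i < j" | "j < i" by linarith
    then show "E n i \<inter> E n j = {}" by cases (auto simp: E_def)
  qed
  have lim: "AE \<omega> in M. (\<lambda>n. \<rho> \<omega> ((Pair \<omega> -` S j - Pair \<omega> -` E n j) \<union> (Pair \<omega> -` E n j - Pair \<omega> -` S j))) \<longlonglongrightarrow> 0"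
    if j: "j < k" for j
    using r(2) AE_space
  proof eventually_elim
    case (elim \<omega>)
    show ?case
    proof (rule Lim_null_comparison[OF _ elim(1)], rule always_eventually, rule allI)
      fix n
      have b: "Pair \<omega> -` ((S i - D (r n) i) \<union> (D (r n) i - S i)) \<in> sets borel" if "i < k" for i
        using sd[OF that] by (rule section_borel)
      have "\<rho> \<omega> ((Pair \<omega> -` S j - Pair \<omega> -` E n j) \<union> (Pair \<omega> -` E n j - Pair \<omega> -` S j))
          \<le> \<rho> \<omega> (\<Union>i<k. Pair \<omega> -` ((S i - D (r n) i) \<union> (D (r n) i - S i)))"
      proof (rule \<rho>_mono[OF elim(2)])
        show "(Pair \<omega> -` S j - Pair \<omega> -` E n j) \<union> (Pair \<omega> -` E n j - Pair \<omega> -` S j)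
            \<subseteq> (\<Union>i<k. Pair \<omega> -` ((S i - D (r n) i) \<union> (D (r n) i - S i)))"
        proof
          fix p assume "p \<in> (Pair \<omega> -` S j - Pair \<omega> -` E n j) \<union> (Pair \<omega> -` E n j - Pair \<omega> -` S j)"
          then consider "(\<omega>, p) \<in> S j" "(\<omega>, p) \<notin> D (r n) j" | i where "(\<omega>, p) \<in> S j" "i < j" "(\<omega>, p) \<in> D (r n) i"
            | "(\<omega>, p) \<notin> S j" "(\<omega>, p) \<in> D (r n) j"
            by (auto simp: E_def)
          then show "p \<in> (\<Union>i<k. Pair \<omega> -` ((S i - D (r n) i) \<union> (D (r n) i - S i)))"
          proof cases
            \<comment> \<open>A point of \<open>S j\<close> lost to an earlier approximant lies
              outside \<open>S i\<close> by disjointness, so it is already an error of the set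
              \<open>i\<close>.\<close>
            case (2 i)
            moreover have "S i \<inter> S j = {}" using dis j 2 by (auto simp: disjoint_family_on_def)
            ultimately have "(\<omega>, p) \<notin> S i" by blast
            then have "p \<in> Pair \<omega> -` ((S i - D (r n) i) \<union> (D (r n) i - S i))" using 2(3) by simp
            then show ?thesis using less_trans[OF 2(2) j] by (intro UN_I[of i]) simp_all
          next
            case 1
            then have "p \<in> Pair \<omega> -` ((S j - D (r n) j) \<union> (D (r n) j - S j))" by simp
            then show ?thesis using j by (intro UN_I[of j]) simp_all
          next
            case 3
            then have "p \<in> Pair \<omega> -` ((S j - D (r n) j) \<union> (D (r n) j - S j))" by simp
            then show ?thesis using j by (intro UN_I[of j]) simp_all
          qed
        qed
      qed (use b in auto)
      also have "\<dots> \<le> ?u (r n) \<omega>"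
        using b elim(2) by (intro \<rho>_UN_le) auto
      finally show "norm (\<rho> \<omega> ((Pair \<omega> -` S j - Pair \<omega> -` E n j) \<union> (Pair \<omega> -` E n j - Pair \<omega> -` S j))) \<le> ?u (r n) \<omega>"
        using \<rho>_nonneg by simp
    qed
  qed
  have b: "Pair \<omega> -` S j \<in> sets borel" "Pair \<omega> -` E n j \<in> sets borel" if "j < k" for j n \<omega>
    using section_borel[OF S[OF that]] section_borel[OF dyadic_sets_measurable[OF E[OF that]]] by auto
  have limZ: "AE \<omega> in M. \<forall>\<^sub>F n in sequentially. measure (Z \<omega>) (Pair \<omega> -` E n j) = measure (Z \<omega>) (Pair \<omega> -` S j)"
    and limV: "AE \<omega> in M. (\<lambda>n. measure (V \<omega>) (Pair \<omega> -` E n j)) \<longlonglongrightarrow> measure (V \<omega>) (Pair \<omega> -` S j)" if j: "j < k" for j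
  proof -
    show "AE \<omega> in M. \<forall>\<^sub>F n in sequentially. measure (Z \<omega>) (Pair \<omega> -` E n j) = measure (Z \<omega>) (Pair \<omega> -` S j)"
      using lim[OF j] AE_space
      by eventually_elim (auto intro!: Nats_tendsto_eventually_eq Zint b[OF j] \<rho>_tendsto_0D(1))
    show "AE \<omega> in M. (\<lambda>n. measure (V \<omega>) (Pair \<omega> -` E n j)) \<longlonglongrightarrow> measure (V \<omega>) (Pair \<omega> -` S j)"
      using lim[OF j] AE_space by eventually_elim (auto intro!: b[OF j] \<rho>_tendsto_0D(2))
  qed
  show ?thesis
  proof (rule cond_poisson_limit)
    show "cond_poisson M G {..<k} (\<lambda>j \<omega>. measure (Z \<omega>) (Pair \<omega> -` E n j)) (\<lambda>j \<omega>. measure (V \<omega>) (Pair \<omega> -` E n j))" for n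
      using I Zint supp cells E disE by (rule dyadic_cond_poisson)
    show "(\<lambda>\<omega>. measure (Z \<omega>) (Pair \<omega> -` E n j)) \<in> borel_measurable M"
      "(\<lambda>\<omega>. measure (V \<omega>) (Pair \<omega> -` E n j)) \<in> borel_measurable M" if "j \<in> {..<k}" for n j
      using that by (intro finite_kernel_section_measurable Z V sets_pair_G dyadic_sets_measurable E; simp)+
    show "(\<lambda>\<omega>. measure (Z \<omega>) (Pair \<omega> -` S j)) \<in> borel_measurable M"
      "(\<lambda>\<omega>. measure (V \<omega>) (Pair \<omega> -` S j)) \<in> borel_measurable M" if "j \<in> {..<k}" for j
      using that by (intro finite_kernel_section_measurable Z V sets_pair_G S; simp)+
  qed (use limZ limV in auto)
qed

end

subsection \<open>Locally finite kernels\<close>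

definition box2 :: "real \<Rightarrow> real \<Rightarrow> real \<Rightarrow> real \<Rightarrow> (real \<times> real) set" where
  "box2 a b c d = {a<..b} \<times> {c<..d}"

definition boxes :: "(real \<times> real) set set" where
  "boxes = {box2 a b c d |a b c d. True}"

abbreviation window :: "nat \<Rightarrow> (real \<times> real) set" where
  "window K \<equiv> box2 (- real K) (real K) (- real K) (real K)"

lemma box2_borel [measurable, simp]: "box2 a b c d \<in> sets borel"
  unfolding box2_def borel_prod[symmetric] by simp

lemma box2_Int: "box2 a b c d \<inter> box2 a' b' c' d' = box2 (max a a') (min b b') (max c c') (min d d')"
  by (auto simp: box2_def)

lemma box2_in_boxes [simp]: "box2 a b c d \<in> boxes"
  by (auto simp: boxes_def)

lemma boxes_Int_stable: "Int_stable boxes"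
  unfolding Int_stable_def boxes_def using box2_Int by blast

lemma boxes_generate: "sets borel = sigma_sets UNIV boxes"
proof (rule antisym)
  have "boxes \<subseteq> sets borel" by (auto simp: boxes_def)
  from sets.sigma_sets_subset[OF this] show "sigma_sets UNIV boxes \<subseteq> sets borel" by simp
  interpret S: sigma_algebra UNIV "sigma_sets UNIV boxes"
    by (rule sigma_algebra_sigma_sets) simp
  have "sigma_sets UNIV (range (\<lambda>a :: real \<times> real. {..a})) \<subseteq> sigma_sets UNIV boxes"
  proof (rule sigma_sets_mono, safe)
    fix a b :: real
    have "{..(a, b)} = (\<Union>n::nat. box2 (- real n) a (- real n) b)"
    proof safe
      fix x y assume "(x, y) \<le> (a, b)"
      moreover obtain n :: nat where "max (- x) (- y) < real n" using reals_Archimedean2 by blast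
      ultimately show "(x, y) \<in> (\<Union>n::nat. box2 (- real n) a (- real n) b)"
        by (auto simp: box2_def intro!: exI[of _ n])
    qed (auto simp: box2_def)
    also have "\<dots> \<in> sigma_sets UNIV boxes"
      by (intro S.countable_UN) (auto intro!: sigma_sets.Basic)
    finally show "{..(a, b)} \<in> sigma_sets UNIV boxes" .
  qed
  then show "sets (borel :: (real \<times> real) measure) \<subseteq> sigma_sets UNIV boxes"
    by (subst borel_eq_atMost) simp
qed

lemma window_mono: "m \<le> n \<Longrightarrow> window m \<subseteq> window n"
  by (auto simp: box2_def)

lemma UN_window: "(\<Union>n. window n) = UNIV"
proof safe
  fix x y :: real
  obtain n :: nat where "max \<bar>x\<bar> \<bar>y\<bar> < real n" using reals_Archimedean2 by blast
  then show "(x, y) \<in> (\<Union>n. window n)" by (auto simp: box2_def intro!: exI[of _ n])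
qed simp

lemma bounded_subset_window:
  assumes "bounded (B :: (real \<times> real) set)" shows "\<exists>K. B \<subseteq> window K"
proof -
  obtain a where a: "\<And>p. p \<in> B \<Longrightarrow> norm p \<le> a" using assms by (auto simp: bounded_iff)
  obtain K :: nat where K: "a < real K" using reals_Archimedean2 by blast
  have "p \<in> window K" if "p \<in> B" for p
    using a[OF that] norm_fst_le[of "fst p" "snd p"] norm_snd_le[of "snd p" "fst p"] K
    by (cases p) (auto simp: box2_def)
  then show ?thesis by blast
qed

lemma bounded_box2: "bounded (box2 a b c d)"
  unfolding box2_def by (intro bounded_Times) (auto intro: bounded_subset[OF bounded_closed_interval[of a b]] bounded_subset[OF bounded_closed_interval[of c d]] simp: subset_eq)

lemma measure_eqI_boxes:
  fixes P Q :: "(real \<times> real) measure"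
  assumes "sets P = sets borel" "sets Q = sets borel"
    and "\<And>a b c d. a \<le> b \<Longrightarrow> c \<le> d \<Longrightarrow> emeasure P (box2 a b c d) = emeasure Q (box2 a b c d)"
    and "\<And>K. emeasure P (window K) \<noteq> \<infinity>"
  shows "P = Q"
proof (rule measure_eqI_generator_eq[where E = boxes and \<Omega> = UNIV and A = window])
  fix B assume "B \<in> boxes"
  then obtain a b c d where B: "B = box2 a b c d" by (auto simp: boxes_def)
  show "emeasure P B = emeasure Q B"
  proof (cases "a \<le> b \<and> c \<le> d")
    case False
    then have "B = {}" by (auto simp: B box2_def)
    then show ?thesis by simp
  qed (simp add: B assms(3))
qed (use assms boxes_Int_stable UN_window in \<open>auto simp: boxes_generate boxes_def\<close>)

text \<open>Measurability is demanded only inside windows, where the mass is finite and the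
  real-valued \<open>measure\<close> therefore does not default to 0.\<close>

definition lf_kernel :: "'a measure \<Rightarrow> ('a \<Rightarrow> (real \<times> real) measure) \<Rightarrow> bool" where
  "lf_kernel M R \<longleftrightarrow> (\<forall>\<omega>\<in>space M. sets (R \<omega>) = sets borel \<and> (\<forall>K. emeasure (R \<omega>) (window K) < \<infinity>)) \<and>
     (\<forall>K. \<forall>B\<in>sets borel. (\<lambda>\<omega>. measure (R \<omega>) (B \<inter> window K)) \<in> borel_measurable M)"

text \<open>A density instead of a restricted space, so that the sigma-algebra remains that of the
  whole plane.\<close>

definition cutoff :: "nat \<Rightarrow> ('a \<Rightarrow> (real \<times> real) measure) \<Rightarrow> 'a \<Rightarrow> (real \<times> real) measure" where
  "cutoff K R \<omega> = density (R \<omega>) (indicator (window K))"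

lemma emeasure_cutoff:
  "sets (R \<omega>) = sets borel \<Longrightarrow> B \<in> sets borel \<Longrightarrow> emeasure (cutoff K R \<omega>) B = emeasure (R \<omega>) (B \<inter> window K)"
  unfolding cutoff_def by (subst emeasure_density) (auto simp flip: indicator_inter_arith simp: mult.commute)

lemma measure_cutoff:
  "sets (R \<omega>) = sets borel \<Longrightarrow> B \<in> sets borel \<Longrightarrow> measure (cutoff K R \<omega>) B = measure (R \<omega>) (B \<inter> window K)"
  unfolding measure_def by (simp add: emeasure_cutoff)

lemma sets_cutoff [simp]: "sets (cutoff K R \<omega>) = sets (R \<omega>)"
  by (simp add: cutoff_def)

lemma finite_measure_cutoff:
  assumes "sets (R \<omega>) = sets borel" "emeasure (R \<omega>) (window K) < \<infinity>"
  shows "finite_measure (cutoff K R \<omega>)"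
proof (rule finite_measureI)
  have "space (cutoff K R \<omega>) = UNIV"
    using assms(1) sets_eq_imp_space_eq[of "cutoff K R \<omega>" borel] by simp
  then show "emeasure (cutoff K R \<omega>) (space (cutoff K R \<omega>)) \<noteq> \<infinity>"
    using assms by (simp add: emeasure_cutoff)
qed

lemma lf_kernel_cutoff: "lf_kernel M R \<Longrightarrow> finite_kernel M (cutoff K R)"
  unfolding lf_kernel_def finite_kernel_def
  by (auto simp: finite_measure_cutoff measure_cutoff cong: measurable_cong)

text \<open>Boxes generate the Borel sets, and a box cut to a window is again a box; a Dynkin
  argument inside the window does the rest.\<close>

lemma lf_kernelI:
  assumes s: "\<And>\<omega>. \<omega> \<in> space M \<Longrightarrow> sets (R \<omega>) = sets borel"
    and f: "\<And>\<omega> K. \<omega> \<in> space M \<Longrightarrow> emeasure (R \<omega>) (window K) < \<infinity>"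
    and m: "\<And>a b c d. a \<le> b \<Longrightarrow> c \<le> d \<Longrightarrow> (\<lambda>\<omega>. measure (R \<omega>) (box2 a b c d)) \<in> borel_measurable M"
  shows "lf_kernel M R"
  unfolding lf_kernel_def
proof (intro conjI allI ballI)
  fix K and B :: "(real \<times> real) set" assume "B \<in> sets borel"
  then have mem: "B \<in> sigma_sets UNIV boxes" by (simp add: boxes_generate)
  have cl: "boxes \<subseteq> Pow UNIV" by simp
  from boxes_Int_stable cl mem
  show "(\<lambda>\<omega>. measure (R \<omega>) (B \<inter> window K)) \<in> borel_measurable M"
  proof (induction rule: sigma_sets_induct_disjoint)
    case (basic B)
    then obtain a b c d where B: "B \<inter> window K = box2 a b c d"
      by (auto simp: boxes_def box2_Int)
    show ?case
    proof (cases "a \<le> b \<and> c \<le> d")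
      case False
      then have "box2 a b c d = {}" by (auto simp: box2_def)
      then show ?thesis by (simp add: B)
    qed (simp add: B m)
  next
    case (compl B)
    then have B: "B \<in> sets borel" by (simp add: boxes_generate)
    have "(\<lambda>\<omega>. measure (R \<omega>) (window K) - measure (R \<omega>) (B \<inter> window K)) \<in> borel_measurable M"
      using compl m by (intro borel_measurable_diff) auto
    also have "?this \<longleftrightarrow> ?case"
    proof (rule measurable_cong)
      fix \<omega> assume w: "\<omega> \<in> space M"
      interpret finite_measure "cutoff K R \<omega>" using s[OF w] f[OF w] by (rule finite_measure_cutoff)
      have "space (cutoff K R \<omega>) = UNIV"
        using s[OF w] sets_eq_imp_space_eq[of "cutoff K R \<omega>" borel] by simp
      then have "measure (cutoff K R \<omega>) (UNIV - B) = measure (cutoff K R \<omega>) UNIV - measure (cutoff K R \<omega>) B"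
        using finite_measure_compl[of B] B s[OF w] by simp
      moreover have "measure (cutoff K R \<omega>) C = measure (R \<omega>) (C \<inter> window K)" if "C \<in> sets borel" for C
        using s[OF w] that by (rule measure_cutoff)
      ultimately show "measure (R \<omega>) (window K) - measure (R \<omega>) (B \<inter> window K) = measure (R \<omega>) ((UNIV - B) \<inter> window K)"
        using B by simp
    qed
    finally show ?case .
  next
    case (union B)
    have B: "B i \<in> sets borel" for i using union(2) by (auto simp: boxes_generate)
    have "(\<lambda>\<omega>. \<Sum>i. measure (R \<omega>) (B i \<inter> window K)) \<in> borel_measurable M"
      using union by (intro borel_measurable_suminf) auto
    also have "?this \<longleftrightarrow> ?case"
    proof (rule measurable_cong)
      fix \<omega> assume w: "\<omega> \<in> space M"
      interpret finite_measure "cutoff K R \<omega>" using s[OF w] f[OF w] by (rule finite_measure_cutoff)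
      have "(\<lambda>i. measure (cutoff K R \<omega>) (B i)) sums measure (cutoff K R \<omega>) (\<Union>i. B i)"
        using B union(1) s[OF w] by (intro finite_measure_UNION) auto
      then show "(\<Sum>i. measure (R \<omega>) (B i \<inter> window K)) = measure (R \<omega>) ((\<Union>i. B i) \<inter> window K)"
        using B s[OF w] by (simp add: measure_cutoff sums_iff sets.countable_UN)
    qed
    finally show ?case .
  qed auto
qed (use s f in auto)

lemma lf_kernel_measurable:
  assumes R: "lf_kernel M R" and B: "B \<in> sets borel" "bounded B"
  shows "(\<lambda>\<omega>. measure (R \<omega>) B) \<in> borel_measurable M"
proof -
  obtain K where "B \<subseteq> window K" using bounded_subset_window[OF B(2)] by blast
  then have "B \<inter> window K = B" by blast
  then show ?thesis using R B(1) unfolding lf_kernel_def by metis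
qed

text \<open>The window that contains a section depends on the outcome, so measurability comes from a
  pointwise limit over growing windows, which is eventually constant.\<close>

lemma lf_kernel_section_measurable:
  assumes R: "lf_kernel M R" and S: "S \<in> sets (M \<Otimes>\<^sub>M borel)"
    and bd: "\<And>\<omega>. \<omega> \<in> space M \<Longrightarrow> bounded (Pair \<omega> -` S)"
  shows "(\<lambda>\<omega>. measure (R \<omega>) (Pair \<omega> -` S)) \<in> borel_measurable M"
proof (rule borel_measurable_LIMSEQ_real)
  show "(\<lambda>\<omega>. measure (cutoff K R \<omega>) (Pair \<omega> -` S)) \<in> borel_measurable M" for K
    by (intro finite_kernel_section_measurable lf_kernel_cutoff R S)
  fix \<omega> assume w: "\<omega> \<in> space M"
  obtain K where K: "Pair \<omega> -` S \<subseteq> window K" using bounded_subset_window[OF bd[OF w]] by blast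
  have "measure (cutoff n R \<omega>) (Pair \<omega> -` S) = measure (R \<omega>) (Pair \<omega> -` S)" if "n \<ge> K" for n
  proof -
    have "Pair \<omega> -` S \<inter> window n = Pair \<omega> -` S" using K window_mono[OF that] by blast
    then show ?thesis using R w section_borel[OF S] by (simp add: lf_kernel_def measure_cutoff)
  qed
  then show "(\<lambda>n. measure (cutoff n R \<omega>) (Pair \<omega> -` S)) \<longlonglongrightarrow> measure (R \<omega>) (Pair \<omega> -` S)"
    by (intro tendsto_eventually) (auto simp: eventually_sequentially)
qed

text \<open>The sides of a window are integers, so at every level it consists of whole cells, and
  cutting off at a window leaves the counts of these cells unchanged.\<close>

lemma window_idx:
  "window K = idx n -` ({- (int K * 2 ^ n)<..int K * 2 ^ n} \<times> {- (int K * 2 ^ n)<..int K * 2 ^ n})"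
proof -
  have 1: "- real K < x \<and> x \<le> real K \<longleftrightarrow> - (int K * 2 ^ n) < \<lceil>2 ^ n * x\<rceil> \<and> \<lceil>2 ^ n * x\<rceil> \<le> int K * 2 ^ n" for x
  proof -
    have "- real K < x \<longleftrightarrow> 2 ^ n * (- real K) < 2 ^ n * x"
      by (rule mult_less_cancel_left_pos[symmetric]) simp
    then have "- real K < x \<longleftrightarrow> of_int (- (int K * 2 ^ n)) < 2 ^ n * x"
      by (simp add: mult.commute)
    moreover have "x \<le> real K \<longleftrightarrow> 2 ^ n * x \<le> of_int (int K * 2 ^ n)"
      by (simp add: field_simps)
    ultimately show ?thesis by (simp only: less_ceiling_iff ceiling_le_iff)
  qed
  show ?thesis
    by (auto simp: box2_def idx_def 1)
qed

lemma bounded_cell: "bounded (idx n -` {c})"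
proof -
  have "idx n -` {c} \<subseteq> {(real_of_int (fst c) - 1) / 2 ^ n..real_of_int (fst c) / 2 ^ n} \<times> {(real_of_int (snd c) - 1) / 2 ^ n..real_of_int (snd c) / 2 ^ n}"
    by (auto simp: idx_def field_simps) linarith+
  then show ?thesis by (rule bounded_subset[rotated]) (intro bounded_Times bounded_closed_interval)
qed

locale cox_lf_kernels = cond_prob +
  fixes Z V :: "'a \<Rightarrow> (real \<times> real) measure"
  assumes Z: "lf_kernel M Z" and VG: "lf_kernel G V"
begin

lemma V: "lf_kernel M V"
  using VG G_space by (auto simp: lf_kernel_def intro: G_measurable)

text \<open>The finite case is applied inside each window. For each outcome the sections are
  bounded, so the truncated counts and means become constant as the window grows.\<close>

lemma cond_poisson_random_bounded_sets:
  fixes k :: nat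
  assumes Zint: "\<And>\<omega> B. \<omega> \<in> space M \<Longrightarrow> B \<in> sets borel \<Longrightarrow> bounded B \<Longrightarrow> measure (Z \<omega>) B \<in> \<nat>"
    and cells: "\<And>n I. finite I \<Longrightarrow> cond_poisson M G I (\<lambda>c \<omega>. measure (Z \<omega>) (idx n -` {c})) (\<lambda>c \<omega>. measure (V \<omega>) (idx n -` {c}))"
    and S: "\<And>j. j < k \<Longrightarrow> S j \<in> sets (G \<Otimes>\<^sub>M borel)" and dis: "disjoint_family_on S {..<k}"
    and bd: "\<And>j \<omega>. j < k \<Longrightarrow> \<omega> \<in> space M \<Longrightarrow> bounded (Pair \<omega> -` S j)"
  shows "cond_poisson M G {..<k} (\<lambda>j \<omega>. measure (Z \<omega>) (Pair \<omega> -` S j)) (\<lambda>j \<omega>. measure (V \<omega>) (Pair \<omega> -` S j))"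
proof (rule cond_poisson_limit)
  fix K
  interpret C: cox_kernels M G "cutoff K Z" "cutoff K V"
    by unfold_locales (rule lf_kernel_cutoff Z VG)+
  \<comment> \<open>The lower bound is strict because a cell lies to the left of its index.\<close>
  let ?I = "\<lambda>n. {- (int K * 2 ^ n)<..int K * 2 ^ n} \<times> {- (int K * 2 ^ n)<..int K * 2 ^ n}"
  have sZ: "sets (Z \<omega>) = sets borel" "sets (V \<omega>) = sets borel" if "\<omega> \<in> space M" for \<omega>
    using that Z V by (auto simp: lf_kernel_def)
  show "cond_poisson M G {..<k} (\<lambda>j \<omega>. measure (cutoff K Z \<omega>) (Pair \<omega> -` S j)) (\<lambda>j \<omega>. measure (cutoff K V \<omega>) (Pair \<omega> -` S j))"
  proof (rule C.cond_poisson_random_sets)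
    show "finite (?I n)" for n by simp
    show "measure (cutoff K Z \<omega>) B \<in> \<nat>" if "\<omega> \<in> space M" "B \<in> sets borel" for \<omega> B
      using that by (auto simp: measure_cutoff sZ intro!: Zint bounded_subset[OF bounded_box2])
    have "- (idx n -` ?I n) \<inter> window K = {}" for n
      by (simp only: window_idx[of K n]) auto
    then show "measure (cutoff K Z \<omega>) (- (idx n -` ?I n)) = 0" "measure (cutoff K V \<omega>) (- (idx n -` ?I n)) = 0" if "\<omega> \<in> space M" for n \<omega>
      using that by (simp_all add: measure_cutoff sZ Compl_eq_Diff_UNIV)
    show "cond_poisson M G (?I n) (\<lambda>c \<omega>. measure (cutoff K Z \<omega>) (idx n -` {c})) (\<lambda>c \<omega>. measure (cutoff K V \<omega>) (idx n -` {c}))" for n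
    proof -
      have "idx n -` {c} \<inter> window K = idx n -` {c}" if "c \<in> ?I n" for c
        using that by (simp only: window_idx[of K n]) auto
      then have eq: "measure (cutoff K Z \<omega>) (idx n -` {c}) = measure (Z \<omega>) (idx n -` {c})"
        "measure (cutoff K V \<omega>) (idx n -` {c}) = measure (V \<omega>) (idx n -` {c})" if "c \<in> ?I n" "\<omega> \<in> space M" for c \<omega>
        using that by (simp_all add: measure_cutoff sZ)
      show ?thesis
      proof (rule cond_poisson_cong_AE[OF _ cells])
        show "(\<lambda>\<omega>. measure (Z \<omega>) (idx n -` {c})) \<in> borel_measurable M" "(\<lambda>\<omega>. measure (V \<omega>) (idx n -` {c})) \<in> borel_measurable M" for c
          by (intro lf_kernel_measurable Z V bounded_cell idx_vimage_borel)+
        show "(\<lambda>\<omega>. measure (cutoff K Z \<omega>) (idx n -` {c})) \<in> borel_measurable M" "(\<lambda>\<omega>. measure (cutoff K V \<omega>) (idx n -` {c})) \<in> borel_measurable M" for c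
          using C.Z C.V by (auto simp: finite_kernel_def)
      qed (auto intro!: AE_I2 eq[symmetric])
    qed
  qed (use S dis in auto)
  show "(\<lambda>\<omega>. measure (cutoff K Z \<omega>) (Pair \<omega> -` S j)) \<in> borel_measurable M"
    "(\<lambda>\<omega>. measure (cutoff K V \<omega>) (Pair \<omega> -` S j)) \<in> borel_measurable M" if "j \<in> {..<k}" for j
    using that by (intro finite_kernel_section_measurable C.Z C.V sets_pair_G S; simp)+
next
  show "(\<lambda>\<omega>. measure (Z \<omega>) (Pair \<omega> -` S j)) \<in> borel_measurable M"
    "(\<lambda>\<omega>. measure (V \<omega>) (Pair \<omega> -` S j)) \<in> borel_measurable M" if "j \<in> {..<k}" for j
    using that by (intro lf_kernel_section_measurable Z V sets_pair_G S bd; simp)+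
next
  have ev: "\<forall>\<^sub>F K in sequentially. measure (cutoff K R \<omega>) (Pair \<omega> -` S j) = measure (R \<omega>) (Pair \<omega> -` S j)"
    if R: "lf_kernel M R" and j: "j < k" and w: "\<omega> \<in> space M" for R j \<omega>
  proof -
    obtain K where K: "Pair \<omega> -` S j \<subseteq> window K" using bounded_subset_window[OF bd[OF j w]] by blast
    have "measure (cutoff n R \<omega>) (Pair \<omega> -` S j) = measure (R \<omega>) (Pair \<omega> -` S j)" if "n \<ge> K" for n
    proof -
      have "Pair \<omega> -` S j \<inter> window n = Pair \<omega> -` S j" using K window_mono[OF that] by blast
      then show ?thesis using R w section_borel[OF S[OF j]] by (simp add: lf_kernel_def measure_cutoff)
    qed
    then show ?thesis by (auto simp: eventually_sequentially)
  qed
  show "AE \<omega> in M. \<forall>\<^sub>F n in sequentially. measure (cutoff n Z \<omega>) (Pair \<omega> -` S j) = measure (Z \<omega>) (Pair \<omega> -` S j)" if "j \<in> {..<k}" for j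
    using that by (intro AE_I2 ev[OF Z]) auto
  show "AE \<omega> in M. (\<lambda>n. measure (cutoff n V \<omega>) (Pair \<omega> -` S j)) \<longlonglongrightarrow> measure (V \<omega>) (Pair \<omega> -` S j)" if "j \<in> {..<k}" for j
    using that by (intro AE_I2 tendsto_eventually ev[OF V]) auto
qed auto

end

subsection \<open>Regular paths\<close>

text \<open>For a monotone path a dense range forces continuity and surjectivity, and this can be
  tested on rational times and levels. Being the identity at negative times makes the path map the
  line onto itself, so that no case distinction at 0 is needed later.\<close>

definition reg_path :: "(real \<Rightarrow> real) \<Rightarrow> bool" where
  "reg_path f \<longleftrightarrow> mono f \<and> (\<forall>a b. a < b \<longrightarrow> (\<exists>x. a < f x \<and> f x < b)) \<and> (\<forall>t\<le>0. f t = t)"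

lemma reg_pathD:
  assumes "reg_path f"
  shows "x \<le> y \<Longrightarrow> f x \<le> f y" "a < b \<Longrightarrow> \<exists>x. a < f x \<and> f x < b" "t \<le> 0 \<Longrightarrow> f t = t"
  using assms by (auto simp: reg_path_def monoD)

lemma reg_path_id: "reg_path (\<lambda>t. t)"
  unfolding reg_path_def by (simp add: mono_def dense)

lemma reg_path_nonneg: "reg_path f \<Longrightarrow> 0 \<le> t \<Longrightarrow> 0 \<le> f t"
  using reg_pathD(1)[of f 0 t] reg_pathD(3)[of f 0] by simp

lemma reg_path_less: "reg_path f \<Longrightarrow> f x < f y \<Longrightarrow> x < y"
  using reg_pathD(1)[of f y x] by (meson not_le)

lemma reg_path_isCont:
  assumes f: "reg_path f"
  shows "isCont f x"
  unfolding continuous_at_eps_delta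
proof (intro allI impI)
  fix e :: real assume "e > 0"
  obtain y where y: "f x < f y" "f y < f x + e" using reg_pathD(2)[OF f, of "f x" "f x + e"] \<open>e > 0\<close> by auto
  obtain z where z: "f x - e < f z" "f z < f x" using reg_pathD(2)[OF f, of "f x - e" "f x"] \<open>e > 0\<close> by auto
  have "dist (f x') (f x) < e" if "dist x' x < min (y - x) (x - z)" for x'
  proof -
    have "z \<le> x'" "x' \<le> y" using that by (auto simp: dist_real_def)
    then show ?thesis using reg_pathD(1)[OF f] y z by (smt (verit) dist_real_def)
  qed
  moreover have "0 < min (y - x) (x - z)" using reg_path_less[OF f y(1)] reg_path_less[OF f z(2)] by simp
  ultimately show "\<exists>d>0. \<forall>x'. dist x' x < d \<longrightarrow> dist (f x') (f x) < e" by blast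
qed

text \<open>The witness is the last time at which the path has not exceeded \<open>u\<close>: by
  continuity the supremum is attained, and a value below \<open>u\<close> there would contradict the
  dense range.\<close>

lemma reg_path_inverse:
  assumes f: "reg_path f"
  obtains t where "\<And>s. f s \<le> u \<longleftrightarrow> s \<le> t" "f t = u"
proof -
  define t where "t = Sup {s. f s \<le> u}"
  obtain y where y: "u < f y" using reg_pathD(2)[OF f, of u "u + 1"] by auto
  have bdd: "bdd_above {s. f s \<le> u}"
  proof (rule bdd_aboveI[of _ y])
    fix s assume "s \<in> {s. f s \<le> u}"
    then show "s \<le> y" using reg_path_less[OF f, of s y] y by simp
  qed
  have "f (min u 0) \<le> u" using reg_pathD(3)[OF f, of "min u 0"] by simp
  then have ne: "{s. f s \<le> u} \<noteq> {}" by blast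
  have cl: "closed {s. f s \<le> u}"
    by (intro closed_Collect_le continuous_at_imp_continuous_on ballI reg_path_isCont f continuous_on_const)
  have t: "f t \<le> u" using closed_contains_Sup[OF ne bdd cl] by (simp add: t_def)
  have le: "f s \<le> u \<longleftrightarrow> s \<le> t" for s
    using cSup_upper[OF _ bdd, of s] t reg_pathD(1)[OF f, of s t] by (auto simp: t_def)
  moreover have "f t = u"
  proof (rule ccontr)
    assume "f t \<noteq> u"
    then obtain z where z: "f t < f z" "f z < u" using t reg_pathD(2)[OF f, of "f t" u] by auto
    then show False using le[of z] reg_path_less[OF f z(1)] by auto
  qed
  ultimately show thesis using that by blast
qed

lemma reg_path_borel [measurable]: "reg_path f \<Longrightarrow> f \<in> borel_measurable borel"
  by (intro borel_measurable_continuous_onI continuous_at_imp_continuous_on ballI reg_path_isCont)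

section \<open>Stieltjes measures of regular paths and their products\<close>

text \<open>Taking the positive part removes the mass that the identity branch would put on negative
  times.\<close>

definition stieltjes :: "(real \<Rightarrow> real) \<Rightarrow> real measure" where
  "stieltjes f = interval_measure (\<lambda>t. max 0 (f t))"

lemma sets_stieltjes [simp, measurable_cong]: "sets (stieltjes f) = sets borel"
  by (simp add: stieltjes_def)

lemma space_stieltjes [simp]: "space (stieltjes f) = UNIV"
  by (simp add: stieltjes_def)

lemma reg_path_max_mono: "reg_path f \<Longrightarrow> x \<le> y \<Longrightarrow> max 0 (f x) \<le> max 0 (f y)"
  using reg_pathD(1)[of f x y] by (intro max.mono) auto

lemma reg_path_max_cont: "reg_path f \<Longrightarrow> continuous (at_right a) (\<lambda>t. max 0 (f t))"
  by (rule continuous_at_imp_continuous_at_within[OF continuous_max[OF continuous_const reg_path_isCont]])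

lemma emeasure_stieltjes_Ioc:
  "reg_path f \<Longrightarrow> a \<le> b \<Longrightarrow> emeasure (stieltjes f) {a<..b} = ennreal (max 0 (f b) - max 0 (f a))"
  unfolding stieltjes_def by (intro emeasure_interval_measure_Ioc reg_path_max_mono reg_path_max_cont)

lemma sigma_finite_stieltjes: "reg_path f \<Longrightarrow> sigma_finite_measure (stieltjes f)"
  unfolding stieltjes_def by (intro sigma_finite_interval_measure reg_path_max_mono reg_path_max_cont)

text \<open>A path maps its own Stieltjes measure to Lebesgue measure on the positive half line: the
  preimage of \<open>(a,b]\<close> lies between the last times at the levels \<open>a\<close> and
  \<open>b\<close>.\<close>

lemma emeasure_stieltjes_vimage:
  assumes f: "reg_path f" and "a \<le> b"
  shows "emeasure (stieltjes f) (f -` {a<..b}) = ennreal (max 0 b - max 0 a)"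
proof -
  obtain s where s: "\<And>x. f x \<le> a \<longleftrightarrow> x \<le> s" "f s = a" using reg_path_inverse[OF f] by blast
  obtain t where t: "\<And>x. f x \<le> b \<longleftrightarrow> x \<le> t" "f t = b" using reg_path_inverse[OF f] by blast
  have "f -` {a<..b} = {s<..t}" using s(1) t(1) by (auto simp: not_le[symmetric])
  moreover have "s \<le> t" using t(1)[of s] s(2) \<open>a \<le> b\<close> by simp
  ultimately show ?thesis using emeasure_stieltjes_Ioc[OF f, of s t] s t by simp
qed

text \<open>These are the flat stretches without their left endpoints. Requiring a rational witness
  makes the set a countable union of intervals on which the path does not increase.\<close>

lemma emeasure_stieltjes_flat:
  assumes f: "reg_path f"
  shows "emeasure (stieltjes f) {s. \<exists>q\<in>\<rat>. q < s \<and> f q = f s} = 0"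
proof -
  have "{q<..} \<inter> f -` {f q} \<in> null_sets (stieltjes f)" for q
  proof -
    obtain t where t: "\<And>s. f s \<le> f q \<longleftrightarrow> s \<le> t" "f t = f q" using reg_path_inverse[OF f] by blast
    have "{q<..} \<inter> f -` {f q} = {q<..t}"
    proof (intro set_eqI iffI)
      fix x assume "x \<in> {q<..t}"
      then show "x \<in> {q<..} \<inter> f -` {f q}"
        using t(1)[of x] reg_pathD(1)[OF f, of q x] by simp
    next
      fix x assume "x \<in> {q<..} \<inter> f -` {f q}"
      then show "x \<in> {q<..t}" using t(1)[of x] by simp
    qed
    moreover have "q \<le> t" using t(1)[of q] by simp
    ultimately show ?thesis using emeasure_stieltjes_Ioc[OF f, of q t] t(2) by (auto simp: null_sets_def)
  qed
  then have "(\<Union>q\<in>\<rat>. {q<..} \<inter> f -` {f q}) \<in> null_sets (stieltjes f)"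
    by (intro null_sets_UN' countable_rat)
  moreover have "(\<Union>q\<in>\<rat>. {q<..} \<inter> f -` {f q}) = {s. \<exists>q\<in>\<rat>. q < s \<and> f q = f s}"
    by auto
  ultimately show ?thesis by (simp add: null_sets_def)
qed

definition stieltjes2 :: "(real \<Rightarrow> real) \<Rightarrow> (real \<Rightarrow> real) \<Rightarrow> (real \<times> real) measure" where
  "stieltjes2 f g = stieltjes f \<Otimes>\<^sub>M stieltjes g"

lemma sets_stieltjes2 [simp, measurable_cong]: "sets (stieltjes2 f g) = sets borel"
  unfolding stieltjes2_def borel_prod[symmetric] by (intro sets_pair_measure_cong) simp_all

lemma space_stieltjes2 [simp]: "space (stieltjes2 f g) = UNIV"
  by (simp add: stieltjes2_def space_pair_measure)

lemma emeasure_stieltjes2_Times: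
  "reg_path g \<Longrightarrow> A \<in> sets borel \<Longrightarrow> B \<in> sets borel \<Longrightarrow>
    emeasure (stieltjes2 f g) (A \<times> B) = emeasure (stieltjes f) A * emeasure (stieltjes g) B"
  unfolding stieltjes2_def by (intro sigma_finite_measure.emeasure_pair_measure_Times sigma_finite_stieltjes) simp_all

lemma emeasure_stieltjes2_box2:
  "reg_path f \<Longrightarrow> reg_path g \<Longrightarrow> a \<le> b \<Longrightarrow> c \<le> d \<Longrightarrow>
    emeasure (stieltjes2 f g) (box2 a b c d) = ennreal ((max 0 (f b) - max 0 (f a)) * (max 0 (g d) - max 0 (g c)))"
  unfolding box2_def
  using reg_path_max_mono[of f a b] reg_path_max_mono[of g c d]
  by (simp add: emeasure_stieltjes2_Times emeasure_stieltjes_Ioc ennreal_mult[symmetric] del: max.bounded_iff)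

lemma emeasure_lborel_Ioc_nonneg: "a \<le> b \<Longrightarrow> emeasure lborel ({a<..b} \<inter> {0..}) = ennreal (max 0 b - max 0 a)"
proof -
  assume "a \<le> b"
  consider "0 \<le> a" | "a < 0" "0 \<le> b" | "b < 0" by linarith
  then show ?thesis
  proof cases
    case 1
    then have "{a<..b} \<inter> {0..} = {a<..b}" by auto
    then show ?thesis using 1 \<open>a \<le> b\<close> by simp
  next
    case 2
    then have "{a<..b} \<inter> {0..} = {0..b}" by auto
    then show ?thesis using 2 by simp
  next
    case 3
    then have "{a<..b} \<inter> {0..} = {}" by auto
    then show ?thesis using 3 \<open>a \<le> b\<close> by (simp add: max_def)
  qed
qed

lemma quadrant_borel [measurable, simp]: "quadrant \<in> sets borel"
  unfolding quadrant_def borel_prod[symmetric] by simp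

text \<open>The product form of \<open>emeasure_stieltjes_vimage\<close>; the quadrant appears
  because neither factor charges negative times.\<close>

lemma distr_stieltjes2:
  assumes f: "reg_path f" and g: "reg_path g"
  shows "distr (stieltjes2 f g) borel (map_prod f g) = density lborel (indicator quadrant)"
proof (rule measure_eqI_boxes)
  note [measurable] = reg_path_borel[OF f] reg_path_borel[OF g]
  have m [measurable]: "map_prod f g \<in> borel \<rightarrow>\<^sub>M borel"
    unfolding borel_prod[symmetric] map_prod_def by measurable
  have m': "map_prod f g \<in> stieltjes2 f g \<rightarrow>\<^sub>M borel"
    using m by (simp cong: measurable_cong_sets)
  have vim: "map_prod f g -` box2 a b c d \<inter> space (stieltjes2 f g) = f -` {a<..b} \<times> g -` {c<..d}" for a b c d
    by (auto simp: box2_def)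
  show "emeasure (distr (stieltjes2 f g) borel (map_prod f g)) (box2 a b c d) = emeasure (density lborel (indicator quadrant)) (box2 a b c d)"
    if le: "a \<le> b" "c \<le> d" for a b c d
  proof -
  have "emeasure (distr (stieltjes2 f g) borel (map_prod f g)) (box2 a b c d) = emeasure (stieltjes2 f g) (f -` {a<..b} \<times> g -` {c<..d})"
    by (simp only: emeasure_distr[OF m' box2_borel] vim)
  also have "\<dots> = ennreal (max 0 b - max 0 a) * ennreal (max 0 d - max 0 c)"
    using measurable_sets[OF reg_path_borel[OF f], of "{a<..b}"] measurable_sets[OF reg_path_borel[OF g], of "{c<..d}"] f g le
    by (simp add: emeasure_stieltjes2_Times emeasure_stieltjes_vimage)
  finally have 1: "emeasure (distr (stieltjes2 f g) borel (map_prod f g)) (box2 a b c d) = ennreal (max 0 b - max 0 a) * ennreal (max 0 d - max 0 c)" .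
  have "emeasure (density lborel (indicator quadrant)) (box2 a b c d) = emeasure lborel (quadrant \<inter> box2 a b c d)"
    by (subst emeasure_density) (simp_all flip: indicator_inter_arith)
  also have "quadrant \<inter> box2 a b c d = ({a<..b} \<inter> {0..}) \<times> ({c<..d} \<inter> {0..})"
    by (auto simp: quadrant_def box2_def)
  also have "emeasure lborel \<dots> = emeasure (lborel \<Otimes>\<^sub>M lborel) (({a<..b} \<inter> {0..}) \<times> ({c<..d} \<inter> {0..}))"
    by (simp only: lborel_prod)
  also have "\<dots> = ennreal (max 0 b - max 0 a) * ennreal (max 0 d - max 0 c)"
    using le by (simp add: lborel.emeasure_pair_measure_Times emeasure_lborel_Ioc_nonneg)
  finally show ?thesis
    using 1 by simp
  qed
  show "emeasure (distr (stieltjes2 f g) borel (map_prod f g)) (window K) \<noteq> \<infinity>" for K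
  proof -
    have "emeasure (distr (stieltjes2 f g) borel (map_prod f g)) (window K) = emeasure (stieltjes2 f g) (f -` {- real K<..real K} \<times> g -` {- real K<..real K})"
      by (simp only: emeasure_distr[OF m' box2_borel] vim)
    also have "\<dots> < \<infinity>"
      using measurable_sets[OF reg_path_borel[OF f], of "{- real K<..real K}"] measurable_sets[OF reg_path_borel[OF g], of "{- real K<..real K}"] f g
      by (simp add: emeasure_stieltjes2_Times emeasure_stieltjes_vimage ennreal_mult_less_top)
    finally show ?thesis by simp
  qed
qed simp_all

lemma stieltjes2_lf_kernel:
  assumes "\<And>\<omega>. \<omega> \<in> space M \<Longrightarrow> reg_path (\<lambda>t. Y1 t \<omega>)" "\<And>\<omega>. \<omega> \<in> space M \<Longrightarrow> reg_path (\<lambda>t. Y2 t \<omega>)"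
    and [measurable]: "\<And>t. Y1 t \<in> borel_measurable M" "\<And>t. Y2 t \<in> borel_measurable M" and "0 \<le> lam"
  shows "lf_kernel M (\<lambda>\<omega>. scale_measure (ennreal lam) (stieltjes2 (\<lambda>t. Y1 t \<omega>) (\<lambda>t. Y2 t \<omega>)))"
proof (rule lf_kernelI)
  fix a b c d :: real assume le: "a \<le> b" "c \<le> d"
  have eq: "measure (scale_measure (ennreal lam) (stieltjes2 (\<lambda>t. Y1 t \<omega>) (\<lambda>t. Y2 t \<omega>))) (box2 a b c d)
      = lam * ((max 0 (Y1 b \<omega>) - max 0 (Y1 a \<omega>)) * (max 0 (Y2 d \<omega>) - max 0 (Y2 c \<omega>)))" if "\<omega> \<in> space M" for \<omega>
    using emeasure_stieltjes2_box2[OF assms(1,2)[OF that] le] assms(5) le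
      reg_path_max_mono[OF assms(1)[OF that] le(1)] reg_path_max_mono[OF assms(2)[OF that] le(2)]
    by (simp add: measure_def emeasure_scale_measure ennreal_mult'[symmetric] enn2real_mult)
  have "(\<lambda>\<omega>. lam * ((max 0 (Y1 b \<omega>) - max 0 (Y1 a \<omega>)) * (max 0 (Y2 d \<omega>) - max 0 (Y2 c \<omega>)))) \<in> borel_measurable M"
    by measurable
  then show "(\<lambda>\<omega>. measure (scale_measure (ennreal lam) (stieltjes2 (\<lambda>t. Y1 t \<omega>) (\<lambda>t. Y2 t \<omega>))) (box2 a b c d)) \<in> borel_measurable M"
    by (subst measurable_cong[OF eq])
next
  fix \<omega> K assume "\<omega> \<in> space M"
  then show "emeasure (scale_measure (ennreal lam) (stieltjes2 (\<lambda>t. Y1 t \<omega>) (\<lambda>t. Y2 t \<omega>))) (window K) < \<infinity>"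
    by (simp add: emeasure_stieltjes2_box2[OF assms(1,2)] ennreal_mult_less_top)
qed simp

subsection \<open>Inverse stable subordinators have regular versions\<close>

lemma sigma_gen_sets:
  "sets (sigma_gen \<Omega> I Z) = sigma_sets \<Omega> {Z i -` A \<inter> \<Omega> | i A. i \<in> I \<and> A \<in> sets borel}"
  unfolding sigma_gen_def by (rule sets_measure_of) auto

lemma sigma_gen_space [simp]: "space (sigma_gen \<Omega> I Z) = \<Omega>"
  unfolding sigma_gen_def by (rule space_measure_of) auto

lemma sigma_gen_measurable: "i \<in> I \<Longrightarrow> Z i \<in> borel_measurable (sigma_gen \<Omega> I Z)"
  by (rule measurableI) (auto simp: sigma_gen_sets)

context prob_space
begin

lemma prob_le_integral:
  fixes f :: "'a \<Rightarrow> real"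
  assumes "integrable M f" "A \<in> events" "\<And>\<omega>. \<omega> \<in> space M \<Longrightarrow> 0 \<le> f \<omega>" "\<And>\<omega>. \<omega> \<in> A \<Longrightarrow> 1 \<le> f \<omega>"
  shows "prob A \<le> expectation f"
proof -
  have "prob A = (\<integral>\<omega>. indicator A \<omega> \<partial>M)"
    using sets.sets_into_space[OF assms(2)] by (simp add: Int_absorb2)
  also have "\<dots> \<le> expectation f"
    using assms by (intro integral_mono integrable_real_indicator) (auto simp: indicator_def emeasure_eq_measure)
  finally show ?thesis .
qed

text \<open>On the event that \<open>L h\<close> is at most 0 the variable
  \<open>exp (- s * L h)\<close> is at least 1, so the probability is bounded by the Laplace
  transform, which tends to 0 as \<open>s\<close> grows.\<close>

lemma stable_subordinator_pos:
  assumes L: "stable_subordinator M \<alpha> L" and \<alpha>: "0 < \<alpha>" and h: "0 < h"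
  shows "AE \<omega> in M. 0 < L h \<omega>"
proof -
  have [measurable]: "L h \<in> borel_measurable M"
    using L h by (auto simp: stable_subordinator_def levy_subordinator_def)
  have "AE \<omega> in M. L 0 \<omega> = 0 \<and> mono_on {0..} (\<lambda>t. L t \<omega>)"
    using L by (auto simp: stable_subordinator_def levy_subordinator_def)
  then have nn: "AE \<omega> in M. 0 \<le> L h \<omega>"
    by eventually_elim (use h in \<open>force dest: mono_onD[of _ _ 0 h]\<close>)
  have le: "prob {\<omega> \<in> space M. L h \<omega> \<le> 0} \<le> exp (- h * real n)" for n
  proof -
    \<comment> \<open>Chosen so that \<open>s powr \<alpha>\<close> equals \<open>n\<close>.\<close>
    define s where "s = real n powr (1 / \<alpha>)"
    have s: "0 \<le> s" "s powr \<alpha> = real n" using \<alpha> by (auto simp: s_def powr_powr)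
    have "integrable M (\<lambda>\<omega>. exp (- s * L h \<omega>))"
      by (rule integrable_const_bound[where B = 1]) (use nn s in \<open>auto elim!: AE_mp\<close>)
    then have "prob {\<omega> \<in> space M. L h \<omega> \<le> 0} \<le> (\<integral>\<omega>. exp (- s * L h \<omega>) \<partial>M)"
      using s by (intro prob_le_integral) (auto simp: mult_nonneg_nonpos)
    also have "\<dots> = exp (- h * real n)"
      using L h s by (simp add: stable_subordinator_def)
    finally show ?thesis .
  qed
  have "(\<lambda>n. exp (- h * real n)) \<longlonglongrightarrow> 0"
    using h by real_asymp
  then have "prob {\<omega> \<in> space M. L h \<omega> \<le> 0} \<le> 0"
    by (rule LIMSEQ_le_const) (use le in auto)
  then have "prob {\<omega> \<in> space M. L h \<omega> \<le> 0} = 0"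
    using measure_nonneg[of M] by (auto intro: antisym)
  then have "AE \<omega> in M. \<not> L h \<omega> \<le> 0"
    by (subst (asm) prob_eq_0) auto
  then show ?thesis by (simp add: not_le)
qed

text \<open>By stationarity the increment has the law of \<open>L (q - p)\<close>, which is almost
  surely positive.\<close>

lemma stable_subordinator_increment:
  assumes L: "stable_subordinator M \<alpha> L" and \<alpha>: "0 < \<alpha>" and pq: "0 \<le> p" "p < q"
  shows "AE \<omega> in M. L p \<omega> < L q \<omega>"
proof -
  have [measurable]: "L t \<in> borel_measurable M" if "0 \<le> t" for t
    using L that by (auto simp: stable_subordinator_def levy_subordinator_def)
  have [measurable]: "L p \<in> borel_measurable M" "L q \<in> borel_measurable M" "L (q - p) \<in> borel_measurable M"
    using pq by auto
  have "\<forall>s\<ge>0. \<forall>h\<ge>0. distr M borel (\<lambda>\<omega>. L (s + h) \<omega> - L s \<omega>) = distr M borel (L h)"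
    using L unfolding stable_subordinator_def levy_subordinator_def by blast
  from this[rule_format, of p "q - p"] pq
  have d: "distr M borel (\<lambda>\<omega>. L q \<omega> - L p \<omega>) = distr M borel (L (q - p))"
    by simp
  have "AE \<omega> in M. 0 < L (q - p) \<omega>"
    using stable_subordinator_pos[OF L \<alpha>, of "q - p"] pq by simp
  then have "AE x in distr M borel (L (q - p)). 0 < x"
    by (subst AE_distr_iff) auto
  then have "AE x in distr M borel (\<lambda>\<omega>. L q \<omega> - L p \<omega>). 0 < x"
    by (simp only: d)
  then have "AE \<omega> in M. 0 < L q \<omega> - L p \<omega>"
    by (subst (asm) AE_distr_iff) auto
  then show ?thesis by simp
qed

text \<open>If all \<open>L n\<close> stay below \<open>K\<close>, then
  \<open>exp K * exp (- L n)\<close> is at least 1, while its mean is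
  \<open>exp K * exp (- n)\<close> and tends to 0.\<close>

lemma stable_subordinator_unbounded:
  assumes L: "stable_subordinator M \<alpha> L"
  shows "AE \<omega> in M. \<exists>n::nat. K < L (real n) \<omega>"
proof -
  have [measurable]: "L (real n) \<in> borel_measurable M" for n
    using L by (auto simp: stable_subordinator_def levy_subordinator_def)
  have "AE \<omega> in M. L 0 \<omega> = 0 \<and> mono_on {0..} (\<lambda>t. L t \<omega>)"
    using L by (auto simp: stable_subordinator_def levy_subordinator_def)
  then have nn: "AE \<omega> in M. \<forall>n. 0 \<le> L (real n) \<omega>"
  proof eventually_elim
    case (elim \<omega>)
    show ?case
    proof
      fix n show "0 \<le> L (real n) \<omega>" using elim mono_onD[of "{0..}" "\<lambda>t. L t \<omega>" 0 "real n"] by simp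
    qed
  qed
  let ?A = "{\<omega> \<in> space M. \<forall>n::nat. L (real n) \<omega> \<le> K}"
  have le: "prob ?A \<le> exp K * exp (- real n)" for n
  proof -
    have i: "integrable M (\<lambda>\<omega>. exp (- L (real n) \<omega>))"
      by (rule integrable_const_bound[where B = 1]) (use nn in \<open>auto elim!: AE_mp\<close>)
    then have "prob ?A \<le> (\<integral>\<omega>. exp K * exp (- L (real n) \<omega>) \<partial>M)"
      by (intro prob_le_integral integrable_mult_right) (auto simp: exp_add[symmetric])
    also have "\<dots> = exp K * exp (- real n)"
      using L[unfolded stable_subordinator_def, THEN conjunct2, rule_format, of "real n" 1] by simp
    finally show ?thesis .
  qed
  have "(\<lambda>n. exp K * exp (- real n)) \<longlonglongrightarrow> 0" by real_asymp
  then have "prob ?A \<le> 0"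
    by (rule LIMSEQ_le_const) (use le in auto)
  then have "prob ?A = 0"
    using measure_nonneg[of M] by (auto intro: antisym)
  then have "AE \<omega> in M. \<not> (\<forall>n::nat. L (real n) \<omega> \<le> K)"
    by (subst (asm) prob_eq_0) auto
  then show ?thesis by (simp add: not_le)
qed

end

text \<open>Strict growth on rational pairs extends to all pairs by monotonicity. Hence the times at
  which \<open>l\<close> exceeds \<open>l u\<close> are exactly those after \<open>u\<close>, so
  \<open>y (l u) = u\<close> and \<open>y\<close> is onto. Unboundedness keeps the sets in the
  infimum nonempty, which gives monotonicity.\<close>

lemma inverse_path:
  fixes l y :: "real \<Rightarrow> real"
  assumes l0: "l 0 = 0" and mono: "mono_on {0..} l"
    and strict: "\<And>p q. p \<in> \<rat> \<Longrightarrow> q \<in> \<rat> \<Longrightarrow> 0 \<le> p \<Longrightarrow> p < q \<Longrightarrow> l p < l q"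
    and unbdd: "\<And>m::nat. \<exists>n::nat. real m < l (real n)"
    and y: "\<And>t. 0 \<le> t \<Longrightarrow> y t = Inf {u. 0 \<le> u \<and> l u > t}"
  shows "y 0 = 0" and "0 \<le> s \<Longrightarrow> s \<le> t \<Longrightarrow> y s \<le> y t" and "0 \<le> u \<Longrightarrow> \<exists>t\<ge>0. y t = u"
proof -
  have less: "l a < l b" if "0 \<le> a" "a < b" for a b
  proof -
    obtain p where p: "p \<in> \<rat>" "a < p" "p < b" using Rats_dense_in_real[OF \<open>a < b\<close>] by blast
    obtain q where q: "q \<in> \<rat>" "p < q" "q < b" using Rats_dense_in_real[OF \<open>p < b\<close>] by blast
    have "l a \<le> l p" "l q \<le> l b" using p q that by (auto intro!: mono_onD[OF mono])
    then show ?thesis using strict[of p q] p q that by simp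
  qed
  have yl: "y (l u) = u" "0 \<le> l u" if "0 \<le> u" for u
  proof -
    show "0 \<le> l u" using mono_onD[OF mono, of 0 u] l0 that by simp
    have "0 \<le> v \<and> l v > l u \<longleftrightarrow> v \<in> {u<..}" for v
      using that less[of u v] mono_onD[OF mono, of v u] by (cases "u < v") auto
    then have "{v. 0 \<le> v \<and> l v > l u} = {u<..}" by blast
    then show "y (l u) = u" using y[OF \<open>0 \<le> l u\<close>] by simp
  qed
  show "y 0 = 0" using yl[of 0] l0 by simp
  show "\<exists>t\<ge>0. y t = u" if "0 \<le> u" using yl[OF that] by blast
  show "y s \<le> y t" if "0 \<le> s" "s \<le> t"
  proof -
    obtain m :: nat where "t < real m" using reals_Archimedean2 by blast
    moreover obtain n :: nat where "real m < l (real n)" using unbdd by blast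
    ultimately have "real n \<in> {u. 0 \<le> u \<and> l u > t}" by simp
    then have "{u. 0 \<le> u \<and> l u > t} \<noteq> {}" by blast
    then have "Inf {u. 0 \<le> u \<and> l u > s} \<le> Inf {u. 0 \<le> u \<and> l u > t}"
      by (rule cInf_superset_mono) (use that in \<open>auto intro!: bdd_belowI[of _ 0]\<close>)
    then show ?thesis using y that by simp
  qed
qed

text \<open>Strictness for rational pairs and unboundedness at integer levels are countably many
  almost sure facts, so they hold simultaneously outside one null set.\<close>

lemma (in prob_space) inverse_stable_subordinator_path:
  assumes Y: "inverse_stable_subordinator M \<alpha> Y" and \<alpha>: "0 < \<alpha>"
  shows "AE \<omega> in M. Y 0 \<omega> = 0 \<and> (\<forall>s t. 0 \<le> s \<longrightarrow> s \<le> t \<longrightarrow> Y s \<omega> \<le> Y t \<omega>) \<and> (\<forall>u\<ge>0. \<exists>t\<ge>0. Y t \<omega> = u)"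
proof -
  obtain L where L: "stable_subordinator M \<alpha> L"
    and Yeq: "AE \<omega> in M. \<forall>t\<ge>0. Y t \<omega> = Inf {u. 0 \<le> u \<and> L u \<omega> > t}"
    using Y by (auto simp: inverse_stable_subordinator_def)
  have "AE \<omega> in M. L 0 \<omega> = 0 \<and> mono_on {0..} (\<lambda>t. L t \<omega>)"
    using L by (auto simp: stable_subordinator_def levy_subordinator_def)
  moreover have "AE \<omega> in M. \<forall>p\<in>\<rat>. \<forall>q\<in>\<rat>. 0 \<le> p \<longrightarrow> p < q \<longrightarrow> L p \<omega> < L q \<omega>"
    using stable_subordinator_increment[OF L \<alpha>] by (simp add: AE_ball_countable countable_rat)
  moreover have "AE \<omega> in M. \<forall>m::nat. \<exists>n::nat. real m < L (real n) \<omega>"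
    using stable_subordinator_unbounded[OF L] by (simp add: AE_all_countable)
  ultimately show ?thesis
    using Yeq
  proof eventually_elim
    case (elim \<omega>)
    then show ?case
      using inverse_path[of "\<lambda>t. L t \<omega>" "\<lambda>t. Y t \<omega>"] by blast
  qed
qed

text \<open>The exceptional set has to be measurable for the process itself, so it is expressed through
  countably many coordinates.\<close>

lemma (in prob_space) regular_version:
  assumes Y: "inverse_stable_subordinator M \<alpha> Y" and \<alpha>: "0 < \<alpha>"
  obtains Y' where "\<And>\<omega>. reg_path (\<lambda>t. Y' t \<omega>)" "\<And>t. Y' t \<in> borel_measurable (sigma_process M Y)"
    "AE \<omega> in M. \<forall>t\<ge>0. Y t \<omega> = Y' t \<omega>"
proof -
  let ?S = "sigma_process M Y" and ?R = "\<rat> \<inter> {0::real..}"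
  have m [measurable]: "Y t \<in> borel_measurable ?S" if "0 \<le> t" for t
    unfolding sigma_process_def using that by (intro sigma_gen_measurable) simp
  have cR: "countable ?R" by (intro countable_Int1 countable_rat)
  define E where "E = {\<omega> \<in> space ?S. Y 0 \<omega> = 0 \<and> (\<forall>p\<in>?R. \<forall>q\<in>?R. p \<le> q \<longrightarrow> Y p \<omega> \<le> Y q \<omega>)
    \<and> (\<forall>a\<in>?R. \<forall>b\<in>?R. a < b \<longrightarrow> (\<exists>q\<in>?R. a < Y q \<omega> \<and> Y q \<omega> < b))}"
  have E [measurable]: "E \<in> sets ?S"
    unfolding E_def using cR by (intro sets.sets_Collect sets.sets_Collect_countable_Ball sets.sets_Collect_countable_Bex sets.sets_Collect_imp
      borel_measurable_less borel_measurable_le borel_measurable_eq m) auto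
  \<comment> \<open>On \<open>E\<close> the path is rebuilt from later rational times; elsewhere,
    and at nonpositive times, it is the identity, which is regular. The maximum with 0 bounds the
    infimum below for every outcome.\<close>
  define Y' where "Y' t \<omega> = (if 0 < t \<and> \<omega> \<in> E then (INF q\<in>\<rat> \<inter> {t..}. max 0 (Y q \<omega>)) else t)" for t \<omega>
  have ne: "\<rat> \<inter> {t..} \<noteq> {}" for t :: real
    using Rats_dense_in_real[of t "t + 1"] by auto
  have bdd: "bdd_below ((\<lambda>q. max 0 (Y q \<omega>)) ` A)" for A \<omega>
    by (rule bdd_belowI[of _ 0]) auto
  have INF_eq: "Y' q \<omega> = Y q \<omega>" if "\<omega> \<in> E" "q \<in> \<rat>" "0 < q" for q \<omega>
  proof -
    have mono: "Y p \<omega> \<le> Y p' \<omega>" if "p \<in> ?R" "p' \<in> ?R" "p \<le> p'" for p p'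
      using that \<open>\<omega> \<in> E\<close> unfolding E_def by blast
    have le: "Y q \<omega> \<le> Y p \<omega>" if "p \<in> \<rat>" "q \<le> p" for p
      using that \<open>q \<in> \<rat>\<close> \<open>0 < q\<close> by (intro mono) auto
    have "Y 0 \<omega> = 0" using \<open>\<omega> \<in> E\<close> by (simp add: E_def)
    then have nn: "0 \<le> Y q \<omega>" using mono[of 0 q] \<open>q \<in> \<rat>\<close> \<open>0 < q\<close> by simp
    have "(INF p\<in>\<rat> \<inter> {q..}. max 0 (Y p \<omega>)) = max 0 (Y q \<omega>)"
    proof (rule antisym)
      show "(INF p\<in>\<rat> \<inter> {q..}. max 0 (Y p \<omega>)) \<le> max 0 (Y q \<omega>)"
        using \<open>q \<in> \<rat>\<close> by (intro cINF_lower bdd) auto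
      show "max 0 (Y q \<omega>) \<le> (INF p\<in>\<rat> \<inter> {q..}. max 0 (Y p \<omega>))"
        using le by (intro cINF_greatest ne max.mono) auto
    qed
    then show ?thesis using that nn by (simp add: Y'_def)
  qed
  have nonneg: "0 \<le> Y' t \<omega>" if "0 < t" for t \<omega>
    using that ne by (auto simp: Y'_def intro!: cINF_greatest)
  have reg: "reg_path (\<lambda>t. Y' t \<omega>)" for \<omega>
  proof (cases "\<omega> \<in> E")
    case False
    then show ?thesis by (auto simp: reg_path_def Y'_def mono_def intro: dense)
  next
    case True
    show ?thesis
      unfolding reg_path_def
    proof (intro conjI allI impI)
      show "mono (\<lambda>t. Y' t \<omega>)"
      proof (rule monoI)
        fix s t :: real assume "s \<le> t"
        show "Y' s \<omega> \<le> Y' t \<omega>"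
        proof (cases "0 < s")
          case True
          have "(INF q\<in>\<rat> \<inter> {s..}. max 0 (Y q \<omega>)) \<le> (INF q\<in>\<rat> \<inter> {t..}. max 0 (Y q \<omega>))"
            using \<open>s \<le> t\<close> by (intro cINF_superset_mono ne bdd) auto
          then show ?thesis using True \<open>\<omega> \<in> E\<close> \<open>s \<le> t\<close> by (simp add: Y'_def)
        next
          case False
          then have "Y' s \<omega> = s" by (simp add: Y'_def)
          moreover have "s \<le> Y' t \<omega>"
            using False \<open>s \<le> t\<close> nonneg[of t \<omega>] by (cases "0 < t") (auto simp: Y'_def)
          ultimately show ?thesis by simp
        qed
      qed
      fix a b :: real assume "a < b"
      show "\<exists>x. a < Y' x \<omega> \<and> Y' x \<omega> < b"
      proof (cases "a < 0")
        case True
        obtain x where "a < x" "x < min b 0" using dense[of a "min b 0"] True \<open>a < b\<close> by auto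
        then show ?thesis by (intro exI[of _ x]) (simp add: Y'_def)
      next
        case False
        obtain a' where a': "a' \<in> \<rat>" "a < a'" "a' < b" using Rats_dense_in_real[OF \<open>a < b\<close>] by blast
        obtain b' where b': "b' \<in> \<rat>" "a' < b'" "b' < b" using Rats_dense_in_real[OF \<open>a' < b\<close>] by blast
        have "\<forall>a\<in>?R. \<forall>b\<in>?R. a < b \<longrightarrow> (\<exists>q\<in>?R. a < Y q \<omega> \<and> Y q \<omega> < b)"
          using \<open>\<omega> \<in> E\<close> unfolding E_def by blast
        moreover have "a' \<in> ?R" "b' \<in> ?R" using a' b' False by auto
        ultimately obtain q where q: "q \<in> ?R" "a' < Y q \<omega>" "Y q \<omega> < b'"
          using b'(2) by blast
        have "q \<noteq> 0" using q a' False \<open>\<omega> \<in> E\<close> by (auto simp: E_def)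
        then have "Y' q \<omega> = Y q \<omega>" using q by (intro INF_eq[OF True]) auto
        then show ?thesis using q a' b' by (intro exI[of _ q]) auto
      qed
    qed (simp add: Y'_def)
  qed
  moreover have "Y' t \<in> borel_measurable ?S" for t
  proof (cases "0 < t")
    case True
    have "(\<lambda>\<omega>. INF q\<in>\<rat> \<inter> {t..}. max 0 (Y q \<omega>)) \<in> borel_measurable ?S"
    proof (rule borel_measurable_cINF)
      show "countable (\<rat> \<inter> {t..})" by (intro countable_Int1 countable_rat)
      show "(\<lambda>\<omega>. max 0 (Y q \<omega>)) \<in> borel_measurable ?S" if "q \<in> \<rat> \<inter> {t..}" for q
        using that True by (intro borel_measurable_max borel_measurable_const m) auto
    qed (rule bdd)
    then show ?thesis using True E unfolding Y'_def[abs_def] by simp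
  qed (simp add: Y'_def[abs_def])
  moreover have "AE \<omega> in M. \<forall>t\<ge>0. Y t \<omega> = Y' t \<omega>"
    using inverse_stable_subordinator_path[OF Y \<alpha>] AE_space
  proof eventually_elim
    case (elim \<omega>)
    then have Y0: "Y 0 \<omega> = 0" and mono: "\<And>s t. 0 \<le> s \<Longrightarrow> s \<le> t \<Longrightarrow> Y s \<omega> \<le> Y t \<omega>"
      and surj: "\<And>u. 0 \<le> u \<Longrightarrow> \<exists>t\<ge>0. Y t \<omega> = u" by blast+
    \<comment> \<open>Surjectivity yields times with two different values between \<open>a\<close>
      and \<open>b\<close>; a rational time between them has a value in the same range by
      monotonicity.\<close>
    have between: "\<exists>q\<in>?R. a < Y q \<omega> \<and> Y q \<omega> < b" if "0 \<le> a" "a < b" for a b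
    proof -
      obtain c d where cd: "a < c" "c < d" "d < b" using dense[OF \<open>a < b\<close>] dense by meson
      obtain s t where st: "0 \<le> s" "Y s \<omega> = c" "0 \<le> t" "Y t \<omega> = d"
        using surj[of c] surj[of d] cd \<open>0 \<le> a\<close> by auto
      have "s < t" using mono[of t s] st cd by (cases "s < t") auto
      then obtain q where "q \<in> \<rat>" "s < q" "q < t" using Rats_dense_in_real by blast
      then show ?thesis using mono[of s q] mono[of q t] st cd by (intro bexI[of _ q]) auto
    qed
    have wE: "\<omega> \<in> E"
      unfolding E_def using elim(2) Y0 mono between by (auto simp: sigma_process_def)
    show ?case
    proof (intro allI impI)
      fix t :: real assume "0 \<le> t"
      show "Y t \<omega> = Y' t \<omega>"
      proof (cases "t = 0")
        case False
        then have "0 < t" using \<open>0 \<le> t\<close> by simp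
        have nn: "0 \<le> Y t \<omega>" using mono[of 0 t] Y0 \<open>0 \<le> t\<close> by simp
        have le: "Y t \<omega> \<le> Y' t \<omega>"
          using \<open>0 < t\<close> wE mono nn unfolding Y'_def by (auto intro!: cINF_greatest ne max.coboundedI2)
        have "\<not> Y t \<omega> < Y' t \<omega>"
        proof
          assume "Y t \<omega> < Y' t \<omega>"
          \<comment> \<open>A rational time with value strictly between \<open>Y t\<close> and
            \<open>Y' t\<close> must come after \<open>t\<close>, and then it belongs to the infimum
            defining \<open>Y' t\<close>, a contradiction.\<close>
          then obtain q where q: "q \<in> ?R" "Y t \<omega> < Y q \<omega>" "Y q \<omega> < Y' t \<omega>" using between[OF nn] by blast
          then have "t \<le> q" using mono[of q t] by (cases "t \<le> q") auto
          then have "Y' t \<omega> \<le> Y' q \<omega>" using reg_pathD(1)[OF reg] by blast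
          also have "\<dots> = Y q \<omega>" using q \<open>t \<le> q\<close> \<open>0 < t\<close> by (intro INF_eq[OF wE]) auto
          finally show False using q by simp
        qed
        then show ?thesis using le by simp
      qed (simp add: Y0 Y'_def)
    qed
  qed
  ultimately show thesis using that by blast
qed

text \<open>Connects the intensity of the definitions, a product of measures on restricted spaces,
  with the Stieltjes measure on the plane. At negative times the first distribution function is 0 by
  definition, the second by the positive part.\<close>

lemma product_path_measure_eq:
  assumes f: "reg_path f1" "reg_path f2"
    and eq: "\<And>t. 0 \<le> t \<Longrightarrow> Y1 t \<omega> = f1 t" "\<And>t. 0 \<le> t \<Longrightarrow> Y2 t \<omega> = f2 t"
    and B: "B \<in> sets borel" "B \<subseteq> quadrant"
  shows "measure (product_path_measure Y1 Y2 \<omega>) B = measure (stieltjes2 f1 f2) B"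
proof -
  have pm: "path_measure Y \<omega> = restrict_space (stieltjes f) {0..}"
    if "reg_path f" "\<And>t. 0 \<le> t \<Longrightarrow> Y t \<omega> = f t" for Y :: "real \<Rightarrow> 'a \<Rightarrow> real" and f
  proof -
    have "(\<lambda>t. if t < 0 then 0 else Y t \<omega>) = (\<lambda>t. max 0 (f t))"
      using that reg_path_nonneg[OF that(1)] reg_pathD(3)[OF that(1)] by (auto simp: fun_eq_iff max_def not_less)
    then show ?thesis by (simp add: path_measure_def stieltjes_def)
  qed
  let ?R1 = "restrict_space (stieltjes f1) {0..}" and ?R2 = "restrict_space (stieltjes f2) {0..}"
  have sp: "space ?R1 = {0..}" "space ?R2 = {0..}" by (simp_all add: space_restrict_space)
  have Bm: "B \<in> sets (?R1 \<Otimes>\<^sub>M ?R2)"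
  proof -
    have "(\<lambda>p. (fst p, snd p)) \<in> ?R1 \<Otimes>\<^sub>M ?R2 \<rightarrow>\<^sub>M borel \<Otimes>\<^sub>M borel"
      by (intro measurable_Pair measurable_compose[OF measurable_fst] measurable_compose[OF measurable_snd] measurable_restrict_space1) (simp_all add: measurable_ident_sets)
    moreover have "B \<in> sets (borel \<Otimes>\<^sub>M borel)" using B(1) by (simp only: borel_prod)
    ultimately have "(\<lambda>p. (fst p, snd p)) -` B \<inter> space (?R1 \<Otimes>\<^sub>M ?R2) \<in> sets (?R1 \<Otimes>\<^sub>M ?R2)"
      by (rule measurable_sets)
    also have "(\<lambda>p. (fst p, snd p)) -` B \<inter> space (?R1 \<Otimes>\<^sub>M ?R2) = B"
      using B(2) by (auto simp: space_pair_measure sp quadrant_def)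
    finally show ?thesis .
  qed
  interpret S2: sigma_finite_measure "stieltjes f2" by (rule sigma_finite_stieltjes[OF f(2)])
  interpret R2: sigma_finite_measure ?R2
    by (rule sigma_finite_measure_restrict_space) (use S2.sigma_finite_measure_axioms in auto)
  have Bs: "Pair x -` B \<in> sets borel" for x
    using sets_Pair1[of B borel borel x] B(1) by (simp only: borel_prod)
  have sub: "Pair x -` B \<subseteq> {0..}" for x using B(2) by (auto simp: quadrant_def)
  have "emeasure (?R1 \<Otimes>\<^sub>M ?R2) B = (\<integral>\<^sup>+x. emeasure ?R2 (Pair x -` B) \<partial>?R1)"
    by (rule R2.emeasure_pair_measure_alt[OF Bm])
  also have "\<dots> = (\<integral>\<^sup>+x. emeasure (stieltjes f2) (Pair x -` B) \<partial>?R1)"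
    using Bs sub by (intro nn_integral_cong emeasure_restrict_space) auto
  also have "\<dots> = (\<integral>\<^sup>+x. emeasure (stieltjes f2) (Pair x -` B) * indicator {0..} x \<partial>stieltjes f1)"
    by (subst nn_integral_restrict_space) auto
  also have "\<dots> = (\<integral>\<^sup>+x. emeasure (stieltjes f2) (Pair x -` B) \<partial>stieltjes f1)"
  proof (rule nn_integral_cong)
    fix x
    have "Pair x -` B = {}" if "x < 0" using B(2) that by (auto simp: quadrant_def)
    then show "emeasure (stieltjes f2) (Pair x -` B) * indicator {0..} x = emeasure (stieltjes f2) (Pair x -` B)"
      by (auto simp: indicator_def not_le)
  qed
  also have "\<dots> = emeasure (stieltjes2 f1 f2) B"
    unfolding stieltjes2_def using B(1)
    by (intro S2.emeasure_pair_measure_alt[symmetric]) (simp add: borel_prod[symmetric] cong: sets_pair_measure_cong)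
  finally show ?thesis
    using pm[OF f(1), of Y1] pm[OF f(2), of Y2] eq by (simp add: product_path_measure_def measure_def)
qed

subsection \<open>Counting processes as kernels on the plane\<close>

lemma Times_borel: "A \<in> sets borel \<Longrightarrow> B \<in> sets borel \<Longrightarrow> A \<times> B \<in> sets (borel :: (real \<times> real) measure)"
  unfolding borel_prod[symmetric] by simp

text \<open>The image under the inclusion of the quadrant, so that the results on kernels on the
  plane apply; nothing is added outside the quadrant.\<close>

definition ext :: "('a \<Rightarrow> (real \<times> real) measure) \<Rightarrow> 'a \<Rightarrow> (real \<times> real) measure" where
  "ext X \<omega> = distr (X \<omega>) borel (\<lambda>p. p)"

lemma sets_ext [simp]: "sets (ext X \<omega>) = sets borel"
  by (simp add: ext_def)

lemma emeasure_ext: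
  assumes "sets (X \<omega>) = sets (restrict_space borel quadrant)" "B \<in> sets borel"
  shows "emeasure (ext X \<omega>) B = emeasure (X \<omega>) (B \<inter> quadrant)"
proof -
  have sp: "space (X \<omega>) = quadrant"
    using sets_eq_imp_space_eq[OF assms(1)] by (simp add: space_restrict_space)
  have "(\<lambda>p. p) \<in> restrict_space borel quadrant \<rightarrow>\<^sub>M borel"
    by (rule measurable_restrict_space1) simp
  then have "(\<lambda>p. p) \<in> X \<omega> \<rightarrow>\<^sub>M borel"
    by (simp cong: measurable_cong_sets add: assms(1))
  then show ?thesis
    unfolding ext_def using assms(2) by (subst emeasure_distr) (auto simp: sp vimage_def)
qed

lemma measure_ext:
  "sets (X \<omega>) = sets (restrict_space borel quadrant) \<Longrightarrow> B \<in> sets borel \<Longrightarrow>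
    measure (ext X \<omega>) B = measure (X \<omega>) (B \<inter> quadrant)"
  by (simp add: measure_def emeasure_ext)

lemma counting_processD:
  assumes "counting_process M X" "\<omega> \<in> space M"
  shows "sets (X \<omega>) = sets (restrict_space borel quadrant)"
    and "B \<in> bounded_borel_sets \<Longrightarrow> \<exists>k::nat. emeasure (X \<omega>) B = of_nat k"
  using assms by (auto simp: counting_process_def)

lemma bounded_borel_Int_quadrant: "B \<in> sets borel \<Longrightarrow> bounded B \<Longrightarrow> B \<inter> quadrant \<in> bounded_borel_sets"
  by (auto simp: bounded_borel_sets_def intro: bounded_subset)

lemma counting_ext_nat:
  assumes "counting_process M X" "\<omega> \<in> space M" "B \<in> sets borel" "bounded B"
  obtains k :: nat where "emeasure (ext X \<omega>) B = of_nat k" "measure (ext X \<omega>) B = real k"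
proof -
  obtain k :: nat where "emeasure (X \<omega>) (B \<inter> quadrant) = of_nat k"
    using counting_processD(2)[OF assms(1,2)] bounded_borel_Int_quadrant[OF assms(3,4)] by blast
  then show thesis
    using that[of k] emeasure_ext[of X \<omega> B] counting_processD(1)[OF assms(1,2)] assms(3)
    by (simp add: measure_def flip: ennreal_of_nat_eq_real_of_nat)
qed

lemma counting_ext_Nats:
  "counting_process M X \<Longrightarrow> \<omega> \<in> space M \<Longrightarrow> B \<in> sets borel \<Longrightarrow> bounded B \<Longrightarrow> measure (ext X \<omega>) B \<in> \<nat>"
  by (erule counting_ext_nat[where B = B]) auto

lemma counting_ext_finite:
  "counting_process M X \<Longrightarrow> \<omega> \<in> space M \<Longrightarrow> B \<in> sets borel \<Longrightarrow> bounded B \<Longrightarrow> emeasure (ext X \<omega>) B < \<infinity>"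
  by (erule counting_ext_nat[where B = B]) (auto simp: of_nat_less_top)

lemma counting_lf_kernel:
  assumes X: "counting_process M X"
  shows "lf_kernel M (ext X)"
proof (rule lf_kernelI)
  fix a b c d :: real
  have "(\<lambda>\<omega>. emeasure (X \<omega>) (box2 a b c d \<inter> quadrant)) \<in> borel_measurable M"
    using X bounded_borel_Int_quadrant[OF box2_borel bounded_box2] by (simp add: counting_process_def)
  then have "(\<lambda>\<omega>. measure (X \<omega>) (box2 a b c d \<inter> quadrant)) \<in> borel_measurable M"
    unfolding measure_def by measurable
  then show "(\<lambda>\<omega>. measure (ext X \<omega>) (box2 a b c d)) \<in> borel_measurable M"
    by (subst measurable_cong[where g = "\<lambda>\<omega>. measure (X \<omega>) (box2 a b c d \<inter> quadrant)"])
      (auto intro!: measure_ext counting_processD[OF X])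
qed (use counting_ext_finite[OF X _ box2_borel bounded_box2] in auto)

text \<open>The distribution function of \<open>ext X\<close>. \<open>count_field\<close> vanishes
  at negative arguments anyway; the explicit case lets facts known for nonnegative arguments extend
  to the corners of all cells.\<close>

definition count0 :: "('a \<Rightarrow> (real \<times> real) measure) \<Rightarrow> real \<Rightarrow> real \<Rightarrow> 'a \<Rightarrow> real" where
  "count0 X a b \<omega> = (if a < 0 \<or> b < 0 then 0 else count_field X a b \<omega>)"

lemma Icc_Times_bounded_borel: "{0..a} \<times> {0..b} \<in> bounded_borel_sets"
  unfolding bounded_borel_sets_def using Times_borel[of "{0..a}" "{0..b}"]
  by (auto simp: quadrant_def intro!: bounded_Times)

lemma lower_borel: "{..a} \<times> {..b} \<in> sets (borel :: (real \<times> real) measure)"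
  by (simp add: Times_borel)

lemma lower_quadrant: "({..a} \<times> {..b}) \<inter> quadrant = {0..a} \<times> {0..b}"
  by (auto simp: quadrant_def)

lemma measure_ext_lower:
  assumes X: "counting_process M X" and w: "\<omega> \<in> space M"
  shows "measure (ext X \<omega>) ({..a} \<times> {..b}) = count0 X a b \<omega>" "emeasure (ext X \<omega>) ({..a} \<times> {..b}) \<noteq> top"
proof -
  note s = counting_processD(1)[OF X w]
  show "measure (ext X \<omega>) ({..a} \<times> {..b}) = count0 X a b \<omega>"
    by (auto simp: measure_ext[where X = X, OF s lower_borel] lower_quadrant count0_def count_field_def)
  obtain k :: nat where "emeasure (X \<omega>) ({0..a} \<times> {0..b}) = of_nat k"
    using counting_processD(2)[OF X w Icc_Times_bounded_borel] by blast
  then show "emeasure (ext X \<omega>) ({..a} \<times> {..b}) \<noteq> top"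
    by (simp add: emeasure_ext[where X = X, OF s lower_borel] lower_quadrant)
qed

lemma measure_ext_box2:
  assumes X: "counting_process M X" and w: "\<omega> \<in> space M" and le: "a \<le> b" "c \<le> d"
  shows "measure (ext X \<omega>) (box2 a b c d) = count0 X b d \<omega> - count0 X a d \<omega> - count0 X b c \<omega> + count0 X a c \<omega>"
proof -
  let ?Q = "\<lambda>a b. {..a} \<times> {..b} :: (real \<times> real) set"
  note [simp] = measure_ext_lower[OF X w] lower_borel
  have 1: "measure (ext X \<omega>) (?Q b e - ?Q a e) = count0 X b e \<omega> - count0 X a e \<omega>" for e
    using le by (subst measure_Diff) auto
  have fin: "emeasure (ext X \<omega>) (?Q b d - ?Q a d) \<noteq> \<infinity>"
    using emeasure_mono[of "?Q b d - ?Q a d" "?Q b d" "ext X \<omega>"] measure_ext_lower(2)[OF X w, of b d]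
    by (auto simp: top_unique)
  have "box2 a b c d = (?Q b d - ?Q a d) - (?Q b c - ?Q a c)"
    by (auto simp: box2_def)
  moreover have "measure (ext X \<omega>) ((?Q b d - ?Q a d) - (?Q b c - ?Q a c)) = measure (ext X \<omega>) (?Q b d - ?Q a d) - measure (ext X \<omega>) (?Q b c - ?Q a c)"
  proof (rule measure_Diff[OF fin])
    show "?Q b d - ?Q a d \<in> sets (ext X \<omega>)" "?Q b c - ?Q a c \<in> sets (ext X \<omega>)"
      by (simp_all add: sets.Diff)
    show "?Q b c - ?Q a c \<subseteq> ?Q b d - ?Q a d" using le by auto
  qed
  ultimately show ?thesis by (simp add: 1)
qed

lemma increment_eq:
  assumes "counting_process M X" "\<omega> \<in> space M" "0 \<le> s1" "s1 \<le> t1" "0 \<le> s2" "s2 \<le> t2"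
  shows "increment X s1 s2 t1 t2 \<omega> = measure (ext X \<omega>) (box2 s1 t1 s2 t2)"
  using assms by (simp add: measure_ext_box2 increment_def count0_def)

lemma cell_box2:
  "idx n -` {c} = box2 ((real_of_int (fst c) - 1) / 2 ^ n) (real_of_int (fst c) / 2 ^ n)
    ((real_of_int (snd c) - 1) / 2 ^ n) (real_of_int (snd c) / 2 ^ n)"
  by (auto simp: idx_def box2_def prod_eq_iff ceiling_eq_iff field_simps)

text \<open>There is no atom at 0 either, so the axes carry no mass of the product measure.\<close>

lemma stieltjes_nonpos: "reg_path f \<Longrightarrow> emeasure (stieltjes f) {..0} = 0"
proof -
  assume f: "reg_path f"
  have "{- real n<..0} \<in> null_sets (stieltjes f)" for n
    using emeasure_stieltjes_Ioc[OF f, of "- real n" 0] reg_pathD(3)[OF f] by (simp add: null_sets_def)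
  then have "(\<Union>n. {- real n<..0}) \<in> null_sets (stieltjes f)" by (rule null_sets_UN)
  moreover have "(\<Union>n. {- real n<..0}) = {..0}"
  proof safe
    fix x :: real assume "x \<le> 0"
    obtain n :: nat where "- x < real n" using reals_Archimedean2 by blast
    then show "x \<in> (\<Union>n. {- real n<..0})" using \<open>x \<le> 0\<close> by (auto intro!: exI[of _ n])
  qed auto
  ultimately show ?thesis by (simp add: null_sets_def)
qed

lemma stieltjes2_null:
  assumes f: "reg_path f" "reg_path g" and A: "A \<in> sets borel"
  shows "emeasure (stieltjes f) A = 0 \<Longrightarrow> A \<times> UNIV \<in> null_sets (stieltjes2 f g)"
    and "emeasure (stieltjes g) A = 0 \<Longrightarrow> UNIV \<times> A \<in> null_sets (stieltjes2 f g)"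
proof -
  have "A \<times> (UNIV :: real set) \<in> sets borel" "(UNIV :: real set) \<times> A \<in> sets borel"
    using A by (simp_all add: Times_borel)
  then show "emeasure (stieltjes f) A = 0 \<Longrightarrow> A \<times> UNIV \<in> null_sets (stieltjes2 f g)"
    "emeasure (stieltjes g) A = 0 \<Longrightarrow> UNIV \<times> A \<in> null_sets (stieltjes2 f g)"
    using A f by (auto simp: null_sets_def emeasure_stieltjes2_Times)
qed

lemma stieltjes2_quadrant:
  assumes f: "reg_path f" "reg_path g" and B: "B \<in> sets borel"
  shows "measure (stieltjes2 f g) (B \<inter> quadrant) = measure (stieltjes2 f g) B"
proof -
  have n: "{..0} \<times> UNIV \<in> null_sets (stieltjes2 f g)" "UNIV \<times> {..0} \<in> null_sets (stieltjes2 f g)"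
    using stieltjes2_null[OF f, of "{..0}"] stieltjes_nonpos[OF f(1)] stieltjes_nonpos[OF f(2)] by auto
  have "B - quadrant \<in> null_sets (stieltjes2 f g)"
  proof (rule null_sets_subset[OF null_sets.Un[OF n]])
    show "B - quadrant \<in> sets (stieltjes2 f g)" using B by simp
    show "B - quadrant \<subseteq> {..0} \<times> UNIV \<union> UNIV \<times> {..0}" by (auto simp: quadrant_def)
  qed
  then have "emeasure (stieltjes2 f g) (B - (B - quadrant)) = emeasure (stieltjes2 f g) B"
    using B by (intro emeasure_Diff_null_set) auto
  moreover have "B - (B - quadrant) = B \<inter> quadrant" by auto
  ultimately show ?thesis by (simp add: measure_def)
qed

lemma measure_stieltjes2_id:
  assumes B: "B \<in> sets borel" "B \<subseteq> quadrant"
  shows "measure (stieltjes2 (\<lambda>t. t) (\<lambda>t. t)) B = measure lborel B"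
proof -
  have "emeasure (density lborel (indicator quadrant)) B = emeasure (stieltjes2 (\<lambda>t. t) (\<lambda>t. t)) B"
    unfolding distr_stieltjes2[OF reg_path_id reg_path_id, symmetric] using B(1)
    by (subst emeasure_distr) (auto simp: map_prod_def vimage_def measurable_ident_sets)
  moreover have "emeasure (density lborel (indicator quadrant)) B = emeasure lborel B"
    using B by (subst emeasure_density) (auto simp: Int_absorb1 simp flip: indicator_inter_arith)
  ultimately show ?thesis by (simp add: measure_def)
qed

section \<open>The conditional Poisson property on bounded Borel sets\<close>

text \<open>The form in which the three conditions of the theorem meet, applied to
  \<open>ext X\<close> and the intensity measure.\<close>

definition (in cond_prob) cond_poisson_borel ::
  "('a \<Rightarrow> (real \<times> real) measure) \<Rightarrow> ('a \<Rightarrow> (real \<times> real) measure) \<Rightarrow> bool" where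
  "cond_poisson_borel Z V \<longleftrightarrow> (\<forall>k B. (\<forall>j<k. B j \<in> sets borel \<and> bounded (B j)) \<longrightarrow> disjoint_family_on B {..<k} \<longrightarrow>
     cond_poisson M G {..<k::nat} (\<lambda>j \<omega>. measure (Z \<omega>) (B j)) (\<lambda>j \<omega>. measure (V \<omega>) (B j)))"

lemma (in cond_prob) cond_poisson_borelD:
  fixes I :: "'i set"
  assumes cp: "cond_poisson_borel Z V" and I: "finite I" "\<And>i. i \<in> I \<Longrightarrow> B i \<in> sets borel" "\<And>i. i \<in> I \<Longrightarrow> bounded (B i)"
    "disjoint_family_on B I"
  shows "cond_poisson M G I (\<lambda>i \<omega>. measure (Z \<omega>) (B i)) (\<lambda>i \<omega>. measure (V \<omega>) (B i))"
proof -
  obtain h where h: "bij_betw h {..<card I} I"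
    using ex_bij_betw_nat_finite[OF I(1)] by (auto simp: atLeast0LessThan)
  have hI: "h j \<in> I" if "j < card I" for j using h that by (auto simp: bij_betw_def)
  show ?thesis
  proof (rule cond_poisson_reindex[OF h])
    have "disjoint_family_on (\<lambda>j. B (h j)) {..<card I}"
      unfolding disjoint_family_on_def
    proof (intro ballI impI)
      fix i j assume "i \<in> {..<card I}" "j \<in> {..<card I}" "i \<noteq> j"
      then have "h i \<noteq> h j" "h i \<in> I" "h j \<in> I"
        using h hI by (auto simp: bij_betw_def inj_on_def)
      then show "B (h i) \<inter> B (h j) = {}" using I(4) by (auto simp: disjoint_family_on_def)
    qed
    then show "cond_poisson M G {..<card I} (\<lambda>j \<omega>. measure (Z \<omega>) (B (h j))) (\<lambda>j \<omega>. measure (V \<omega>) (B (h j)))"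
      using cp hI I unfolding cond_poisson_borel_def by simp
  qed
qed

context cox_lf_kernels
begin

text \<open>A fixed set is a random set with constant section, so this is a case of
  \<open>cond_poisson_random_bounded_sets\<close>.\<close>

lemma cells_imp_cond_poisson_borel:
  assumes "\<And>\<omega> B. \<omega> \<in> space M \<Longrightarrow> B \<in> sets borel \<Longrightarrow> bounded B \<Longrightarrow> measure (Z \<omega>) B \<in> \<nat>"
    and "\<And>n I. finite I \<Longrightarrow> cond_poisson M G I (\<lambda>c \<omega>. measure (Z \<omega>) (idx n -` {c})) (\<lambda>c \<omega>. measure (V \<omega>) (idx n -` {c}))"
  shows "cond_poisson_borel Z V"
  unfolding cond_poisson_borel_def
proof (intro allI impI)
  fix k :: nat and B :: "nat \<Rightarrow> (real \<times> real) set"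
  assume B: "\<forall>j<k. B j \<in> sets borel \<and> bounded (B j)" "disjoint_family_on B {..<k}"
  have sec: "Pair \<omega> -` (space G \<times> B j) = B j" if "\<omega> \<in> space M" for \<omega> j
    using that by (auto simp: G_space)
  have "cond_poisson M G {..<k} (\<lambda>j \<omega>. measure (Z \<omega>) (Pair \<omega> -` (space G \<times> B j))) (\<lambda>j \<omega>. measure (V \<omega>) (Pair \<omega> -` (space G \<times> B j)))"
  proof (rule cond_poisson_random_bounded_sets[OF assms])
    show "space G \<times> B j \<in> sets (G \<Otimes>\<^sub>M borel)" if "j < k" for j
      using B(1) that by (intro pair_measureI) auto
    show "disjoint_family_on (\<lambda>j. space G \<times> B j) {..<k}"
      using B(2) by (auto simp: disjoint_family_on_def)
    show "bounded (Pair \<omega> -` (space G \<times> B j))" if "j < k" "\<omega> \<in> space M" for j \<omega>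
      using B(1) that by (simp only: sec)
  qed
  then show "cond_poisson M G {..<k} (\<lambda>j \<omega>. measure (Z \<omega>) (B j)) (\<lambda>j \<omega>. measure (V \<omega>) (B j))"
  proof (rule cond_poisson_cong_AE[rotated])
    fix c assume "c \<in> {..<k}"
    then have c: "B c \<in> sets borel" "bounded (B c)" using B(1) by auto
    show m: "(\<lambda>\<omega>. measure (Z \<omega>) (B c)) \<in> borel_measurable M" "(\<lambda>\<omega>. measure (V \<omega>) (B c)) \<in> borel_measurable M"
      using c by (intro lf_kernel_measurable Z V; simp)+
    show "(\<lambda>\<omega>. measure (Z \<omega>) (Pair \<omega> -` (space G \<times> B c))) \<in> borel_measurable M"
      using m(1) by (rule measurable_cong[THEN iffD1, rotated]) (simp only: sec)
    show "(\<lambda>\<omega>. measure (V \<omega>) (Pair \<omega> -` (space G \<times> B c))) \<in> borel_measurable M"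
      using m(2) by (rule measurable_cong[THEN iffD1, rotated]) (simp only: sec)
    show "AE \<omega> in M. measure (Z \<omega>) (Pair \<omega> -` (space G \<times> B c)) = measure (Z \<omega>) (B c)"
      by (rule AE_I2) (simp only: sec)
    show "AE \<omega> in M. measure (V \<omega>) (Pair \<omega> -` (space G \<times> B c)) = measure (V \<omega>) (B c)"
      by (rule AE_I2) (simp only: sec)
  qed auto
qed

lemma cond_poisson_borel_random_sets:
  fixes k :: nat
  assumes "\<And>\<omega> B. \<omega> \<in> space M \<Longrightarrow> B \<in> sets borel \<Longrightarrow> bounded B \<Longrightarrow> measure (Z \<omega>) B \<in> \<nat>"
    and cp: "cond_poisson_borel Z V"
    and "\<And>j. j < k \<Longrightarrow> S j \<in> sets (G \<Otimes>\<^sub>M borel)" "disjoint_family_on S {..<k}"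
    and "\<And>j \<omega>. j < k \<Longrightarrow> \<omega> \<in> space M \<Longrightarrow> bounded (Pair \<omega> -` S j)"
  shows "cond_poisson M G {..<k} (\<lambda>j \<omega>. measure (Z \<omega>) (Pair \<omega> -` S j)) (\<lambda>j \<omega>. measure (V \<omega>) (Pair \<omega> -` S j))"
proof (rule cond_poisson_random_bounded_sets)
  show "cond_poisson M G I (\<lambda>c \<omega>. measure (Z \<omega>) (idx n -` {c})) (\<lambda>c \<omega>. measure (V \<omega>) (idx n -` {c}))" if "finite I" for n I
    by (rule cond_poisson_borelD[OF cp that]) (auto simp: disjoint_family_on_def bounded_cell)
qed (use assms in auto)

end

text \<open>The functions \<open>y1\<close> and \<open>y2\<close> are the regular versions of the
  two subordinators. Regularity for every outcome keeps exceptional sets out of the arguments, and G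
  may be any sub-sigma-algebra for which both are measurable.\<close>

locale fprf_setting = cond_prob +
  fixes X :: "'a \<Rightarrow> (real \<times> real) measure" and y1 y2 :: "real \<Rightarrow> 'a \<Rightarrow> real" and lam :: real
  assumes X: "counting_process M X"
    and reg1: "\<And>\<omega>. reg_path (\<lambda>t. y1 t \<omega>)" and reg2: "\<And>\<omega>. reg_path (\<lambda>t. y2 t \<omega>)"
    and y1 [measurable]: "\<And>t. y1 t \<in> borel_measurable G" and y2 [measurable]: "\<And>t. y2 t \<in> borel_measurable G"
    and lam: "0 < lam"
begin

definition V :: "'a \<Rightarrow> (real \<times> real) measure" where
  "V \<omega> = scale_measure (ennreal lam) (stieltjes2 (\<lambda>t. y1 t \<omega>) (\<lambda>t. y2 t \<omega>))"

lemma V_lf: "lf_kernel G V"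
  unfolding V_def[abs_def] using reg1 reg2 y1 y2 lam by (intro stieltjes2_lf_kernel) auto

lemma measure_V: "measure (V \<omega>) B = lam * measure (stieltjes2 (\<lambda>t. y1 t \<omega>) (\<lambda>t. y2 t \<omega>)) B"
  unfolding V_def measure_def using lam by (simp add: enn2real_mult)

sublocale XV: cox_lf_kernels M G "ext X" V
  by unfold_locales (use counting_lf_kernel[OF X] V_lf in auto)

lemma cprob_count_ind:
  fixes n :: nat
  assumes E: "E = {\<omega> \<in> space M. \<forall>i<n. K i \<omega> = real (x i)}" and K: "\<And>i. i < n \<Longrightarrow> K i \<in> borel_measurable M"
    and A: "subalgebra M A"
  shows "AE \<omega> in M. cprob M A E \<omega> = real_cond_exp M A (count_ind {..<n} K x) \<omega>"
proof -
  interpret A: finite_measure_subalgebra M A by unfold_locales (rule A)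
  have m [measurable]: "count_ind {..<n} K x \<in> borel_measurable M"
    using K by (intro count_ind_measurable) auto
  have "E = {\<omega> \<in> space M. count_ind {..<n} K x \<omega> = 1}"
    by (auto simp: E count_ind_eq_indicator)
  then have [measurable]: "E \<in> sets M" by simp
  show ?thesis
    unfolding cprob_def
  proof (rule A.real_cond_exp_cong)
    show "AE \<omega> in M. indicator E \<omega> = count_ind {..<n} K x \<omega>"
      by (rule AE_I2) (auto simp: count_ind_eq_indicator E indicator_def)
  qed simp_all
qed

text \<open>Translates to the product formula of the theorem: conditional probabilities replace
  integrals over events of G, and the path measure replaces \<open>V\<close> up to a null
  set.\<close>

lemma cond_poisson_borel_iff:
  assumes V\<mu>: "AE \<omega> in M. \<forall>B. B \<in> sets borel \<longrightarrow> B \<subseteq> quadrant \<longrightarrow> lam * measure (\<mu> \<omega>) B = measure (V \<omega>) B"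
  shows "cond_poisson_borel (ext X) V \<longleftrightarrow>
    (\<forall>n (B :: nat \<Rightarrow> (real \<times> real) set) (x :: nat \<Rightarrow> nat).
      (\<forall>i<n. B i \<in> bounded_borel_sets) \<and> disjoint_family_on B {..<n} \<longrightarrow>
      (AE \<omega> in M. cprob M G {\<omega>' \<in> space M. \<forall>i<n. measure (X \<omega>') (B i) = real (x i)} \<omega> =
        (\<Prod>i<n. exp (- lam * measure (\<mu> \<omega>) (B i)) * (lam * measure (\<mu> \<omega>) (B i)) ^ x i / fact (x i))))"
    (is "_ \<longleftrightarrow> ?C")
proof -
  have eq: "cond_poisson M G {..<n} (\<lambda>j \<omega>. measure (ext X \<omega>) (B j)) (\<lambda>j \<omega>. measure (V \<omega>) (B j)) \<longleftrightarrow>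
      (\<forall>x. AE \<omega> in M. cprob M G {\<omega>' \<in> space M. \<forall>i<n. measure (X \<omega>') (B i) = real (x i)} \<omega> =
        (\<Prod>i<n. exp (- lam * measure (\<mu> \<omega>) (B i)) * (lam * measure (\<mu> \<omega>) (B i)) ^ x i / fact (x i)))"
    if B: "\<And>i. i < n \<Longrightarrow> B i \<in> bounded_borel_sets" for n and B :: "nat \<Rightarrow> (real \<times> real) set"
  proof -
    have Bb: "B i \<in> sets borel" "bounded (B i)" "B i \<inter> quadrant = B i" "B i \<subseteq> quadrant" if "i < n" for i
      using B[OF that] by (auto simp: bounded_borel_sets_def)
    have XB: "measure (ext X \<omega>) (B i) = measure (X \<omega>) (B i)" if "i < n" "\<omega> \<in> space M" for i \<omega>
      using measure_ext[where X = X, OF counting_processD(1)[OF X that(2)]] Bb[OF that(1)] by simp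
    have m: "(\<lambda>\<omega>. measure (ext X \<omega>) (B i)) \<in> borel_measurable M" "(\<lambda>\<omega>. measure (V \<omega>) (B i)) \<in> borel_measurable G" if "i < n" for i
      using Bb[OF that] by (intro lf_kernel_measurable XV.Z V_lf; simp)+
    have "cond_poisson M G {..<n} (\<lambda>j \<omega>. measure (ext X \<omega>) (B j)) (\<lambda>j \<omega>. measure (V \<omega>) (B j)) \<longleftrightarrow>
      (\<forall>x. AE \<omega> in M. real_cond_exp M G (count_ind {..<n} (\<lambda>j \<omega>. measure (ext X \<omega>) (B j)) x) \<omega>
        = poisson_prod {..<n} (\<lambda>j \<omega>. measure (V \<omega>) (B j)) x \<omega>)"
      using m by (intro cond_poisson_iff_cond_exp) auto
    also have "\<dots> \<longleftrightarrow> (\<forall>x. AE \<omega> in M. cprob M G {\<omega>' \<in> space M. \<forall>i<n. measure (X \<omega>') (B i) = real (x i)} \<omega> =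
        (\<Prod>i<n. exp (- lam * measure (\<mu> \<omega>) (B i)) * (lam * measure (\<mu> \<omega>) (B i)) ^ x i / fact (x i)))"
    proof (rule iff_allI)
      fix x
      have E: "{\<omega>' \<in> space M. \<forall>i<n. measure (X \<omega>') (B i) = real (x i)} = {\<omega>' \<in> space M. \<forall>i<n. measure (ext X \<omega>') (B i) = real (x i)}"
        using XB by auto
      have 1: "AE \<omega> in M. cprob M G {\<omega>' \<in> space M. \<forall>i<n. measure (X \<omega>') (B i) = real (x i)} \<omega>
          = real_cond_exp M G (count_ind {..<n} (\<lambda>j \<omega>. measure (ext X \<omega>) (B j)) x) \<omega>"
        using m by (intro cprob_count_ind[OF E _ subalgG])
      have 2: "AE \<omega> in M. (\<Prod>i<n. exp (- lam * measure (\<mu> \<omega>) (B i)) * (lam * measure (\<mu> \<omega>) (B i)) ^ x i / fact (x i))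
          = poisson_prod {..<n} (\<lambda>j \<omega>. measure (V \<omega>) (B j)) x \<omega>"
        using V\<mu>
      proof eventually_elim
        case (elim \<omega>)
        then show ?case using Bb by (auto simp: poisson_prod_def poisson_weight_def intro!: prod.cong)
      qed
      show "(AE \<omega> in M. real_cond_exp M G (count_ind {..<n} (\<lambda>j \<omega>. measure (ext X \<omega>) (B j)) x) \<omega>
        = poisson_prod {..<n} (\<lambda>j \<omega>. measure (V \<omega>) (B j)) x \<omega>) \<longleftrightarrow>
        (AE \<omega> in M. cprob M G {\<omega>' \<in> space M. \<forall>i<n. measure (X \<omega>') (B i) = real (x i)} \<omega> =
        (\<Prod>i<n. exp (- lam * measure (\<mu> \<omega>) (B i)) * (lam * measure (\<mu> \<omega>) (B i)) ^ x i / fact (x i)))"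
        (is "?l \<longleftrightarrow> ?r")
      proof
        assume ?l
        with 1 2 show ?r by eventually_elim simp
      next
        assume ?r
        with 1 2 show ?l by eventually_elim simp
      qed
    qed
    finally show ?thesis .
  qed
  show ?thesis
  proof
    assume cp: "cond_poisson_borel (ext X) V"
    show ?C
    proof (intro allI impI, elim conjE)
      fix n B x assume B: "\<forall>i<n. B i \<in> bounded_borel_sets" "disjoint_family_on B {..<n::nat}"
      have "cond_poisson M G {..<n} (\<lambda>j \<omega>. measure (ext X \<omega>) (B j)) (\<lambda>j \<omega>. measure (V \<omega>) (B j))"
        by (rule cond_poisson_borelD[OF cp]) (use B in \<open>auto simp: bounded_borel_sets_def\<close>)
      then show "AE \<omega> in M. cprob M G {\<omega>' \<in> space M. \<forall>i<n. measure (X \<omega>') (B i) = real (x i)} \<omega> =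
        (\<Prod>i<n. exp (- lam * measure (\<mu> \<omega>) (B i)) * (lam * measure (\<mu> \<omega>) (B i)) ^ x i / fact (x i))"
        using eq[of n B] B by blast
    qed
  next
    assume C: ?C
    show "cond_poisson_borel (ext X) V"
      unfolding cond_poisson_borel_def
    proof (intro allI impI)
      fix k :: nat and B :: "nat \<Rightarrow> (real \<times> real) set"
      assume B: "\<forall>j<k. B j \<in> sets borel \<and> bounded (B j)" "disjoint_family_on B {..<k}"
      have B': "B j \<inter> quadrant \<in> bounded_borel_sets" if "j < k" for j
        using B that by (intro bounded_borel_Int_quadrant) auto
      have dis: "disjoint_family_on (\<lambda>j. B j \<inter> quadrant) {..<k}"
        using B(2) by (auto simp: disjoint_family_on_def)
      \<comment> \<open>The product formula speaks only of sets inside the quadrant; intersecting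
        with the quadrant changes neither the counts nor the means.\<close>
      have "cond_poisson M G {..<k} (\<lambda>j \<omega>. measure (ext X \<omega>) (B j \<inter> quadrant)) (\<lambda>j \<omega>. measure (V \<omega>) (B j \<inter> quadrant))"
        by (rule eq[THEN iffD2], erule B') (intro allI C[rule_format] conjI impI B' dis)
      then show "cond_poisson M G {..<k} (\<lambda>j \<omega>. measure (ext X \<omega>) (B j)) (\<lambda>j \<omega>. measure (V \<omega>) (B j))"
      proof (rule cond_poisson_cong_AE[rotated])
        fix c assume "c \<in> {..<k}"
        then have c: "B c \<in> sets borel" "bounded (B c)" "B c \<inter> quadrant \<in> sets borel" "bounded (B c \<inter> quadrant)"
          using B by (auto intro: bounded_subset)
        show "(\<lambda>\<omega>. measure (ext X \<omega>) (B c)) \<in> borel_measurable M" "(\<lambda>\<omega>. measure (V \<omega>) (B c)) \<in> borel_measurable M"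
          "(\<lambda>\<omega>. measure (ext X \<omega>) (B c \<inter> quadrant)) \<in> borel_measurable M" "(\<lambda>\<omega>. measure (V \<omega>) (B c \<inter> quadrant)) \<in> borel_measurable M"
          using c by (intro lf_kernel_measurable XV.Z XV.V; simp)+
        show "AE \<omega> in M. measure (V \<omega>) (B c \<inter> quadrant) = measure (V \<omega>) (B c)"
          using c by (intro AE_I2) (simp add: measure_V stieltjes2_quadrant[OF reg1 reg2])
        show "AE \<omega> in M. measure (ext X \<omega>) (B c \<inter> quadrant) = measure (ext X \<omega>) (B c)"
          using c by (intro AE_I2) (simp add: measure_ext[where X = X] counting_processD(1)[OF X])
      qed auto
    qed
  qed
qed

end

subsection \<open>Events determined by a counting process\<close>

text \<open>Closure under disjoint sequences is carried over to countable index sets by enumerating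
  them and padding with empty sets.\<close>

lemma countable_disjoint_UN:
  fixes \<Phi> :: "'a set \<Rightarrow> bool"
  assumes UN: "\<And>E. range E \<subseteq> \<A> \<Longrightarrow> disjoint_family E \<Longrightarrow> (\<And>i::nat. \<Phi> (E i)) \<Longrightarrow> \<Phi> (\<Union>i. E i)"
    and empty: "\<Phi> {}" "{} \<in> \<A>"
    and I: "countable I" "\<And>x. x \<in> I \<Longrightarrow> \<Phi> (f x)" "\<And>x. x \<in> I \<Longrightarrow> f x \<in> \<A>" "disjoint_family_on f I"
  shows "\<Phi> (\<Union>x\<in>I. f x)"
proof -
  define E where "E n = (if n \<in> to_nat_on I ` I then f (from_nat_into I n) else {})" for n
  have E: "E (to_nat_on I x) = f x" if "x \<in> I" for x
    using that I(1) by (simp add: E_def)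
  have eq: "(\<exists>x\<in>I. n = to_nat_on I x \<and> E n = f x) \<or> E n = {}" for n
    using E by (auto simp: E_def)
  have "\<Phi> (\<Union>n. E n)"
  proof (rule UN)
    have "E n \<in> \<A>" for n using eq[of n] I(3) empty(2) by (elim disjE bexE conjE) simp_all
    then show "range E \<subseteq> \<A>" by blast
    show "\<Phi> (E n)" for n using eq[of n] I(2) empty(1) by (elim disjE bexE conjE) simp_all
    show "disjoint_family E"
      unfolding disjoint_family_on_def
    proof (intro ballI impI)
      fix m n :: nat assume "m \<noteq> n"
      show "E m \<inter> E n = {}"
      proof (cases "E m = {} \<or> E n = {}")
        case False
        then obtain x y where xy: "x \<in> I" "m = to_nat_on I x" "E m = f x" "y \<in> I" "n = to_nat_on I y" "E n = f y"
          using eq[of m] eq[of n] by blast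
        then have "x \<noteq> y" using \<open>m \<noteq> n\<close> by blast
        then show ?thesis using xy I(4) by (simp add: disjoint_family_on_def)
      qed auto
    qed
  qed
  also have "(\<Union>n. E n) = (\<Union>x\<in>I. f x)"
  proof (intro set_eqI iffI)
    fix w assume "w \<in> (\<Union>n. E n)"
    then obtain n where "w \<in> E n" by blast
    then show "w \<in> (\<Union>x\<in>I. f x)" using eq[of n] by auto
  next
    fix w assume "w \<in> (\<Union>x\<in>I. f x)"
    then obtain x where "x \<in> I" "w \<in> f x" by blast
    then show "w \<in> (\<Union>n. E n)" using E[of x] by (intro UN_I[of "to_nat_on I x"]) auto
  qed
  finally show ?thesis .
qed

text \<open>Overlapping sets are reduced to disjoint ones by passing to the atoms of the algebra they
  generate.\<close>

lemma (in prob_space) counting_sigma_induct: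
  fixes R :: "'p \<Rightarrow> (real \<times> real) set" and \<Phi> :: "'a set \<Rightarrow> bool"
  assumes X: "counting_process M X"
    and G0: "Int_stable G0" "G0 \<subseteq> events" "space M \<in> G0"
    and R: "\<And>p. p \<in> Q \<Longrightarrow> R p \<in> sets borel" "\<And>p. p \<in> Q \<Longrightarrow> bounded (R p)" "\<And>p. p \<in> Q \<Longrightarrow> R p \<inter> W = {}"
    and base: "\<And>A n B (x :: nat \<Rightarrow> nat). A \<in> G0 \<Longrightarrow> (\<And>i. i < n \<Longrightarrow> B i \<in> sets borel) \<Longrightarrow> (\<And>i. i < n \<Longrightarrow> bounded (B i)) \<Longrightarrow>
        (\<And>i. i < n \<Longrightarrow> B i \<inter> W = {}) \<Longrightarrow> disjoint_family_on B {..<n::nat} \<Longrightarrow>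
        \<Phi> (A \<inter> {\<omega> \<in> space M. \<forall>i<n. measure (ext X \<omega>) (B i) = real (x i)})"
    and compl: "\<And>E. E \<in> events \<Longrightarrow> \<Phi> E \<Longrightarrow> \<Phi> (space M - E)"
    and UN: "\<And>E. range E \<subseteq> events \<Longrightarrow> disjoint_family E \<Longrightarrow> (\<And>i::nat. \<Phi> (E i)) \<Longrightarrow> \<Phi> (\<Union>i. E i)"
    and empty: "\<Phi> {}"
    and E: "E \<in> sigma_sets (space M) (G0 \<union> {(\<lambda>\<omega>. measure (ext X \<omega>) (R p)) -` C \<inter> space M | p C. p \<in> Q \<and> C \<in> sets borel})"
  shows "\<Phi> E"
proof -
  let ?ev = "\<lambda>J C. {\<omega> \<in> space M. \<forall>p\<in>J. measure (ext X \<omega>) (R p) \<in> C p}"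
  \<comment> \<open>A generator stable under intersection: finitely many counts are constrained,
    each to a Borel set, on an event of \<open>G0\<close>.\<close>
  define P where "P = {A \<inter> ?ev J C | A J C. A \<in> G0 \<and> finite J \<and> J \<subseteq> Q \<and> (\<forall>p. C p \<in> sets (borel :: real measure))}"
  have meas: "(\<lambda>\<omega>. measure (ext X \<omega>) B) \<in> borel_measurable M" if "B \<in> sets borel" "bounded B" for B
    using that by (intro lf_kernel_measurable counting_lf_kernel[OF X])
  have evm: "?ev J C \<in> events" if "finite J" "J \<subseteq> Q" "\<And>p. C p \<in> sets (borel :: real measure)" for J C
  proof (intro sets.sets_Collect_finite_All that(1))
    fix p assume "p \<in> J"
    then show "{\<omega> \<in> space M. measure (ext X \<omega>) (R p) \<in> C p} \<in> events"
      using measurable_sets[OF meas[OF R(1,2)] that(3)[of p], of p] that(2)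
      by (auto simp: vimage_def Int_def conj_commute)
  qed
  have PI: "A \<inter> ?ev J C \<in> P" if "A \<in> G0" "finite J" "J \<subseteq> Q" "\<And>p. C p \<in> sets (borel :: real measure)" for A J C
    unfolding P_def mem_Collect_eq
    by (rule exI[of _ A], rule exI[of _ J], rule exI[of _ C]) (use that in \<open>intro conjI allI refl\<close>)
  have PE: "P \<subseteq> events"
    unfolding P_def using G0(2) evm by (auto intro!: sets.Int)
  have Pst: "Int_stable P"
  proof (rule Int_stableI)
    fix a b assume "a \<in> P" "b \<in> P"
    then obtain A J C A' J' C' where a: "a = A \<inter> ?ev J C" "A \<in> G0" "finite J" "J \<subseteq> Q" "\<And>p. C p \<in> sets (borel :: real measure)"
      and b: "b = A' \<inter> ?ev J' C'" "A' \<in> G0" "finite J'" "J' \<subseteq> Q" "\<And>p. C' p \<in> sets (borel :: real measure)"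
      unfolding P_def by blast
    let ?C = "\<lambda>p. (if p \<in> J then C p else UNIV) \<inter> (if p \<in> J' then C' p else UNIV)"
    have "a \<inter> b = (A \<inter> A') \<inter> ?ev (J \<union> J') ?C"
      unfolding a b by auto
    moreover have "A \<inter> A' \<in> G0" using G0(1) a(2) b(2) by (rule Int_stableD)
    moreover have "?C p \<in> sets borel" for p using a(5)[of p] b(5)[of p] by (intro sets.Int) auto
    moreover have "finite (J \<union> J')" "J \<union> J' \<subseteq> Q" using a(3,4) b(3,4) by auto
    ultimately show "a \<inter> b \<in> P" using PI[of "A \<inter> A'" "J \<union> J'" ?C] by (simp only:)
  qed
  have \<Phi>P: "\<Phi> a" if "a \<in> P" for a
  proof -
    obtain A J C where a0: "a = A \<inter> ?ev J C \<and> A \<in> G0 \<and> finite J \<and> J \<subseteq> Q \<and> (\<forall>p. C p \<in> sets (borel :: real measure))"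
      using \<open>a \<in> P\<close> unfolding P_def mem_Collect_eq by (elim exE)
    then have a: "a = A \<inter> ?ev J C" "A \<in> G0" "finite J" "J \<subseteq> Q" by simp_all
    have fin: "finite (Pow J - {{}})" using a(3) by simp
    define n where "n = card (Pow J - {{}})"
    obtain h where h: "bij_betw h {..<n} (Pow J - {{}})"
      using ex_bij_betw_nat_finite[OF fin] by (auto simp: n_def atLeast0LessThan)
    \<comment> \<open>The atom of the points lying in exactly those \<open>R p\<close> with
      \<open>p\<close> in \<open>h i\<close>. The empty subset of \<open>J\<close> is left out,
      since its atom is the unbounded exterior; every other atom lies in some \<open>R p\<close>,
      hence is bounded and misses \<open>W\<close>.\<close>
    define B where "B i = {t. \<forall>p\<in>J. t \<in> R p \<longleftrightarrow> p \<in> h i}" for i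
    have hi: "h i \<subseteq> J" "h i \<noteq> {}" if "i < n" for i using h that by (auto simp: bij_betw_def)
    have Bsub: "B i \<subseteq> R p" if "p \<in> h i" "i < n" for i p
      using that hi[OF that(2)] by (auto simp: B_def)
    have Bm: "B i \<in> sets borel" for i
    proof -
      have "{t \<in> space borel. \<forall>p\<in>J. t \<in> R p \<longleftrightarrow> p \<in> h i} \<in> sets borel"
      proof (intro sets.sets_Collect_finite_All a(3))
        fix p assume "p \<in> J"
        then have "R p \<in> sets borel" using R(1) a(4) by blast
        then show "{t \<in> space borel. t \<in> R p \<longleftrightarrow> p \<in> h i} \<in> sets borel"
          by (cases "p \<in> h i") (auto simp: Compl_eq[symmetric])
      qed
      then show ?thesis by (simp add: B_def)
    qed
    have Bb: "bounded (B i)" "B i \<inter> W = {}" if "i < n" for i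
    proof -
      obtain p where p: "p \<in> h i" "p \<in> Q" using hi[OF \<open>i < n\<close>] a(4) by blast
      show "bounded (B i)" using R(2)[OF p(2)] Bsub[OF p(1) that] by (rule bounded_subset)
      show "B i \<inter> W = {}" using R(3)[OF p(2)] Bsub[OF p(1) that] by blast
    qed
    have Bdis: "disjoint_family_on B {..<n}"
      unfolding disjoint_family_on_def
    proof (intro ballI impI)
      fix i j assume ij: "i \<in> {..<n}" "j \<in> {..<n}" "i \<noteq> j"
      then have "h i \<noteq> h j" using h by (auto simp: bij_betw_def inj_on_def)
      moreover have "h i \<subseteq> J" "h j \<subseteq> J" using hi ij by auto
      ultimately obtain p where "p \<in> J" "(p \<in> h i) \<noteq> (p \<in> h j)" by blast
      then show "B i \<inter> B j = {}" by (auto simp: B_def)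
    qed
    have Rsum: "measure (ext X \<omega>) (R p) = (\<Sum>i\<in>{i\<in>{..<n}. p \<in> h i}. measure (ext X \<omega>) (B i))"
      if "\<omega> \<in> space M" "p \<in> J" for \<omega> p
    proof -
      have "R p = (\<Union>i\<in>{i\<in>{..<n}. p \<in> h i}. B i)"
      proof (intro set_eqI iffI)
        fix t assume "t \<in> R p"
        then have "{q\<in>J. t \<in> R q} \<in> Pow J - {{}}" using that by auto
        then have "{q\<in>J. t \<in> R q} \<in> h ` {..<n}" using h by (simp add: bij_betw_def)
        then obtain i where i: "i < n" "{q\<in>J. t \<in> R q} = h i" by auto
        have "t \<in> B i" using i(2) by (auto simp: B_def)
        moreover have "p \<in> h i" using i(2) \<open>t \<in> R p\<close> that(2) by auto
        ultimately show "t \<in> (\<Union>i\<in>{i\<in>{..<n}. p \<in> h i}. B i)" using i(1) by auto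
      next
        fix t assume "t \<in> (\<Union>i\<in>{i\<in>{..<n}. p \<in> h i}. B i)"
        then show "t \<in> R p" using Bsub by auto
      qed
      also have "measure (ext X \<omega>) \<dots> = (\<Sum>i\<in>{i\<in>{..<n}. p \<in> h i}. measure (ext X \<omega>) (B i))"
      proof (rule measure_finite_Union)
        show "disjoint_family_on B {i\<in>{..<n}. p \<in> h i}"
          by (rule disjoint_family_on_mono[OF _ Bdis]) auto
        show "emeasure (ext X \<omega>) (B i) \<noteq> \<infinity>" if "i \<in> {i\<in>{..<n}. p \<in> h i}" for i
          using counting_ext_finite[OF X \<open>\<omega> \<in> space M\<close> Bm Bb(1), of i] that by auto
      qed (use Bm in auto)
      finally show ?thesis .
    qed
    \<comment> \<open>The event is split according to the counts in the atoms. Extensional vectors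
      are countably many, and two different ones differ at some index below \<open>n\<close>, which
      makes the pieces disjoint.\<close>
    define XX where "XX = {x \<in> {..<n} \<rightarrow>\<^sub>E (UNIV :: nat set). \<forall>p\<in>J. real (\<Sum>i\<in>{i\<in>{..<n}. p \<in> h i}. x i) \<in> C p}"
    let ?f = "\<lambda>x. A \<inter> {\<omega> \<in> space M. \<forall>i<n. measure (ext X \<omega>) (B i) = real (x i)}"
    have "a = (\<Union>x\<in>XX. ?f x)"
    proof (intro set_eqI iffI)
      fix \<omega> assume w: "\<omega> \<in> a"
      then have wM: "\<omega> \<in> space M" "\<omega> \<in> A" by (auto simp: a(1))
      define x where "x = (\<lambda>i\<in>{..<n}. nat \<lfloor>measure (ext X \<omega>) (B i)\<rfloor>)"
      have x: "measure (ext X \<omega>) (B i) = real (x i)" if "i < n" for i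
        using counting_ext_Nats[OF X wM(1) Bm Bb(1)[OF that]] that by (auto simp: x_def elim!: Nats_cases)
      have "real (\<Sum>i\<in>{i\<in>{..<n}. p \<in> h i}. x i) \<in> C p" if "p \<in> J" for p
      proof -
        have "real (\<Sum>i\<in>{i\<in>{..<n}. p \<in> h i}. x i) = measure (ext X \<omega>) (R p)"
          unfolding Rsum[OF wM(1) that] of_nat_sum using x by (intro sum.cong) auto
        then show ?thesis using w that by (auto simp: a(1))
      qed
      then have "x \<in> XX" by (auto simp: XX_def x_def)
      then show "\<omega> \<in> (\<Union>x\<in>XX. ?f x)" using x wM by auto
    next
      fix \<omega> assume "\<omega> \<in> (\<Union>x\<in>XX. ?f x)"
      then obtain x where x: "x \<in> XX" "\<omega> \<in> A" "\<omega> \<in> space M" "\<And>i. i < n \<Longrightarrow> measure (ext X \<omega>) (B i) = real (x i)" by auto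
      have "measure (ext X \<omega>) (R p) \<in> C p" if "p \<in> J" for p
      proof -
        have "measure (ext X \<omega>) (R p) = real (\<Sum>i\<in>{i\<in>{..<n}. p \<in> h i}. x i)"
          unfolding Rsum[OF x(3) that] of_nat_sum using x(4) by (intro sum.cong) auto
        then show ?thesis using x(1) that by (auto simp: XX_def)
      qed
      then show "\<omega> \<in> a" using x by (auto simp: a(1))
    qed
    moreover have "\<Phi> (\<Union>x\<in>XX. ?f x)"
    proof (rule countable_disjoint_UN[where \<A> = events])
      have "countable ({..<n} \<rightarrow>\<^sub>E (UNIV :: nat set))" by (intro countable_PiE) auto
      then show "countable XX" unfolding XX_def by (rule countable_subset[rotated]) auto
      show "\<Phi> (?f x)" for x using a(2) Bm Bb Bdis by (intro base) auto
      show "?f x \<in> events" for x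
      proof (intro sets.Int)
        show "A \<in> events" using G0(2) a(2) by blast
        have "{\<omega> \<in> space M. \<forall>i\<in>{..<n}. measure (ext X \<omega>) (B i) = real (x i)} \<in> events"
          by (intro sets.sets_Collect_finite_All borel_measurable_eq meas Bm Bb) auto
        then show "{\<omega> \<in> space M. \<forall>i<n. measure (ext X \<omega>) (B i) = real (x i)} \<in> events"
          by (simp only: Ball_def lessThan_iff)
      qed
      show "disjoint_family_on ?f XX"
        unfolding disjoint_family_on_def
      proof (intro ballI impI)
        fix x y assume xy: "x \<in> XX" "y \<in> XX" "x \<noteq> y"
        obtain i where i: "x i \<noteq> y i" using xy(3) by (auto simp: fun_eq_iff)
        have "x \<in> {..<n} \<rightarrow>\<^sub>E UNIV" "y \<in> {..<n} \<rightarrow>\<^sub>E UNIV" using xy by (auto simp: XX_def)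
        then have "i < n" using i PiE_arb[of x "{..<n}" _ i] PiE_arb[of y "{..<n}" _ i] by (cases "i < n") auto
        then show "?f x \<inter> ?f y = {}" using i by auto
      qed
    qed (use UN empty in auto)
    ultimately show ?thesis by simp
  qed
  have gen: "sigma_sets (space M) (G0 \<union> {(\<lambda>\<omega>. measure (ext X \<omega>) (R p)) -` C \<inter> space M | p C. p \<in> Q \<and> C \<in> sets borel}) \<subseteq> sigma_sets (space M) P"
  proof (rule sigma_sets_mono', safe)
    fix A assume A: "A \<in> G0"
    then have "A = A \<inter> space M" using G0(2) sets.sets_into_space by blast
    then show "A \<in> P" using PI[OF A, of "{}" "\<lambda>_. UNIV"] by simp
  next
    fix p and C :: "real set" assume "p \<in> Q" "C \<in> sets borel"
    moreover have "(\<lambda>\<omega>. measure (ext X \<omega>) (R p)) -` C \<inter> space M = space M \<inter> ?ev {p} (\<lambda>_. C)" by auto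
    ultimately show "(\<lambda>\<omega>. measure (ext X \<omega>) (R p)) -` C \<inter> space M \<in> P"
      using PI[OF G0(3), of "{p}" "\<lambda>_. C"] by simp
  qed
  have sub: "sigma_sets (space M) P \<subseteq> events" using PE by (rule sets.sigma_sets_subset)
  have PP: "P \<subseteq> Pow (space M)" using PE sets.sets_into_space by blast
  have mem: "E \<in> sigma_sets (space M) P" using E gen by blast
  from Pst PP mem show ?thesis
  proof (induction rule: sigma_sets_induct_disjoint)
    case (basic A)
    then show ?case by (rule \<Phi>P)
  next
    case empty
    show ?case by (rule \<open>\<Phi> {}\<close>)
  next
    case (compl A)
    then show ?case using sub assms(9) by blast
  next
    case (union A)
    then show ?case using sub assms(10)[of A] by blast
  qed
qed

text \<open>For integer counts independence reduces to point probabilities, since singletons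
  generate the discrete sigma-algebra.\<close>

lemma (in prob_space) indep_vars_discrete:
  fixes K :: "'i \<Rightarrow> 'a \<Rightarrow> real"
  assumes I: "finite I"
    and m [measurable]: "\<And>i. i \<in> I \<Longrightarrow> K i \<in> borel_measurable M"
    and N: "\<And>i \<omega>. i \<in> I \<Longrightarrow> \<omega> \<in> space M \<Longrightarrow> K i \<omega> \<in> \<nat>"
    and prod: "\<And>J (x :: 'i \<Rightarrow> nat). J \<subseteq> I \<Longrightarrow> prob {\<omega> \<in> space M. \<forall>i\<in>J. K i \<omega> = real (x i)}
        = (\<Prod>i\<in>J. prob {\<omega> \<in> space M. K i \<omega> = real (x i)})"
  shows "indep_vars (\<lambda>_. borel) K I"
proof (cases "I = {}")
  case True
  then show ?thesis by (simp add: indep_vars_def indep_sets_def)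
next
  case False
  define K' where "K' i \<omega> = nat \<lfloor>K i \<omega>\<rfloor>" for i \<omega>
  have K': "K i \<omega> = real (K' i \<omega>)" if "i \<in> I" "\<omega> \<in> space M" for i \<omega>
    using N[OF that] by (auto simp: K'_def elim!: Nats_cases)
  \<comment> \<open>The empty set makes the generator stable under intersection; the full set leaves
    a coordinate free, which is where proper subfamilies \<open>J\<close> come from.\<close>
  let ?E = "{{k} | k::nat. True} \<union> {{}, UNIV :: nat set}"
  have "indep_vars (\<lambda>_. count_space UNIV) K' I"
  proof (subst indep_vars_finite[where E = "\<lambda>_. ?E"])
    show "sets (count_space UNIV) = sigma_sets (space (count_space UNIV)) ?E"
    proof (rule antisym)
      interpret S: sigma_algebra UNIV "sigma_sets UNIV ?E" by (rule sigma_algebra_sigma_sets) simp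
      show "sets (count_space UNIV) \<subseteq> sigma_sets (space (count_space UNIV)) ?E"
      proof
        fix A :: "nat set"
        have "A = (\<Union>k\<in>A. {k})" by auto
        also have "\<dots> \<in> sigma_sets UNIV ?E" by (intro S.countable_UN' ) (auto intro!: sigma_sets.Basic)
        finally show "A \<in> sigma_sets (space (count_space UNIV)) ?E" by simp
      qed
    qed simp
    show "random_variable (count_space UNIV) (K' i)" if "i \<in> I" for i
      using m[OF that] unfolding K'_def by measurable
    show "Int_stable ?E" by (auto simp: Int_stable_def)
    show "\<forall>A\<in>I \<rightarrow> ?E. prob (\<Inter>j\<in>I. K' j -` A j \<inter> space M) = (\<Prod>j\<in>I. prob (K' j -` A j \<inter> space M))"
    proof
      fix A assume A: "A \<in> I \<rightarrow> ?E"
      show "prob (\<Inter>j\<in>I. K' j -` A j \<inter> space M) = (\<Prod>j\<in>I. prob (K' j -` A j \<inter> space M))"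
      proof (cases "\<exists>j\<in>I. A j = {}")
        case True
        then have "(\<Inter>j\<in>I. K' j -` A j \<inter> space M) = {}" by auto
        moreover have "(\<Prod>j\<in>I. prob (K' j -` A j \<inter> space M)) = 0"
        proof -
          obtain j where "j \<in> I" "A j = {}" using True by blast
          then show ?thesis by (intro prod_zero I bexI[of _ j]) simp_all
        qed
        ultimately show ?thesis by simp
      next
        case nonempty: False
        define J where "J = {j\<in>I. A j \<noteq> UNIV}"
        have "\<exists>k. A j = {k}" if "j \<in> J" for j using that A nonempty by (fastforce simp: J_def)
        then obtain x where x: "\<And>j. j \<in> J \<Longrightarrow> A j = {x j}" by metis
        have JI: "J \<subseteq> I" by (auto simp: J_def)
        have "(\<Inter>j\<in>I. K' j -` A j \<inter> space M) = {\<omega> \<in> space M. \<forall>i\<in>J. K i \<omega> = real (x i)}"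
        proof (intro set_eqI iffI)
          fix \<omega> assume "\<omega> \<in> (\<Inter>j\<in>I. K' j -` A j \<inter> space M)"
          then show "\<omega> \<in> {\<omega> \<in> space M. \<forall>i\<in>J. K i \<omega> = real (x i)}"
            using False JI x K' by (auto 0 3)
        next
          fix \<omega> assume w: "\<omega> \<in> {\<omega> \<in> space M. \<forall>i\<in>J. K i \<omega> = real (x i)}"
          have "\<omega> \<in> K' j -` A j \<inter> space M" if "j \<in> I" for j
          proof (cases "j \<in> J")
            case True
            then have "K' j \<omega> = x j" using w K'[OF that, of \<omega>] by auto
            then show ?thesis using w x[OF True] by simp
          next
            case False
            then show ?thesis using w that by (simp add: J_def)
          qed
          then show "\<omega> \<in> (\<Inter>j\<in>I. K' j -` A j \<inter> space M)" by blast
        qed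
        then have "prob (\<Inter>j\<in>I. K' j -` A j \<inter> space M) = (\<Prod>i\<in>J. prob {\<omega> \<in> space M. K i \<omega> = real (x i)})"
          using prod[OF JI] by simp
        also have "\<dots> = (\<Prod>j\<in>J. prob (K' j -` A j \<inter> space M))"
        proof (rule prod.cong[OF refl])
          fix j assume j: "j \<in> J"
          then have "{\<omega> \<in> space M. K j \<omega> = real (x j)} = K' j -` A j \<inter> space M"
            using K'[of j] JI x[OF j] by auto
          then show "prob {\<omega> \<in> space M. K j \<omega> = real (x j)} = prob (K' j -` A j \<inter> space M)" by simp
        qed
        also have "\<dots> = (\<Prod>j\<in>I. prob (K' j -` A j \<inter> space M))"
          using I JI by (intro prod.mono_neutral_left) (auto simp: J_def prob_space)
        finally show ?thesis .
      qed
    qed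
  qed (use False I in auto)
  then have "indep_vars (\<lambda>_. borel) (\<lambda>i \<omega>. real (K' i \<omega>)) I"
    by (rule indep_vars_compose2) auto
  then have ind: "indep_sets (\<lambda>i. {(\<lambda>\<omega>. real (K' i \<omega>)) -` A \<inter> space M | A. A \<in> sets borel}) I"
    by (simp add: indep_vars_def2)
  have eq: "(\<lambda>\<omega>. real (K' i \<omega>)) -` A \<inter> space M = K i -` A \<inter> space M" if "i \<in> I" for i A
    using K'[OF that] by auto
  have "indep_sets (\<lambda>i. {K i -` A \<inter> space M | A. A \<in> sets borel}) I"
    using ind by (rule indep_sets_cong[THEN iffD1, rotated 2]) (simp_all add: eq)
  then show ?thesis
    using m by (simp add: indep_vars_def2)
qed

subsection \<open>From conditional Poisson counts to a time-changed Poisson field\<close>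

text \<open>By monotonicity and dense range a value below \<open>c\<close> at time \<open>s\<close>
  persists up to some later rational time, so the sublevel set is a countable union of
  rectangles.\<close>

lemma reg_path_joint_measurable:
  assumes reg: "\<And>\<omega>. reg_path (\<lambda>t. y t \<omega>)" and y: "\<And>t. y t \<in> borel_measurable G"
  shows "(\<lambda>x. y (snd x) (fst x)) \<in> borel_measurable (G \<Otimes>\<^sub>M borel)"
proof (rule borel_measurable_iff_less[THEN iffD2], rule allI)
  fix c :: real
  have iff: "y s \<omega> < c \<longleftrightarrow> (\<exists>q\<in>\<rat>. s < q \<and> y q \<omega> < c)" for s \<omega>
  proof
    assume "y s \<omega> < c"
    obtain x where x: "y s \<omega> < y x \<omega>" "y x \<omega> < c" using reg_pathD(2)[OF reg \<open>y s \<omega> < c\<close>] by blast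
    then have "s < x" using reg_path_less[OF reg] by blast
    then obtain q where q: "q \<in> \<rat>" "s < q" "q < x" using Rats_dense_in_real by blast
    then have "y q \<omega> \<le> y x \<omega>" using reg_pathD(1)[OF reg] by (meson less_imp_le)
    then show "\<exists>q\<in>\<rat>. s < q \<and> y q \<omega> < c" using q x by auto
  next
    assume "\<exists>q\<in>\<rat>. s < q \<and> y q \<omega> < c"
    then obtain q where "s < q" "y q \<omega> < c" by blast
    then show "y s \<omega> < c" using reg_pathD(1)[OF reg, of s q \<omega>] by simp
  qed
  have "{x \<in> space (G \<Otimes>\<^sub>M borel). \<exists>q\<in>\<rat>. snd x < q \<and> y q (fst x) < c}
      = (\<Union>q\<in>\<rat>. {\<omega> \<in> space G. y q \<omega> < c} \<times> {..<q})"
    by (auto simp: space_pair_measure)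
  then have "{x \<in> space (G \<Otimes>\<^sub>M borel). y (snd x) (fst x) < c}
      = (\<Union>q\<in>\<rat>. {\<omega> \<in> space G. y q \<omega> < c} \<times> {..<q})"
    by (simp only: iff[symmetric])
  also have "\<dots> \<in> sets (G \<Otimes>\<^sub>M borel)"
    using y by (intro sets.countable_UN' countable_rat pair_measureI borel_measurable_less) auto
  finally show "{x \<in> space (G \<Otimes>\<^sub>M borel). y (snd x) (fst x) < c} \<in> sets (G \<Otimes>\<^sub>M borel)" .
qed

lemma (in prob_space) prob_eq_integral:
  "A \<in> events \<Longrightarrow> prob A = (\<integral>\<omega>. indicator A \<omega> \<partial>M)"
  by (simp add: Int_absorb2 sets.sets_into_space)

context fprf_setting
begin

definition \<phi> :: "'a \<Rightarrow> real \<times> real \<Rightarrow> real \<times> real" where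
  "\<phi> \<omega> = map_prod (\<lambda>t. y1 t \<omega>) (\<lambda>t. y2 t \<omega>)"

text \<open>The preimage of a fixed set under the random time change, in the form of a random set:
  its section at an outcome is the preimage under that outcome's map.\<close>

definition preim :: "(real \<times> real) set \<Rightarrow> ('a \<times> real \<times> real) set" where
  "preim B = {x \<in> space G \<times> UNIV. \<phi> (fst x) (snd x) \<in> B}"

lemma coordinate_measurable:
  "(\<lambda>x. y1 (fst (snd x)) (fst x)) \<in> borel_measurable (G \<Otimes>\<^sub>M (borel :: (real \<times> real) measure))"
  "(\<lambda>x. y2 (snd (snd x)) (fst x)) \<in> borel_measurable (G \<Otimes>\<^sub>M (borel :: (real \<times> real) measure))"
proof -
  have f: "(\<lambda>x. (fst x, fst (snd x))) \<in> G \<Otimes>\<^sub>M (borel :: (real \<times> real) measure) \<rightarrow>\<^sub>M G \<Otimes>\<^sub>M borel"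
    "(\<lambda>x. (fst x, snd (snd x))) \<in> G \<Otimes>\<^sub>M (borel :: (real \<times> real) measure) \<rightarrow>\<^sub>M G \<Otimes>\<^sub>M borel"
    unfolding borel_prod[symmetric] by measurable
  show "(\<lambda>x. y1 (fst (snd x)) (fst x)) \<in> borel_measurable (G \<Otimes>\<^sub>M (borel :: (real \<times> real) measure))"
    using measurable_compose[OF f(1) reg_path_joint_measurable[OF reg1 y1]] by simp
  show "(\<lambda>x. y2 (snd (snd x)) (fst x)) \<in> borel_measurable (G \<Otimes>\<^sub>M (borel :: (real \<times> real) measure))"
    using measurable_compose[OF f(2) reg_path_joint_measurable[OF reg2 y2]] by simp
qed

lemma preim_measurable: "B \<in> sets borel \<Longrightarrow> preim B \<in> sets (G \<Otimes>\<^sub>M borel)"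
proof -
  assume B: "B \<in> sets borel"
  have "(\<lambda>x. \<phi> (fst x) (snd x)) \<in> G \<Otimes>\<^sub>M (borel :: (real \<times> real) measure) \<rightarrow>\<^sub>M borel \<Otimes>\<^sub>M borel"
    unfolding \<phi>_def map_prod_def case_prod_beta by (intro measurable_Pair coordinate_measurable)
  then have "(\<lambda>x. \<phi> (fst x) (snd x)) \<in> G \<Otimes>\<^sub>M (borel :: (real \<times> real) measure) \<rightarrow>\<^sub>M borel"
    by (simp only: borel_prod)
  from measurable_sets[OF this B] show ?thesis
    by (simp add: preim_def vimage_def Int_def space_pair_measure conj_commute)
qed

lemma preim_section: "\<omega> \<in> space M \<Longrightarrow> Pair \<omega> -` preim B = \<phi> \<omega> -` B"
  by (auto simp: preim_def G_space)

lemma \<phi>_measurable [measurable]: "\<phi> \<omega> \<in> borel \<rightarrow>\<^sub>M borel"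
  unfolding \<phi>_def borel_prod[symmetric] map_prod_def case_prod_beta
  using reg_path_borel[OF reg1] reg_path_borel[OF reg2] by measurable

lemma \<phi>_vimage_borel: "B \<in> sets borel \<Longrightarrow> \<phi> \<omega> -` B \<in> sets borel"
  using measurable_sets[OF \<phi>_measurable, of B \<omega>] by simp

text \<open>Each level has a finite last time, so a path spends only a bounded time between two
  levels.\<close>

lemma \<phi>_vimage_bounded: "bounded B \<Longrightarrow> bounded (\<phi> \<omega> -` B)"
proof -
  assume "bounded B"
  then obtain K where K: "B \<subseteq> window K" using bounded_subset_window by blast
  obtain a1 where a1: "\<And>s. y1 s \<omega> \<le> - real K \<longleftrightarrow> s \<le> a1" using reg_path_inverse[OF reg1] by metis
  obtain b1 where b1: "\<And>s. y1 s \<omega> \<le> real K \<longleftrightarrow> s \<le> b1" using reg_path_inverse[OF reg1] by metis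
  obtain a2 where a2: "\<And>s. y2 s \<omega> \<le> - real K \<longleftrightarrow> s \<le> a2" using reg_path_inverse[OF reg2] by metis
  obtain b2 where b2: "\<And>s. y2 s \<omega> \<le> real K \<longleftrightarrow> s \<le> b2" using reg_path_inverse[OF reg2] by metis
  have "\<phi> \<omega> -` B \<subseteq> box2 a1 b1 a2 b2"
  proof
    fix p assume "p \<in> \<phi> \<omega> -` B"
    then have "\<phi> \<omega> p \<in> window K" using K by blast
    then show "p \<in> box2 a1 b1 a2 b2"
      using a1[of "fst p"] b1[of "fst p"] a2[of "snd p"] b2[of "snd p"]
      by (cases p) (auto simp: \<phi>_def box2_def not_le)
  qed
  then show ?thesis by (rule bounded_subset[OF bounded_box2])
qed

lemma measure_V_\<phi>:
  assumes B: "B \<in> sets borel" "B \<subseteq> quadrant"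
  shows "measure (V \<omega>) (\<phi> \<omega> -` B) = lam * measure lborel B"
proof -
  let ?s = "stieltjes2 (\<lambda>t. y1 t \<omega>) (\<lambda>t. y2 t \<omega>)"
  have m: "\<phi> \<omega> \<in> ?s \<rightarrow>\<^sub>M borel" using \<phi>_measurable by (simp cong: measurable_cong_sets)
  have "emeasure ?s (\<phi> \<omega> -` B) = emeasure (distr ?s borel (\<phi> \<omega>)) B"
    using B(1) by (subst emeasure_distr[OF m]) simp_all
  also have "\<dots> = emeasure (density lborel (indicator quadrant)) B"
    unfolding \<phi>_def by (simp add: distr_stieltjes2 reg1 reg2)
  also have "\<dots> = emeasure lborel B"
    using B by (subst emeasure_density) (auto simp: Int_absorb1 simp flip: indicator_inter_arith)
  finally have "measure ?s (\<phi> \<omega> -` B) = measure lborel B" by (simp add: measure_def)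
  then show ?thesis by (simp add: measure_V)
qed

definition N :: "'a \<Rightarrow> (real \<times> real) measure" where
  "N \<omega> = restrict_space (distr (ext X \<omega>) borel (\<phi> \<omega>)) quadrant"

lemma sets_N: "sets (N \<omega>) = sets (restrict_space borel quadrant)"
  unfolding N_def by (rule sets_restrict_space_cong) simp

lemma emeasure_N:
  assumes "B \<in> sets borel" "B \<subseteq> quadrant"
  shows "emeasure (N \<omega>) B = emeasure (ext X \<omega>) (\<phi> \<omega> -` B)"
proof -
  have m: "\<phi> \<omega> \<in> ext X \<omega> \<rightarrow>\<^sub>M borel" using \<phi>_measurable by (simp cong: measurable_cong_sets)
  have sp: "space (ext X \<omega>) = UNIV" by (simp add: ext_def)
  have "emeasure (N \<omega>) B = emeasure (distr (ext X \<omega>) borel (\<phi> \<omega>)) B"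
    unfolding N_def using assms by (intro emeasure_restrict_space) auto
  also have "\<dots> = emeasure (ext X \<omega>) (\<phi> \<omega> -` B)"
    using assms(1) by (subst emeasure_distr[OF m]) (simp_all add: sp)
  finally show ?thesis .
qed

lemma measure_N:
  assumes "B \<in> sets borel" "B \<subseteq> quadrant"
  shows "measure (N \<omega>) B = measure (ext X \<omega>) (\<phi> \<omega> -` B)"
  using emeasure_N[OF assms] by (simp add: measure_def)

lemma bounded_borel_setsD:
  assumes "B \<in> bounded_borel_sets"
  shows "B \<in> sets borel" "B \<subseteq> quadrant" "bounded B"
  using assms by (auto simp: bounded_borel_sets_def)

lemma counting_N: "counting_process M N"
  unfolding counting_process_def
proof (intro conjI ballI)
  fix B assume "B \<in> bounded_borel_sets"
  note B = bounded_borel_setsD[OF this]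
  have nat: "\<exists>k::nat. emeasure (N \<omega>) B = of_nat k" if "\<omega> \<in> space M" for \<omega>
    using counting_ext_nat[OF X that \<phi>_vimage_borel[OF B(1)] \<phi>_vimage_bounded[OF B(3)]]
    by (metis emeasure_N[OF B(1,2)])
  show "\<exists>k::nat. emeasure (N \<omega>) B = of_nat k" if "\<omega> \<in> space M" for \<omega> using nat[OF that] .
  have [measurable]: "(\<lambda>\<omega>. measure (ext X \<omega>) (Pair \<omega> -` preim B)) \<in> borel_measurable M"
    by (intro lf_kernel_section_measurable XV.Z sets_pair_G preim_measurable B(1))
      (simp only: preim_section \<phi>_vimage_bounded[OF B(3)])
  have "(\<lambda>\<omega>. ennreal (measure (ext X \<omega>) (Pair \<omega> -` preim B))) \<in> borel_measurable M"
    by measurable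
  also have "?this \<longleftrightarrow> (\<lambda>\<omega>. emeasure (N \<omega>) B) \<in> borel_measurable M"
  proof (rule measurable_cong)
    fix \<omega> assume w: "\<omega> \<in> space M"
    obtain k :: nat where "emeasure (N \<omega>) B = of_nat k" using nat[OF w] by blast
    then show "ennreal (measure (ext X \<omega>) (Pair \<omega> -` preim B)) = emeasure (N \<omega>) B"
      using measure_N[OF B(1,2), of \<omega>] by (simp add: preim_section[OF w] measure_def ennreal_of_nat_eq_real_of_nat)
  qed
  finally show "(\<lambda>\<omega>. emeasure (N \<omega>) B) \<in> borel_measurable M" .
qed (rule sets_N)

lemma N_measurable: "B \<in> bounded_borel_sets \<Longrightarrow> (\<lambda>\<omega>. measure (N \<omega>) B) \<in> borel_measurable M"
  using counting_N unfolding counting_process_def measure_def by auto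

lemma N_Nats: "\<omega> \<in> space M \<Longrightarrow> B \<in> bounded_borel_sets \<Longrightarrow> measure (N \<omega>) B \<in> \<nat>"
  using counting_processD(2)[OF counting_N, of \<omega> B] by (auto simp: measure_def simp flip: ennreal_of_nat_eq_real_of_nat)

lemma X_Nats: "\<omega> \<in> space M \<Longrightarrow> B \<in> sets borel \<Longrightarrow> bounded B \<Longrightarrow> measure (ext X \<omega>) B \<in> \<nat>"
  by (rule counting_ext_Nats[OF X])

text \<open>The random sets \<open>preim (B j)\<close> have constant conditional means, because the
  time change maps the intensity to a multiple of Lebesgue measure. This one identity contains both
  the Poisson law of \<open>N\<close> and its independence of G.\<close>

lemma N_cond_poisson:
  fixes k :: nat
  assumes cp: "cond_poisson_borel (ext X) V"
    and B: "\<And>j. j < k \<Longrightarrow> B j \<in> bounded_borel_sets" "disjoint_family_on B {..<k}"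
  shows "cond_poisson M G {..<k} (\<lambda>j \<omega>. measure (N \<omega>) (B j)) (\<lambda>j _. lam * measure lborel (B j))"
proof -
  note Bd = bounded_borel_setsD[OF B(1)]
  have "cond_poisson M G {..<k} (\<lambda>j \<omega>. measure (ext X \<omega>) (Pair \<omega> -` preim (B j))) (\<lambda>j \<omega>. measure (V \<omega>) (Pair \<omega> -` preim (B j)))"
  proof (rule XV.cond_poisson_borel_random_sets[OF X_Nats cp])
    show "preim (B j) \<in> sets (G \<Otimes>\<^sub>M borel)" if "j < k" for j by (rule preim_measurable[OF Bd(1)[OF that]])
    show "disjoint_family_on (\<lambda>j. preim (B j)) {..<k}"
      unfolding disjoint_family_on_def
    proof (intro ballI impI)
      fix i j assume "i \<in> {..<k}" "j \<in> {..<k}" "i \<noteq> j"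
      then have "B i \<inter> B j = {}" using B(2) by (auto simp: disjoint_family_on_def)
      then show "preim (B i) \<inter> preim (B j) = {}" by (auto simp: preim_def)
    qed
    show "bounded (Pair \<omega> -` preim (B j))" if "j < k" "\<omega> \<in> space M" for j \<omega>
      using \<phi>_vimage_bounded[OF Bd(3)[OF that(1)]] by (simp only: preim_section[OF that(2)])
  qed
  then show ?thesis
  proof (rule cond_poisson_cong_AE[rotated])
    fix j assume "j \<in> {..<k}"
    then have j: "j < k" by simp
    have bd: "bounded (Pair \<omega> -` preim (B j))" if "\<omega> \<in> space M" for \<omega>
      using \<phi>_vimage_bounded[OF Bd(3)[OF j]] by (simp only: preim_section[OF that])
    show "(\<lambda>\<omega>. measure (ext X \<omega>) (Pair \<omega> -` preim (B j))) \<in> borel_measurable M"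
      "(\<lambda>\<omega>. measure (V \<omega>) (Pair \<omega> -` preim (B j))) \<in> borel_measurable M"
      by (rule lf_kernel_section_measurable[OF XV.Z sets_pair_G[OF preim_measurable[OF Bd(1)[OF j]]] bd]
          lf_kernel_section_measurable[OF XV.V sets_pair_G[OF preim_measurable[OF Bd(1)[OF j]]] bd]; assumption)+
    show "(\<lambda>\<omega>. measure (N \<omega>) (B j)) \<in> borel_measurable M" by (rule N_measurable[OF B(1)[OF j]])
    show "AE \<omega> in M. measure (ext X \<omega>) (Pair \<omega> -` preim (B j)) = measure (N \<omega>) (B j)"
      by (rule AE_I2) (simp only: preim_section measure_N[OF Bd(1,2)[OF j]])
    show "AE \<omega> in M. measure (V \<omega>) (Pair \<omega> -` preim (B j)) = lam * measure lborel (B j)"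
      by (rule AE_I2) (simp only: preim_section measure_V_\<phi>[OF Bd(1,2)[OF j]])
  qed auto
qed

lemma N_prob:
  fixes k :: nat
  assumes cp: "cond_poisson_borel (ext X) V"
    and B: "\<And>j. j < k \<Longrightarrow> B j \<in> bounded_borel_sets" "disjoint_family_on B {..<k}"
    and A: "A \<in> sets G"
  shows "prob (A \<inter> {\<omega> \<in> space M. \<forall>j<k. measure (N \<omega>) (B j) = real (x j)})
    = prob A * (\<Prod>j<k. poisson_weight (lam * measure lborel (B j)) (x j))"
proof -
  have E: "{\<omega> \<in> space M. \<forall>j\<in>{..<k}. measure (N \<omega>) (B j) = real (x j)} \<in> events"
    by (intro sets.sets_Collect_finite_All borel_measurable_eq N_measurable B) auto
  have AM: "A \<in> events" by (rule G_sets[OF A])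
  then have A_sub: "A \<subseteq> space M" by (rule sets.sets_into_space)
  have "prob (A \<inter> {\<omega> \<in> space M. \<forall>j\<in>{..<k}. measure (N \<omega>) (B j) = real (x j)})
      = (\<integral>\<omega>. indicator (A \<inter> {\<omega> \<in> space M. \<forall>j\<in>{..<k}. measure (N \<omega>) (B j) = real (x j)}) \<omega> \<partial>M)"
    by (rule prob_eq_integral) (intro sets.Int AM E)
  also have "\<dots> = (\<integral>\<omega>. indicator A \<omega> * count_ind {..<k} (\<lambda>j \<omega>. measure (N \<omega>) (B j)) x \<omega> \<partial>M)"
    by (rule Bochner_Integration.integral_cong) (auto simp: count_ind_eq_indicator indicator_def)
  also have "\<dots> = (\<integral>\<omega>. indicator A \<omega> * poisson_prod {..<k} (\<lambda>j _. lam * measure lborel (B j)) x \<omega> \<partial>M)"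
    using N_cond_poisson[OF cp B] A by (simp add: cond_poisson_def)
  also have "\<dots> = prob A * (\<Prod>j<k. poisson_weight (lam * measure lborel (B j)) (x j))"
    using A_sub by (simp add: poisson_prod_def Int_absorb2)
  finally show ?thesis by (simp only: Ball_def lessThan_iff)
qed

text \<open>With the whole space as the event of G, \<open>N_prob\<close> gives the unconditional
  product formula, and \<open>indep_vars_discrete\<close> turns it into independence.\<close>

lemma poisson_random_field_N:
  assumes cp: "cond_poisson_borel (ext X) V"
  shows "poisson_random_field M lam N"
  unfolding poisson_random_field_def
proof (intro conjI ballI allI impI counting_N)
  have one: "prob {\<omega> \<in> space M. measure (N \<omega>) B = real k} = poisson_weight (lam * measure lborel B) k"
    if B: "B \<in> bounded_borel_sets" for B k
  proof -
    have "prob (space M \<inter> {\<omega> \<in> space M. \<forall>j<1::nat. measure (N \<omega>) B = real k})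
        = prob (space M) * (\<Prod>j<1::nat. poisson_weight (lam * measure lborel B) k)"
      using N_prob[OF cp, of 1 "\<lambda>_. B" "space M" "\<lambda>_. k"] B G_space sets.top[of G]
      by (simp add: disjoint_family_on_def)
    then show ?thesis by (simp add: prob_space Int_def)
  qed
  show "prob {\<omega> \<in> space M. measure (N \<omega>) B = real k} = poisson_weight (lam * measure lborel B) k"
    if "B \<in> bounded_borel_sets" for B k
    using one[OF that] .
  fix n and B :: "nat \<Rightarrow> (real \<times> real) set"
  assume B: "(\<forall>i<n. B i \<in> bounded_borel_sets) \<and> disjoint_family_on B {..<n}"
  show "indep_vars (\<lambda>_. borel) (\<lambda>i \<omega>. measure (N \<omega>) (B i)) {..<n}"
  proof (rule indep_vars_discrete)
    show "(\<lambda>\<omega>. measure (N \<omega>) (B i)) \<in> borel_measurable M" if "i \<in> {..<n}" for i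
      using B that by (intro N_measurable) auto
    show "measure (N \<omega>) (B i) \<in> \<nat>" if "i \<in> {..<n}" "\<omega> \<in> space M" for i \<omega>
      using B that by (intro N_Nats) auto
    fix J and x :: "nat \<Rightarrow> nat" assume J: "J \<subseteq> {..<n}"
    define m where "m = card J"
    obtain h where h: "bij_betw h {..<m} J"
      using ex_bij_betw_nat_finite[OF finite_subset[OF J finite_lessThan]] by (auto simp: m_def atLeast0LessThan)
    have hJ: "h i \<in> J" if "i < m" for i using h that by (auto simp: bij_betw_def)
    have dis: "disjoint_family_on (\<lambda>i. B (h i)) {..<m}"
      unfolding disjoint_family_on_def
    proof (intro ballI impI)
      fix i j assume ij: "i \<in> {..<m}" "j \<in> {..<m}" "i \<noteq> j"
      then have "h i \<noteq> h j" using h by (auto simp: bij_betw_def inj_on_def)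
      moreover have "h i \<in> {..<n}" "h j \<in> {..<n}" using hJ ij J by auto
      ultimately show "B (h i) \<inter> B (h j) = {}" using B by (auto simp: disjoint_family_on_def)
    qed
    have "{\<omega> \<in> space M. \<forall>i\<in>J. measure (N \<omega>) (B i) = real (x i)}
        = space M \<inter> {\<omega> \<in> space M. \<forall>j<m. measure (N \<omega>) (B (h j)) = real (x (h j))}"
    proof -
      have Jh: "J = h ` {..<m}" using h by (simp add: bij_betw_def)
      have ball: "(\<forall>i\<in>J. P i) \<longleftrightarrow> (\<forall>j<m. P (h j))" for P
        unfolding Jh by blast
      show ?thesis unfolding ball by blast
    qed
    also have "prob \<dots> = prob (space M) * (\<Prod>j<m. poisson_weight (lam * measure lborel (B (h j))) (x (h j)))"
    proof (rule N_prob[OF cp _ dis])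
      show "B (h j) \<in> bounded_borel_sets" if "j < m" for j using B hJ[OF that] J by auto
      show "space M \<in> sets G" using G_space sets.top[of G] by simp
    qed
    also have "\<dots> = (\<Prod>i\<in>J. poisson_weight (lam * measure lborel (B i)) (x i))"
      using prod.reindex_bij_betw[OF h, of "\<lambda>i. poisson_weight (lam * measure lborel (B i)) (x i)"] by (simp add: prob_space)
    also have "\<dots> = (\<Prod>i\<in>J. prob {\<omega> \<in> space M. measure (N \<omega>) (B i) = real (x i)})"
    proof (rule prod.cong[OF refl])
      fix i assume "i \<in> J"
      then have "B i \<in> bounded_borel_sets" using B J by auto
      then show "poisson_weight (lam * measure lborel (B i)) (x i) = prob {\<omega> \<in> space M. measure (N \<omega>) (B i) = real (x i)}"
        by (simp add: one)
    qed
    finally show "prob {\<omega> \<in> space M. \<forall>i\<in>J. measure (N \<omega>) (B i) = real (x i)}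
        = (\<Prod>i\<in>J. prob {\<omega> \<in> space M. measure (N \<omega>) (B i) = real (x i)})" .
  qed simp
qed

lemma count_field_ext:
  assumes "counting_process M Z" "\<omega> \<in> space M"
  shows "count_field Z a b \<omega> = measure (ext Z \<omega>) ({0..a} \<times> {0..b})"
proof -
  have "({0..a} \<times> {0..b}) \<inter> quadrant = {0..a} \<times> {0..b}" by (auto simp: quadrant_def)
  then show ?thesis
    using measure_ext[where X = Z, OF counting_processD(1)[OF assms], of "{0..a} \<times> {0..b}"]
    by (simp add: count_field_def Times_borel)
qed

text \<open>For prescribed counts on disjoint sets the product rule with an event of G is
  \<open>N_prob\<close>. It extends to all events of \<open>N\<close> by
  \<open>counting_sigma_induct\<close>, with trivial \<open>G0\<close> and no forbidden set.\<close>

lemma indep_N: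
  assumes cp: "cond_poisson_borel (ext X) V"
  shows "indep_set (sets (sigma_count_field M N)) (sets G)"
proof -
  define \<Phi> where "\<Phi> E \<longleftrightarrow> E \<in> events \<and> (\<forall>A\<in>sets G. prob (A \<inter> E) = prob A * prob E)" for E
  have \<Phi>: "\<Phi> E" if E: "E \<in> sets (sigma_count_field M N)" for E
  proof (rule counting_sigma_induct[OF counting_N, where ?G0.0 = "{{}, space M}" and Q = quadrant and W = "{}"
        and R = "\<lambda>p. {0..fst p} \<times> {0..snd p}"])
    show "Int_stable {{}, space M}" by (auto simp: Int_stable_def)
    show "{0..fst p} \<times> {0..snd p} \<in> sets borel" "bounded ({0..fst p} \<times> {0..snd p})" for p :: "real \<times> real"
      using bounded_borel_setsD[OF Icc_Times_bounded_borel] by auto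
    show "E \<in> sigma_sets (space M) ({{}, space M} \<union> {(\<lambda>\<omega>. measure (ext N \<omega>) ({0..fst p} \<times> {0..snd p})) -` C \<inter> space M | p C. p \<in> quadrant \<and> C \<in> sets borel})"
    proof -
      have eq: "(\<lambda>(t1, t2). count_field N t1 t2) p -` C \<inter> space M = (\<lambda>\<omega>. measure (ext N \<omega>) ({0..fst p} \<times> {0..snd p})) -` C \<inter> space M" for p C
        by (auto simp: count_field_ext[OF counting_N] split: prod.splits)
      have "E \<in> sigma_sets (space M) {(\<lambda>(t1, t2). count_field N t1 t2) p -` C \<inter> space M | p C. p \<in> quadrant \<and> C \<in> sets borel}"
        using E by (simp only: sigma_count_field_def sigma_gen_sets)
      then show ?thesis
        unfolding eq by (rule sigma_sets_mono'[THEN subsetD, rotated]) blast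
    qed
  next
    fix A n and B :: "nat \<Rightarrow> (real \<times> real) set" and x :: "nat \<Rightarrow> nat"
    assume A: "A \<in> {{}, space M}" and B: "\<And>i. i < n \<Longrightarrow> B i \<in> sets borel" "\<And>i. i < n \<Longrightarrow> bounded (B i)"
      "disjoint_family_on B {..<n::nat}"
    let ?E = "{\<omega> \<in> space M. \<forall>i<n. measure (N \<omega>) (B i \<inter> quadrant) = real (x i)}"
    have eq: "{\<omega> \<in> space M. \<forall>i<n. measure (ext N \<omega>) (B i) = real (x i)} = ?E"
      using B(1) by (auto simp: measure_ext[where X = N, OF sets_N])
    have Bq: "B j \<inter> quadrant \<in> bounded_borel_sets" if "j < n" for j
      using B that by (intro bounded_borel_Int_quadrant)
    have dis: "disjoint_family_on (\<lambda>j. B j \<inter> quadrant) {..<n}"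
      using B(3) by (auto simp: disjoint_family_on_def)
    note p = N_prob[OF cp Bq dis, of _ x]
    have "{\<omega> \<in> space M. \<forall>i\<in>{..<n}. measure (N \<omega>) (B i \<inter> quadrant) = real (x i)} \<in> events"
      by (intro sets.sets_Collect_finite_All borel_measurable_eq N_measurable Bq) auto
    then have Ee: "?E \<in> events" by (simp only: Ball_def lessThan_iff)
    have "space M \<in> sets G" using G_space sets.top[of G] by simp
    from p[OF _ this] have pE: "prob ?E = (\<Prod>j<n. poisson_weight (lam * measure lborel (B j \<inter> quadrant)) (x j))"
      using sets.sets_into_space[OF Ee] by (simp add: prob_space Int_absorb1)
    have "prob (A' \<inter> ?E) = prob A' * prob ?E" if "A' \<in> sets G" for A'
      unfolding pE using p[OF _ that] by simp
    then have "\<Phi> ?E" unfolding \<Phi>_def using Ee by blast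
    moreover have "\<Phi> {}" by (simp add: \<Phi>_def)
    moreover have "space M \<inter> ?E = ?E" by blast
    ultimately show "\<Phi> (A \<inter> {\<omega> \<in> space M. \<forall>i<n. measure (ext N \<omega>) (B i) = real (x i)})"
      unfolding eq using A by (elim insertE emptyE) (simp_all only: Int_empty_left)
  next
    fix E assume E: "E \<in> events" "\<Phi> E"
    have "prob (A \<inter> (space M - E)) = prob A * prob (space M - E)" if A: "A \<in> sets G" for A
    proof -
      have AM: "A \<in> events" by (rule G_sets[OF A])
      have "A \<inter> (space M - E) = A - A \<inter> E" using sets.sets_into_space[OF AM] by auto
      then have "prob (A \<inter> (space M - E)) = prob A - prob (A \<inter> E)"
        using AM E(1) by (simp add: finite_measure_Diff)
      then show ?thesis using E A by (simp add: \<Phi>_def prob_compl algebra_simps)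
    qed
    then show "\<Phi> (space M - E)" using E(1) by (simp add: \<Phi>_def)
  next
    fix E :: "nat \<Rightarrow> 'a set"
    assume E: "range E \<subseteq> events" "disjoint_family E" "\<And>i. \<Phi> (E i)"
    have "prob (A \<inter> (\<Union>i. E i)) = prob A * prob (\<Union>i. E i)" if A: "A \<in> sets G" for A
    proof -
      have AM: "A \<in> events" by (rule G_sets[OF A])
      have s: "(\<lambda>i. prob (E i)) sums prob (\<Union>i. E i)"
        using E by (intro finite_measure_UNION) auto
      have "disjoint_family (\<lambda>i. A \<inter> E i)" using E(2) by (auto simp: disjoint_family_on_def)
      then have "(\<lambda>i. prob (A \<inter> E i)) sums prob (\<Union>i. A \<inter> E i)"
        using E(1) AM by (intro finite_measure_UNION) auto
      moreover have "(\<lambda>i. prob (A \<inter> E i)) sums (prob A * prob (\<Union>i. E i))"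
        using sums_mult[OF s, of "prob A"] E(3) A by (simp add: \<Phi>_def)
      ultimately show ?thesis using sums_unique2 by simp blast
    qed
    then show "\<Phi> (\<Union>i. E i)" using E(1) by (auto simp: \<Phi>_def)
  qed (auto simp: \<Phi>_def)
  show ?thesis
  proof (rule indep_setI)
    show "sets (sigma_count_field M N) \<subseteq> events" using \<Phi> by (auto simp: \<Phi>_def)
    show "sets G \<subseteq> events" using G_sets by blast
    show "prob (a \<inter> b) = prob a * prob b" if "a \<in> sets (sigma_count_field M N)" "b \<in> sets G" for a b
    proof -
      have "prob (b \<inter> a) = prob b * prob a" using \<Phi>[OF that(1)] that(2) unfolding \<Phi>_def by blast
      then show ?thesis by (simp only: Int_commute mult.commute)
    qed
  qed
qed

section \<open>Points over flat stretches of the paths\<close>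

text \<open>A Poisson variable with mean 0 vanishes, so the probability of an empty random set is
  the integral of the constant 1.\<close>

lemma null_random_set:
  assumes cp: "cond_poisson_borel (ext X) V" and S: "S \<in> sets (G \<Otimes>\<^sub>M borel)"
    and bd: "\<And>\<omega>. \<omega> \<in> space M \<Longrightarrow> bounded (Pair \<omega> -` S)"
    and V0: "\<And>\<omega>. \<omega> \<in> space M \<Longrightarrow> measure (V \<omega>) (Pair \<omega> -` S) = 0"
  shows "AE \<omega> in M. measure (ext X \<omega>) (Pair \<omega> -` S) = 0"
proof -
  let ?K = "\<lambda>\<omega>. measure (ext X \<omega>) (Pair \<omega> -` S)"
  have m [measurable]: "?K \<in> borel_measurable M"
    by (rule lf_kernel_section_measurable[OF XV.Z sets_pair_G[OF S] bd])
  have "cond_poisson M G {..<1::nat} (\<lambda>j. ?K) (\<lambda>j \<omega>. measure (V \<omega>) (Pair \<omega> -` S))"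
    by (rule XV.cond_poisson_borel_random_sets[OF X_Nats cp]) (use S bd in \<open>auto simp: disjoint_family_on_def\<close>)
  then have "(\<integral>\<omega>. indicator (space G) \<omega> * count_ind {..<1::nat} (\<lambda>j. ?K) (\<lambda>_. 0) \<omega> \<partial>M)
      = (\<integral>\<omega>. indicator (space G) \<omega> * poisson_prod {..<1::nat} (\<lambda>j \<omega>. measure (V \<omega>) (Pair \<omega> -` S)) (\<lambda>_. 0) \<omega> \<partial>M)"
    unfolding cond_poisson_def by blast
  also have "(\<integral>\<omega>. indicator (space G) \<omega> * count_ind {..<1::nat} (\<lambda>j. ?K) (\<lambda>_. 0) \<omega> \<partial>M)
      = (\<integral>\<omega>. indicator {\<omega> \<in> space M. ?K \<omega> = 0} \<omega> \<partial>M)"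
    by (rule Bochner_Integration.integral_cong) (auto simp: count_ind_def indicator_def G_space)
  also have "\<dots> = prob {\<omega> \<in> space M. ?K \<omega> = 0}"
    by (rule prob_eq_integral[symmetric]) measurable
  also have "(\<integral>\<omega>. indicator (space G) \<omega> * poisson_prod {..<1::nat} (\<lambda>j \<omega>. measure (V \<omega>) (Pair \<omega> -` S)) (\<lambda>_. 0) \<omega> \<partial>M)
      = (\<integral>\<omega>. 1 \<partial>M)"
    by (rule Bochner_Integration.integral_cong) (auto simp: poisson_prod_def V0 poisson_weight_0 G_space)
  finally have "prob {\<omega> \<in> space M. ?K \<omega> = 0} = 1" by (simp add: prob_space)
  then show ?thesis by (simp add: prob_Collect_eq_1)
qed

text \<open>Points whose first coordinate lies in a flat stretch of \<open>y1\<close>, beyond its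
  left endpoint. The rational witness gives product measurability, the window bounded
  sections.\<close>

definition flat1 :: "nat \<Rightarrow> ('a \<times> real \<times> real) set" where
  "flat1 K = {x \<in> space G \<times> UNIV. snd x \<in> window K \<and> (\<exists>q\<in>\<rat>. q < fst (snd x) \<and> y1 q (fst x) = y1 (fst (snd x)) (fst x))}"

definition flat2 :: "nat \<Rightarrow> ('a \<times> real \<times> real) set" where
  "flat2 K = {x \<in> space G \<times> UNIV. snd x \<in> window K \<and> (\<exists>q\<in>\<rat>. q < snd (snd x) \<and> y2 q (fst x) = y2 (snd (snd x)) (fst x))}"

lemma flat_measurable: "flat1 K \<in> sets (G \<Otimes>\<^sub>M borel)" "flat2 K \<in> sets (G \<Otimes>\<^sub>M borel)"
proof -
  let ?P = "G \<Otimes>\<^sub>M (borel :: (real \<times> real) measure)"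
  note [measurable] = coordinate_measurable
  have [measurable]: "(\<lambda>x. y1 q (fst x)) \<in> borel_measurable ?P" "(\<lambda>x. y2 q (fst x)) \<in> borel_measurable ?P" for q
    by (rule measurable_compose[OF measurable_fst y1] measurable_compose[OF measurable_fst y2])+
  have [measurable]: "(\<lambda>x. fst (snd x)) \<in> borel_measurable ?P" "(\<lambda>x. snd (snd x)) \<in> borel_measurable ?P"
    unfolding borel_prod[symmetric] by measurable
  have w: "{x \<in> space ?P. snd x \<in> window K} \<in> sets ?P"
    using measurable_sets[OF measurable_snd[of G borel] box2_borel] by (simp add: vimage_def Int_def conj_commute)
  have h: "{x \<in> space ?P. q < fst (snd x) \<and> y1 q (fst x) = y1 (fst (snd x)) (fst x)} \<in> sets ?P"
    "{x \<in> space ?P. q < snd (snd x) \<and> y2 q (fst x) = y2 (snd (snd x)) (fst x)} \<in> sets ?P" for q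
    by measurable
  have "{x \<in> space ?P. snd x \<in> window K} \<inter> (\<Union>q\<in>\<rat>. {x \<in> space ?P. q < fst (snd x) \<and> y1 q (fst x) = y1 (fst (snd x)) (fst x)}) \<in> sets ?P"
    by (intro sets.Int w sets.countable_UN' countable_rat) (use h in blast)
  also have "{x \<in> space ?P. snd x \<in> window K} \<inter> (\<Union>q\<in>\<rat>. {x \<in> space ?P. q < fst (snd x) \<and> y1 q (fst x) = y1 (fst (snd x)) (fst x)}) = flat1 K"
    by (auto simp: flat1_def space_pair_measure)
  finally show "flat1 K \<in> sets ?P" .
  have "{x \<in> space ?P. snd x \<in> window K} \<inter> (\<Union>q\<in>\<rat>. {x \<in> space ?P. q < snd (snd x) \<and> y2 q (fst x) = y2 (snd (snd x)) (fst x)}) \<in> sets ?P"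
    by (intro sets.Int w sets.countable_UN' countable_rat) (use h in blast)
  also have "{x \<in> space ?P. snd x \<in> window K} \<inter> (\<Union>q\<in>\<rat>. {x \<in> space ?P. q < snd (snd x) \<and> y2 q (fst x) = y2 (snd (snd x)) (fst x)}) = flat2 K"
    by (auto simp: flat2_def space_pair_measure)
  finally show "flat2 K \<in> sets ?P" .
qed

lemma flat_set_borel: "reg_path f \<Longrightarrow> {s. \<exists>q\<in>\<rat>. q < s \<and> f q = f s} \<in> sets borel"
proof -
  assume "reg_path f"
  then have [measurable]: "f \<in> borel_measurable borel" by (rule reg_path_borel)
  have h: "{s \<in> space borel. q < s \<and> f q = f s} \<in> sets borel" for q
    by measurable
  have "(\<Union>q\<in>\<rat>. {s \<in> space borel. q < s \<and> f q = f s}) \<in> sets borel"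
    by (intro sets.countable_UN' countable_rat) (use h in blast)
  also have "(\<Union>q\<in>\<rat>. {s \<in> space borel. q < s \<and> f q = f s}) = {s. \<exists>q\<in>\<rat>. q < s \<and> f q = f s}" by auto
  finally show ?thesis .
qed

lemma flat_null:
  assumes cp: "cond_poisson_borel (ext X) V"
  shows "AE \<omega> in M. \<forall>K. measure (ext X \<omega>) (Pair \<omega> -` flat1 K) = 0 \<and> measure (ext X \<omega>) (Pair \<omega> -` flat2 K) = 0"
proof -
  have bd: "bounded (Pair \<omega> -` flat1 K)" "bounded (Pair \<omega> -` flat2 K)" for \<omega> K
    by (rule bounded_subset[OF bounded_box2, of _ "- real K" "real K" "- real K" "real K"], auto simp: flat1_def flat2_def)+
  have null: "measure (V \<omega>) (Pair \<omega> -` flat1 K) = 0" "measure (V \<omega>) (Pair \<omega> -` flat2 K) = 0" if w: "\<omega> \<in> space M" for \<omega> K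
  proof -
    let ?s = "stieltjes2 (\<lambda>t. y1 t \<omega>) (\<lambda>t. y2 t \<omega>)"
    have n: "{s. \<exists>q\<in>\<rat>. q < s \<and> y1 q \<omega> = y1 s \<omega>} \<times> UNIV \<in> null_sets ?s"
      "UNIV \<times> {s. \<exists>q\<in>\<rat>. q < s \<and> y2 q \<omega> = y2 s \<omega>} \<in> null_sets ?s"
      using stieltjes2_null[OF reg1 reg2 flat_set_borel] emeasure_stieltjes_flat[OF reg1] emeasure_stieltjes_flat[OF reg2] reg1 reg2 by auto
    have "Pair \<omega> -` flat1 K \<in> null_sets ?s"
      by (rule null_sets_subset[OF n(1)]) (use section_borel[OF flat_measurable(1)] in \<open>auto simp: flat1_def\<close>)
    moreover have "Pair \<omega> -` flat2 K \<in> null_sets ?s"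
      by (rule null_sets_subset[OF n(2)]) (use section_borel[OF flat_measurable(2)] in \<open>auto simp: flat2_def\<close>)
    ultimately show "measure (V \<omega>) (Pair \<omega> -` flat1 K) = 0" "measure (V \<omega>) (Pair \<omega> -` flat2 K) = 0"
      by (simp_all add: measure_V measure_eq_0_null_sets)
  qed
  have "AE \<omega> in M. measure (ext X \<omega>) (Pair \<omega> -` flat1 K) = 0" "AE \<omega> in M. measure (ext X \<omega>) (Pair \<omega> -` flat2 K) = 0" for K
    by (rule null_random_set[OF cp flat_measurable(1) bd(1) null(1)] null_random_set[OF cp flat_measurable(2) bd(2) null(2)]; assumption)+
  then show ?thesis by (simp add: AE_all_countable)
qed

text \<open>The rectangle up to \<open>(t1, t2)\<close> lies in the preimage of its image rectangle.
  A further point of the preimage has a coordinate beyond \<open>t1\<close> or \<open>t2\<close>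
  without a larger path value, so it lies over a flat stretch, where \<open>X\<close> has no
  points.\<close>

lemma count_field_N:
  assumes cp: "cond_poisson_borel (ext X) V"
  shows "AE \<omega> in M. \<forall>t1\<ge>0. \<forall>t2\<ge>0. count_field X t1 t2 \<omega> = count_field N (y1 t1 \<omega>) (y2 t2 \<omega>) \<omega>"
  using flat_null[OF cp] AE_space
proof eventually_elim
  case (elim \<omega>)
  then have w: "\<omega> \<in> space M" by simp
  show ?case
  proof (intro allI impI)
    fix t1 t2 :: real assume t: "0 \<le> t1" "0 \<le> t2"
    let ?C = "{0..t1} \<times> {0..t2}" and ?Q = "{0..y1 t1 \<omega>} \<times> {0..y2 t2 \<omega>}"
    let ?D = "\<phi> \<omega> -` ?Q"
    have C: "?C \<in> sets borel" "bounded ?C" using bounded_borel_setsD[OF Icc_Times_bounded_borel] by auto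
    have D: "?D \<in> sets borel" "bounded ?D"
      using bounded_borel_setsD[OF Icc_Times_bounded_borel] by (auto intro!: \<phi>_vimage_borel \<phi>_vimage_bounded)
    have CD: "?C \<subseteq> ?D"
      using reg_path_nonneg[OF reg1, of _ \<omega>] reg_path_nonneg[OF reg2, of _ \<omega>] reg_pathD(1)[OF reg1, of _ _ \<omega>] reg_pathD(1)[OF reg2, of _ _ \<omega>]
      by (auto simp: \<phi>_def)
    obtain K where K: "?D \<subseteq> window K" using bounded_subset_window[OF D(2)] by blast
    \<comment> \<open>A rational time between \<open>t\<close> and \<open>s\<close> has the same
      value, since monotonicity squeezes it between the equal values at both ends.\<close>
    have flat: "\<exists>q\<in>\<rat>. q < s \<and> f q = f s" if f: "reg_path f" and "t < s" "f s \<le> f t" for f s t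
    proof -
      obtain q where q: "q \<in> \<rat>" "t < q" "q < s" using Rats_dense_in_real[OF \<open>t < s\<close>] by blast
      have "f t \<le> f q" "f q \<le> f s" using q reg_pathD(1)[OF f] by (auto simp: less_imp_le)
      then show ?thesis using q that by auto
    qed
    have nonneg: "0 \<le> s" if f: "reg_path f" and "0 \<le> f s" for f s
      using reg_pathD(3)[OF f, of s] that by (cases "0 \<le> s") auto
    have sub: "?D - ?C \<subseteq> Pair \<omega> -` flat1 K \<union> Pair \<omega> -` flat2 K"
    proof
      fix p assume p: "p \<in> ?D - ?C"
      obtain s1 s2 where s: "p = (s1, s2)" by (cases p)
      have le: "0 \<le> y1 s1 \<omega>" "y1 s1 \<omega> \<le> y1 t1 \<omega>" "0 \<le> y2 s2 \<omega>" "y2 s2 \<omega> \<le> y2 t2 \<omega>"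
        using p by (auto simp: s \<phi>_def)
      have "t1 < s1 \<or> t2 < s2"
        using p nonneg[OF reg1 le(1)] nonneg[OF reg2 le(3)] by (auto simp: s)
      then show "p \<in> Pair \<omega> -` flat1 K \<union> Pair \<omega> -` flat2 K"
      proof
        assume "t1 < s1"
        from flat[OF reg1 this le(2)] have "p \<in> Pair \<omega> -` flat1 K"
          using K p w by (auto simp: s flat1_def G_space)
        then show ?thesis by blast
      next
        assume "t2 < s2"
        from flat[OF reg2 this le(4)] have "p \<in> Pair \<omega> -` flat2 K"
          using K p w by (auto simp: s flat2_def G_space)
        then show ?thesis by blast
      qed
    qed
    have bd: "bounded (Pair \<omega> -` flat1 K)" "bounded (Pair \<omega> -` flat2 K)"
      by (rule bounded_subset[OF bounded_box2, of _ "- real K" "real K" "- real K" "real K"], auto simp: flat1_def flat2_def)+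
    have fl: "Pair \<omega> -` flat1 K \<in> null_sets (ext X \<omega>)" "Pair \<omega> -` flat2 K \<in> null_sets (ext X \<omega>)"
    proof -
      have z: "emeasure (ext X \<omega>) B = 0" if "B \<in> sets borel" "bounded B" "measure (ext X \<omega>) B = 0" for B
        using counting_ext_nat[OF X w that(1,2)] that(3) by auto
      show "Pair \<omega> -` flat1 K \<in> null_sets (ext X \<omega>)" "Pair \<omega> -` flat2 K \<in> null_sets (ext X \<omega>)"
        using elim(1) by (auto simp: null_sets_def intro!: z section_borel[OF flat_measurable(1)] section_borel[OF flat_measurable(2)] bd)
    qed
    have "?D - ?C \<in> null_sets (ext X \<omega>)"
      by (rule null_sets_subset[OF null_sets.Un[OF fl] _ sub]) (use C D in auto)
    then have "emeasure (ext X \<omega>) (?D - (?D - ?C)) = emeasure (ext X \<omega>) ?D"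
      using D by (intro emeasure_Diff_null_set) auto
    moreover have "?D - (?D - ?C) = ?C" using CD by auto
    ultimately have "measure (ext X \<omega>) ?C = measure (ext X \<omega>) ?D" by (simp add: measure_def)
    also have "\<dots> = measure (N \<omega>) ?Q"
      using bounded_borel_setsD[OF Icc_Times_bounded_borel, of "y1 t1 \<omega>" "y2 t2 \<omega>"] by (simp add: measure_N)
    finally show "count_field X t1 t2 \<omega> = count_field N (y1 t1 \<omega>) (y2 t2 \<omega>) \<omega>"
      using count_field_ext[OF X w, of t1 t2] by (simp only: count_field_def)
  qed
qed

end

subsection \<open>From a time-changed Poisson field to conditional Poisson counts\<close>

lemma count0_measurable:
  assumes "\<And>u1 u2. 0 \<le> u1 \<Longrightarrow> 0 \<le> u2 \<Longrightarrow> P u1 u2 \<Longrightarrow> count_field X u1 u2 \<in> borel_measurable S" "P a b"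
  shows "count0 X a b \<in> borel_measurable S"
  using assms unfolding count0_def[abs_def] by (cases "a < 0 \<or> b < 0") auto

lemma ext_box2_measurable:
  assumes X: "counting_process M X" and sp: "space S = space M" and le: "a \<le> b" "c \<le> d"
    and m: "count0 X b d \<in> borel_measurable S" "count0 X a d \<in> borel_measurable S"
      "count0 X b c \<in> borel_measurable S" "count0 X a c \<in> borel_measurable S"
  shows "(\<lambda>\<omega>. measure (ext X \<omega>) (box2 a b c d)) \<in> borel_measurable S"
proof -
  have "(\<lambda>\<omega>. count0 X b d \<omega> - count0 X a d \<omega> - count0 X b c \<omega> + count0 X a c \<omega>) \<in> borel_measurable S"
    using m by measurable
  then show ?thesis
    by (rule measurable_cong[THEN iffD1, rotated]) (simp add: measure_ext_box2[OF X _ le] sp)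
qed

lemma cell_le: "(real_of_int k - 1) / 2 ^ n \<le> real_of_int k / 2 ^ n"
  by (simp add: divide_right_mono)

lemma (in prob_space) integral_count_ind:
  assumes I: "finite I" and A: "A \<in> events" and m: "\<And>c. c \<in> I \<Longrightarrow> K c \<in> borel_measurable M"
  shows "(\<integral>\<omega>. indicator A \<omega> * count_ind I K x \<omega> \<partial>M) = prob (A \<inter> {\<omega> \<in> space M. \<forall>c\<in>I. K c \<omega> = real (x c)})"
proof -
  have E: "{\<omega> \<in> space M. \<forall>c\<in>I. K c \<omega> = real (x c)} \<in> events"
    by (intro sets.sets_Collect_finite_All borel_measurable_eq m I) auto
  have "prob (A \<inter> {\<omega> \<in> space M. \<forall>c\<in>I. K c \<omega> = real (x c)}) = (\<integral>\<omega>. indicator (A \<inter> {\<omega> \<in> space M. \<forall>c\<in>I. K c \<omega> = real (x c)}) \<omega> \<partial>M)"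
    by (rule prob_eq_integral) (intro sets.Int A E)
  also have "\<dots> = (\<integral>\<omega>. indicator A \<omega> * count_ind I K x \<omega> \<partial>M)"
    using I by (intro Bochner_Integration.integral_cong) (auto simp: count_ind_eq_indicator indicator_def)
  finally show ?thesis ..
qed

lemma measure_scale_ennreal: "0 \<le> lam \<Longrightarrow> measure (scale_measure (ennreal lam) S) B = lam * measure S B"
  by (simp add: measure_def enn2real_mult)

lemma measure_scaled_stieltjes2_box2:
  assumes f: "reg_path f" and g: "reg_path g" and "0 \<le> lam" and le: "a \<le> b" "c \<le> d"
  shows "measure (scale_measure (ennreal lam) (stieltjes2 f g)) (box2 a b c d)
    = lam * ((max 0 (f b) - max 0 (f a)) * (max 0 (g d) - max 0 (g c)))"
proof -
  have "0 \<le> (max 0 (f b) - max 0 (f a)) * (max 0 (g d) - max 0 (g c))"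
    using reg_path_max_mono[OF f le(1)] reg_path_max_mono[OF g le(2)] by (intro mult_nonneg_nonneg) auto
  then have "measure (stieltjes2 f g) (box2 a b c d) = (max 0 (f b) - max 0 (f a)) * (max 0 (g d) - max 0 (g c))"
    unfolding measure_def emeasure_stieltjes2_box2[OF f g le] by (rule enn2real_ennreal)
  then show ?thesis by (simp only: measure_scale_ennreal[OF \<open>0 \<le> lam\<close>])
qed

context fprf_setting
begin

lemma V_box2:
  "a \<le> b \<Longrightarrow> c \<le> d \<Longrightarrow> measure (V \<omega>) (box2 a b c d)
    = lam * ((max 0 (y1 b \<omega>) - max 0 (y1 a \<omega>)) * (max 0 (y2 d \<omega>) - max 0 (y2 c \<omega>)))"
  unfolding V_def by (rule measure_scaled_stieltjes2_box2[OF reg1 reg2 less_imp_le[OF lam]])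

text \<open>Independence of G makes the conditional law of the cell counts equal to their law, which
  factorises because the cells are disjoint.\<close>

lemma poisson_field_cells:
  assumes N: "poisson_random_field M lam N'"
    and ind: "indep_set (sets (sigma_count_field M N')) (sets G)"
    and I: "finite I"
  shows "cond_poisson M G I (\<lambda>c \<omega>. measure (ext N' \<omega>) (idx n -` {c})) (\<lambda>c \<omega>. lam * measure lborel (idx n -` {c} \<inter> quadrant))"
proof (cases "I = {}")
  case True
  then show ?thesis by (simp add: cond_poisson_def count_ind_def poisson_prod_def)
next
  case False
  have cN: "counting_process M N'" using N by (simp add: poisson_random_field_def)
  define B where "B c = idx n -` {c} \<inter> quadrant" for c
  have B: "B c \<in> bounded_borel_sets" for c
    unfolding B_def by (intro bounded_borel_Int_quadrant idx_vimage_borel bounded_cell)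
  have NB: "measure (ext N' \<omega>) (idx n -` {c}) = measure (N' \<omega>) (B c)" if "\<omega> \<in> space M" for \<omega> c
    using measure_ext[where X = N', OF counting_processD(1)[OF cN that]] by (simp add: B_def)
  let ?S = "sigma_count_field M N'"
  have sp: "space ?S = space M" by (simp add: sigma_count_field_def)
  have "count_field N' u1 u2 \<in> borel_measurable ?S" if "0 \<le> u1" "0 \<le> u2" for u1 u2
    using sigma_gen_measurable[of "(u1, u2)" quadrant "\<lambda>(t1, t2). count_field N' t1 t2" "space M"] that
    by (simp add: sigma_count_field_def quadrant_def)
  then have c0: "count0 N' u1 u2 \<in> borel_measurable ?S" for u1 u2
    by (rule count0_measurable[where P = "\<lambda>_ _. True"]) simp_all
  \<comment> \<open>Independence of G is given only for the sigma-algebra of the distribution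
    function of \<open>N'\<close>; cell counts belong to it as alternating sums over four
    corners.\<close>
  have mS: "(\<lambda>\<omega>. measure (ext N' \<omega>) (idx n -` {c})) \<in> borel_measurable ?S" for c
    unfolding cell_box2 by (intro ext_box2_measurable[OF cN sp] cell_le c0)
  have mM: "(\<lambda>\<omega>. measure (ext N' \<omega>) (idx n -` {c})) \<in> borel_measurable M" for c
    by (intro lf_kernel_measurable counting_lf_kernel[OF cN] bounded_cell idx_vimage_borel)
  show ?thesis
    unfolding cond_poisson_def
  proof (intro ballI allI)
    fix A and x :: "int \<times> int \<Rightarrow> nat" assume A: "A \<in> sets G"
    let ?E = "{\<omega> \<in> space M. \<forall>c\<in>I. measure (ext N' \<omega>) (idx n -` {c}) = real (x c)}"
    have "{\<omega> \<in> space ?S. \<forall>c\<in>I. measure (ext N' \<omega>) (idx n -` {c}) = real (x c)} \<in> sets ?S"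
      by (intro sets.sets_Collect_finite_All borel_measurable_eq mS I) auto
    then have E: "?E \<in> sets ?S" by (simp only: sp)
    obtain h where h: "bij_betw h {..<card I} I"
      using ex_bij_betw_nat_finite[OF I] by (auto simp: atLeast0LessThan)
    have Ih: "I = h ` {..<card I}" using h by (simp add: bij_betw_def)
    have ball: "(\<forall>c\<in>I. P c) \<longleftrightarrow> (\<forall>j\<in>{..<card I}. P (h j))" for P
      by (subst Ih) blast
    have "disjoint_family_on (\<lambda>j. B (h j)) {..<card I}"
      unfolding disjoint_family_on_def
    proof (intro ballI impI)
      fix i j assume "i \<in> {..<card I}" "j \<in> {..<card I}" "i \<noteq> j"
      then have "h i \<noteq> h j" using h by (auto simp: bij_betw_def inj_on_def)
      then show "B (h i) \<inter> B (h j) = {}" by (auto simp: B_def)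
    qed
    moreover have "\<forall>n (B :: nat \<Rightarrow> (real \<times> real) set). (\<forall>i<n. B i \<in> bounded_borel_sets) \<and> disjoint_family_on B {..<n} \<longrightarrow>
        indep_vars (\<lambda>_. borel) (\<lambda>i \<omega>. measure (N' \<omega>) (B i)) {..<n}"
      using N unfolding poisson_random_field_def by (elim conjE)
    ultimately have iv: "indep_vars (\<lambda>_. borel) (\<lambda>j \<omega>. measure (N' \<omega>) (B (h j))) {..<card I}"
      using B by simp
    have "0 \<in> {..<card I}" using False I by (simp add: card_gt_0_iff)
    then have J: "{..<card I} \<noteq> {}" by blast
    have "?E = (\<Inter>j\<in>{..<card I}. (\<lambda>\<omega>. measure (N' \<omega>) (B (h j))) -` {real (x (h j))} \<inter> space M)"
      using J by (auto simp: ball NB)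
    also have "prob \<dots> = (\<Prod>j\<in>{..<card I}. prob ((\<lambda>\<omega>. measure (N' \<omega>) (B (h j))) -` {real (x (h j))} \<inter> space M))"
      by (rule indep_varsD_finite[OF iv J]) simp_all
    also have "\<dots> = (\<Prod>j\<in>{..<card I}. poisson_weight (lam * measure lborel (B (h j))) (x (h j)))"
    proof (rule prod.cong[OF refl])
      fix j
      have "(\<lambda>\<omega>. measure (N' \<omega>) (B (h j))) -` {real (x (h j))} \<inter> space M = {\<omega> \<in> space M. measure (N' \<omega>) (B (h j)) = real (x (h j))}"
        by auto
      then show "prob ((\<lambda>\<omega>. measure (N' \<omega>) (B (h j))) -` {real (x (h j))} \<inter> space M) = poisson_weight (lam * measure lborel (B (h j))) (x (h j))"
        using N B[of "h j"] unfolding poisson_random_field_def by simp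
    qed
    also have "\<dots> = (\<Prod>c\<in>I. poisson_weight (lam * measure lborel (B c)) (x c))"
      by (rule prod.reindex_bij_betw[OF h])
    finally have pE: "prob ?E = (\<Prod>c\<in>I. poisson_weight (lam * measure lborel (B c)) (x c))" .
    have "(\<integral>\<omega>. indicator A \<omega> * count_ind I (\<lambda>c \<omega>. measure (ext N' \<omega>) (idx n -` {c})) x \<omega> \<partial>M) = prob (A \<inter> ?E)"
      by (rule integral_count_ind[OF I G_sets[OF A] mM])
    also have "\<dots> = prob ?E * prob A"
      using indep_setD[OF ind E A] by (simp only: Int_commute)
    also have "\<dots> = (\<integral>\<omega>. indicator A \<omega> * poisson_prod I (\<lambda>c \<omega>. lam * measure lborel (idx n -` {c} \<inter> quadrant)) x \<omega> \<partial>M)"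
      using prob_eq_integral[OF G_sets[OF A]] by (simp add: pE poisson_prod_def B_def mult.commute)
    finally show "(\<integral>\<omega>. indicator A \<omega> * count_ind I (\<lambda>c \<omega>. measure (ext N' \<omega>) (idx n -` {c})) x \<omega> \<partial>M)
      = (\<integral>\<omega>. indicator A \<omega> * poisson_prod I (\<lambda>c \<omega>. lam * measure lborel (idx n -` {c} \<inter> quadrant)) x \<omega> \<partial>M)" .
  qed
qed

text \<open>A cell count of \<open>X\<close> is an alternating sum of distribution function values
  at four corners. The time change moves these corners, and the sum becomes the count of
  \<open>N'\<close> in the rectangle with the moved corners.\<close>

lemma time_changed_cond_poisson:
  assumes N: "poisson_random_field M lam N'"
    and ind: "indep_set (sets (sigma_count_field M N')) (sets G)"
    and XN: "AE \<omega> in M. \<forall>t1\<ge>0. \<forall>t2\<ge>0. count_field X t1 t2 \<omega> = count_field N' (y1 t1 \<omega>) (y2 t2 \<omega>) \<omega>"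
  shows "cond_poisson_borel (ext X) V"
proof (rule XV.cells_imp_cond_poisson_borel[OF X_Nats])
  fix n and I :: "(int \<times> int) set" assume I: "finite I"
  have cN: "counting_process M N'" using N by (simp add: poisson_random_field_def)
  \<comment> \<open>Lebesgue measure on the quadrant, scaled, is written as the Stieltjes measure of
    the identity paths, so that the same kernel and rectangle lemmas serve both intensities.\<close>
  define \<Lambda> :: "'a \<Rightarrow> (real \<times> real) measure"
    where "\<Lambda> \<omega> = scale_measure (ennreal lam) (stieltjes2 (\<lambda>t. t) (\<lambda>t. t))" for \<omega>
  have lam0: "0 \<le> lam" using lam by simp
  have \<Lambda>: "lf_kernel G \<Lambda>"
    unfolding \<Lambda>_def[abs_def] by (rule stieltjes2_lf_kernel[OF reg_path_id reg_path_id _ _ lam0]) simp_all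
  have C: "cox_lf_kernels M G (ext N') \<Lambda>"
    by (rule cox_lf_kernels.intro[OF cond_prob_axioms], rule cox_lf_kernels_axioms.intro[OF counting_lf_kernel[OF cN] \<Lambda>])
  have NLV: "measure (\<Lambda> \<omega>) B = lam * measure lborel (B \<inter> quadrant)" if B: "B \<in> sets borel" for B \<omega>
  proof -
    have "measure (\<Lambda> \<omega>) B = lam * measure (stieltjes2 (\<lambda>t. t) (\<lambda>t. t)) (B \<inter> quadrant)"
      unfolding \<Lambda>_def measure_scale_ennreal[OF lam0] stieltjes2_quadrant[OF reg_path_id reg_path_id B] ..
    also have "\<dots> = lam * measure lborel (B \<inter> quadrant)"
      using B by (subst measure_stieltjes2_id) auto
    finally show ?thesis .
  qed
  obtain h where h: "bij_betw h {..<card I} I"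
    using ex_bij_betw_nat_finite[OF I] by (auto simp: atLeast0LessThan)
  define a where "a j = (real_of_int (fst (h j)) - 1) / 2 ^ n" for j
  define b where "b j = real_of_int (fst (h j)) / 2 ^ n" for j
  define c where "c j = (real_of_int (snd (h j)) - 1) / 2 ^ n" for j
  define d where "d j = real_of_int (snd (h j)) / 2 ^ n" for j
  have cell: "idx n -` {h j} = box2 (a j) (b j) (c j) (d j)" for j
    unfolding cell_box2 a_def b_def c_def d_def ..
  have le: "a j \<le> b j" "c j \<le> d j" for j
    unfolding a_def b_def c_def d_def by (rule cell_le)+
  \<comment> \<open>The rectangle with the moved corners as a random set; monotone paths keep these
    rectangles disjoint for different cells.\<close>
  define S where "S j = {x \<in> space (G \<Otimes>\<^sub>M (borel :: (real \<times> real) measure)). y1 (a j) (fst x) < fst (snd x) \<and> fst (snd x) \<le> y1 (b j) (fst x)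
      \<and> y2 (c j) (fst x) < snd (snd x) \<and> snd (snd x) \<le> y2 (d j) (fst x)}" for j
  have sec: "Pair \<omega> -` S j = box2 (y1 (a j) \<omega>) (y1 (b j) \<omega>) (y2 (c j) \<omega>) (y2 (d j) \<omega>)" if "\<omega> \<in> space M" for \<omega> j
    using that by (auto simp: S_def box2_def space_pair_measure G_space)
  have Sm: "S j \<in> sets (G \<Otimes>\<^sub>M borel)" for j
  proof -
    let ?P = "G \<Otimes>\<^sub>M (borel :: (real \<times> real) measure)"
    have [measurable]: "(\<lambda>x. y1 q (fst x)) \<in> borel_measurable ?P" "(\<lambda>x. y2 q (fst x)) \<in> borel_measurable ?P" for q
      by (rule measurable_compose[OF measurable_fst y1] measurable_compose[OF measurable_fst y2])+
    have [measurable]: "(\<lambda>x. fst (snd x)) \<in> borel_measurable ?P" "(\<lambda>x. snd (snd x)) \<in> borel_measurable ?P"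
      unfolding borel_prod[symmetric] by measurable
    show ?thesis unfolding S_def by measurable
  qed
  have dis: "disjoint_family_on S {..<card I}"
    unfolding disjoint_family_on_def
  proof (intro ballI impI)
    fix i j assume "i \<in> {..<card I}" "j \<in> {..<card I}" "i \<noteq> j"
    then have "h i \<noteq> h j" using h by (auto simp: bij_betw_def inj_on_def)
    then consider "fst (h i) < fst (h j)" | "fst (h j) < fst (h i)" | "snd (h i) < snd (h j)" | "snd (h j) < snd (h i)"
      by (metis linorder_neqE prod.expand)
    then have "b i \<le> a j \<or> b j \<le> a i \<or> d i \<le> c j \<or> d j \<le> c i"
    proof -
      have "real_of_int k / 2 ^ n \<le> (real_of_int l - 1) / 2 ^ n" if "k < l" for k l :: int
        using that by (intro divide_right_mono) auto
      then show ?thesis unfolding a_def b_def c_def d_def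
        using \<open>h i \<noteq> h j\<close> by (metis linorder_neqE prod.expand)
    qed
    then have "y1 (b i) \<omega> \<le> y1 (a j) \<omega> \<or> y1 (b j) \<omega> \<le> y1 (a i) \<omega> \<or> y2 (d i) \<omega> \<le> y2 (c j) \<omega> \<or> y2 (d j) \<omega> \<le> y2 (c i) \<omega>" for \<omega>
      using reg_pathD(1)[OF reg1] reg_pathD(1)[OF reg2] by blast
    note ord = this
    show "S i \<inter> S j = {}"
    proof (rule equals0I)
      fix p assume "p \<in> S i \<inter> S j"
      then show False using ord[of "fst p"] by (auto simp: S_def)
    qed
  qed
  have cp: "cond_poisson M G {..<card I} (\<lambda>j \<omega>. measure (ext N' \<omega>) (Pair \<omega> -` S j)) (\<lambda>j \<omega>. measure (\<Lambda> \<omega>) (Pair \<omega> -` S j))"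
  proof (rule cox_lf_kernels.cond_poisson_random_bounded_sets[OF C])
    show "measure (ext N' \<omega>) B \<in> \<nat>" if "\<omega> \<in> space M" "B \<in> sets borel" "bounded B" for \<omega> B
      by (rule counting_ext_Nats[OF cN that])
    show "cond_poisson M G I' (\<lambda>c \<omega>. measure (ext N' \<omega>) (idx m -` {c})) (\<lambda>c \<omega>. measure (\<Lambda> \<omega>) (idx m -` {c}))"
      if "finite I'" for m I'
      using poisson_field_cells[OF N ind that, of m] by (simp only: NLV[OF idx_vimage_borel])
    show "bounded (Pair \<omega> -` S j)" if "\<omega> \<in> space M" for j \<omega>
      unfolding sec[OF that] by (rule bounded_box2)
  qed (use Sm dis in auto)
  \<comment> \<open>The identity extends to corners with negative coordinates because a regular path
    is negative exactly at negative times.\<close>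
  have c0: "AE \<omega> in M. \<forall>a b. count0 X a b \<omega> = count0 N' (y1 a \<omega>) (y2 b \<omega>) \<omega>"
    using XN
  proof eventually_elim
    case (elim \<omega>)
    have neg: "y1 t \<omega> < 0 \<longleftrightarrow> t < 0" "y2 t \<omega> < 0 \<longleftrightarrow> t < 0" for t
      using reg_path_nonneg[OF reg1, of t \<omega>] reg_path_nonneg[OF reg2, of t \<omega>]
        reg_pathD(3)[OF reg1, of t \<omega>] reg_pathD(3)[OF reg2, of t \<omega>] by (cases "t < 0"; simp add: not_less)+
    show ?case using elim by (auto simp: count0_def neg)
  qed
  show "cond_poisson M G I (\<lambda>c \<omega>. measure (ext X \<omega>) (idx n -` {c})) (\<lambda>c \<omega>. measure (V \<omega>) (idx n -` {c}))"
  proof (rule cond_poisson_reindex[OF h], rule cond_poisson_cong_AE[OF _ cp])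
    fix j
    have bd: "bounded (Pair \<omega> -` S j)" if "\<omega> \<in> space M" for \<omega>
      unfolding sec[OF that] by (rule bounded_box2)
    show "(\<lambda>\<omega>. measure (ext N' \<omega>) (Pair \<omega> -` S j)) \<in> borel_measurable M"
      by (rule lf_kernel_section_measurable[OF counting_lf_kernel[OF cN] sets_pair_G[OF Sm] bd])
    show "(\<lambda>\<omega>. measure (\<Lambda> \<omega>) (Pair \<omega> -` S j)) \<in> borel_measurable M"
      by (rule lf_kernel_section_measurable[OF cox_lf_kernels.V[OF C] sets_pair_G[OF Sm] bd])
    show "(\<lambda>\<omega>. measure (ext X \<omega>) (idx n -` {h j})) \<in> borel_measurable M" "(\<lambda>\<omega>. measure (V \<omega>) (idx n -` {h j})) \<in> borel_measurable M"
      by (intro lf_kernel_measurable XV.Z XV.V bounded_cell idx_vimage_borel)+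
    show "AE \<omega> in M. measure (ext N' \<omega>) (Pair \<omega> -` S j) = measure (ext X \<omega>) (idx n -` {h j})"
      using c0 AE_space
    proof eventually_elim
      case (elim \<omega>)
      have le': "y1 (a j) \<omega> \<le> y1 (b j) \<omega>" "y2 (c j) \<omega> \<le> y2 (d j) \<omega>"
        using reg_pathD(1)[OF reg1 le(1)] reg_pathD(1)[OF reg2 le(2)] .
      show ?case
        using elim(1) by (simp only: sec[OF elim(2)] cell measure_ext_box2[OF cN elim(2) le'] measure_ext_box2[OF X elim(2) le])
    qed
    show "AE \<omega> in M. measure (\<Lambda> \<omega>) (Pair \<omega> -` S j) = measure (V \<omega>) (idx n -` {h j})"
    proof (rule AE_I2)
      fix \<omega> assume w: "\<omega> \<in> space M"
      have le': "y1 (a j) \<omega> \<le> y1 (b j) \<omega>" "y2 (c j) \<omega> \<le> y2 (d j) \<omega>"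
        using reg_pathD(1)[OF reg1 le(1)] reg_pathD(1)[OF reg2 le(2)] .
      show "measure (\<Lambda> \<omega>) (Pair \<omega> -` S j) = measure (V \<omega>) (idx n -` {h j})"
        by (simp only: sec[OF w] cell V_box2[OF le] \<Lambda>_def measure_scaled_stieltjes2_box2[OF reg_path_id reg_path_id lam0 le'])
    qed
  qed auto
qed

subsection \<open>The filtration generated by the field and the time change\<close>

definition F :: "real \<Rightarrow> real \<Rightarrow> 'a measure" where
  "F = enlarged_filtration M G X"

definition FS :: "real \<Rightarrow> real \<Rightarrow> 'a measure" where
  "FS = F_star M F"

text \<open>Corners of the rectangles with lower left corner at the origin that are known at
  \<open>(s1, s2)\<close>. All these rectangles miss the open quadrant beyond
  \<open>(s1, s2)\<close>.\<close>

definition past :: "real \<Rightarrow> real \<Rightarrow> (real \<times> real) set" where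
  "past s1 s2 = {p. 0 \<le> fst p \<and> 0 \<le> snd p \<and> (fst p \<le> s1 \<or> snd p \<le> s2)}"

lemma count_field_measurable: "count_field X t1 t2 \<in> borel_measurable M"
proof -
  have "(\<lambda>\<omega>. emeasure (X \<omega>) ({0..t1} \<times> {0..t2})) \<in> borel_measurable M"
    using X Icc_Times_bounded_borel by (simp add: counting_process_def)
  then show ?thesis unfolding count_field_def[abs_def] measure_def by measurable
qed

lemma sets_natural: "sets (natural_filtration M X t1 t2)
    = sigma_sets (space M) {count_field X (fst p) (snd p) -` A \<inter> space M | p A. p \<in> {0..t1} \<times> {0..t2} \<and> A \<in> sets borel}"
  unfolding natural_filtration_def sigma_gen_sets by (simp add: case_prod_beta)

lemma count_vimage_events: "A \<in> sets borel \<Longrightarrow> count_field X t1 t2 -` A \<inter> space M \<in> events"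
  by (rule measurable_sets[OF count_field_measurable])

lemma sets_natural_sub: "sets (natural_filtration M X t1 t2) \<subseteq> events"
  unfolding sets_natural by (rule sets.sigma_sets_subset) (auto intro: count_vimage_events)

lemma sets_F: "sets (F t1 t2) = sigma_sets (space M) (sets (natural_filtration M X t1 t2) \<union> sets G)"
  and space_F: "space (F t1 t2) = space M"
proof -
  have "sets (natural_filtration M X t1 t2) \<union> sets G \<subseteq> Pow (space M)"
    using sets_natural_sub[of t1 t2] G_sets sets.sets_into_space by blast
  then show "sets (F t1 t2) = sigma_sets (space M) (sets (natural_filtration M X t1 t2) \<union> sets G)" "space (F t1 t2) = space M"
    unfolding F_def enlarged_filtration_def sigma_join_def by (simp_all add: sets_measure_of space_measure_of)
qed

lemma sets_F_sub: "sets (F t1 t2) \<subseteq> events"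
  unfolding sets_F by (rule sets.sigma_sets_subset) (use sets_natural_sub G_sets in blast)

lemma filtration_F: "filtration2 M F"
  unfolding filtration2_def
proof (intro conjI allI impI)
  show "subalgebra M (F t1 t2)" for t1 t2
    using sets_F_sub space_F by (simp add: subalgebra_def)
  fix s1 s2 t1 t2 :: real assume st: "s1 \<le> t1" "s2 \<le> t2"
  have "sets (natural_filtration M X s1 s2) \<subseteq> sets (natural_filtration M X t1 t2)"
    unfolding sets_natural
  proof (rule sigma_sets_mono', safe)
    fix a b and A :: "real set" assume "a \<in> {0..s1}" "b \<in> {0..s2}" "A \<in> sets borel"
    then show "\<exists>p A'. count_field X (fst (a, b)) (snd (a, b)) -` A \<inter> space M = count_field X (fst p) (snd p) -` A' \<inter> space M
        \<and> p \<in> {0..t1} \<times> {0..t2} \<and> A' \<in> sets borel"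
      using st by (intro exI[of _ "(a, b)"] exI[of _ A]) auto
  qed
  then show "sets (F s1 s2) \<subseteq> sets (F t1 t2)"
    unfolding sets_F by (intro sigma_sets_mono') blast
qed

lemma count_field_F: "0 \<le> u1 \<Longrightarrow> u1 \<le> t1 \<Longrightarrow> 0 \<le> u2 \<Longrightarrow> u2 \<le> t2 \<Longrightarrow> count_field X u1 u2 \<in> borel_measurable (F t1 t2)"
proof (rule measurableI)
  fix A :: "real set" assume u: "0 \<le> u1" "u1 \<le> t1" "0 \<le> u2" "u2 \<le> t2" and A: "A \<in> sets borel"
  have "count_field X u1 u2 -` A \<inter> space M \<in> sets (natural_filtration M X t1 t2)"
    unfolding sets_natural
    by (rule sigma_sets.Basic, rule CollectI, rule exI[of _ "(u1, u2)"], rule exI[of _ A]) (use u A in simp)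
  then show "count_field X u1 u2 -` A \<inter> space (F t1 t2) \<in> sets (F t1 t2)"
    unfolding sets_F space_F by (intro sigma_sets.Basic) blast
qed simp

lemma sets_F_left: "sets (F_inf_left M F t2) = sigma_sets (space M) (\<Union>t1\<in>{0<..}. sets (F t1 t2))"
  and sets_F_right: "sets (F_inf_right M F t1) = sigma_sets (space M) (\<Union>t2\<in>{0<..}. sets (F t1 t2))"
proof -
  have "(\<Union>t1\<in>{0<..}. sets (F t1 t2)) \<subseteq> Pow (space M)" "(\<Union>t2\<in>{0<..}. sets (F t1 t2)) \<subseteq> Pow (space M)"
    using sets_F_sub sets.sets_into_space by blast+
  then show "sets (F_inf_left M F t2) = sigma_sets (space M) (\<Union>t1\<in>{0<..}. sets (F t1 t2))"
    "sets (F_inf_right M F t1) = sigma_sets (space M) (\<Union>t2\<in>{0<..}. sets (F t1 t2))"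
    unfolding F_inf_left_def F_inf_right_def by (simp_all add: sets_measure_of)
qed

lemma sets_F_left_sub: "sets (F_inf_left M F t2) \<subseteq> events" "sets (F_inf_right M F t1) \<subseteq> events"
  unfolding sets_F_left sets_F_right by (rule sets.sigma_sets_subset, use sets_F_sub in blast)+

lemma sets_FS: "sets (FS s1 s2) = sigma_sets (space M) (sets (F_inf_left M F s2) \<union> sets (F_inf_right M F s1))"
  and space_FS: "space (FS s1 s2) = space M"
proof -
  have "sets (F_inf_left M F s2) \<union> sets (F_inf_right M F s1) \<subseteq> Pow (space M)"
    using sets_F_left_sub sets.sets_into_space by blast
  then show "sets (FS s1 s2) = sigma_sets (space M) (sets (F_inf_left M F s2) \<union> sets (F_inf_right M F s1))"
    "space (FS s1 s2) = space M"
    unfolding FS_def F_star_def sigma_join_def by (simp_all add: sets_measure_of space_measure_of)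
qed

lemma subalgebra_FS: "subalgebra M (FS s1 s2)"
  unfolding subalgebra_def space_FS sets_FS
  using sets.sigma_sets_subset[of "sets (F_inf_left M F s2) \<union> sets (F_inf_right M F s1)" M] sets_F_left_sub by blast

lemma F_left_FS: "0 < t1 \<Longrightarrow> sets (F t1 s2) \<subseteq> sets (FS s1 s2)"
  unfolding sets_FS sets_F_left by (intro subsetI sigma_sets.Basic UnI1) blast

lemma F_right_FS: "0 < t2 \<Longrightarrow> sets (F s1 t2) \<subseteq> sets (FS s1 s2)"
  unfolding sets_FS sets_F_right by (intro subsetI sigma_sets.Basic UnI2) blast

lemma G_FS: "sets G \<subseteq> sets (FS s1 s2)"
proof -
  have "sets G \<subseteq> sets (F 1 s2)" unfolding sets_F by (intro subsetI sigma_sets.Basic) blast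
  then show ?thesis using F_left_FS[of 1 s2 s1] by simp
qed

lemma count_field_FS:
  assumes "(u1, u2) \<in> past s1 s2"
  shows "count_field X u1 u2 \<in> borel_measurable (FS s1 s2)"
proof -
  have u: "0 \<le> u1" "0 \<le> u2" "u1 \<le> s1 \<or> u2 \<le> s2" using assms by (auto simp: past_def)
  show ?thesis
  proof (cases "u2 \<le> s2")
    case True
    \<comment> \<open>The maximum with 1 is taken because \<open>F_inf_left\<close> ranges over
      strictly positive times only.\<close>
    have "count_field X u1 u2 \<in> borel_measurable (F (max u1 1) s2)" using u True by (intro count_field_F) auto
    then show ?thesis
      by (rule measurable_from_subalg[rotated]) (use F_left_FS[of "max u1 1" s2 s1] in \<open>simp add: subalgebra_def space_F space_FS\<close>)
  next
    case False
    have "count_field X u1 u2 \<in> borel_measurable (F s1 (max u2 1))" using u False by (intro count_field_F) auto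
    then show ?thesis
      by (rule measurable_from_subalg[rotated]) (use F_right_FS[of "max u2 1" s1 s2] in \<open>simp add: subalgebra_def space_F space_FS\<close>)
  qed
qed

text \<open>Puts \<open>FS\<close> into the shape required by \<open>counting_sigma_induct\<close>:
  events of G together with counts in rectangles that avoid the future increment.\<close>

lemma FS_generated:
  "sets (FS s1 s2) \<subseteq> sigma_sets (space M) (sets G \<union> {(\<lambda>\<omega>. measure (ext X \<omega>) ({0..fst p} \<times> {0..snd p})) -` A \<inter> space M | p A. p \<in> past s1 s2 \<and> A \<in> sets borel})"
  (is "_ \<subseteq> ?H")
proof -
  have cf: "count_field X (fst p) (snd p) -` A \<inter> space M = (\<lambda>\<omega>. measure (ext X \<omega>) ({0..fst p} \<times> {0..snd p})) -` A \<inter> space M" for p A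
    by (auto simp: count_field_ext[OF X])
  have nat: "sets (natural_filtration M X t1 t2) \<subseteq> ?H" if "t1 \<le> s1 \<or> t2 \<le> s2" for t1 t2
    unfolding sets_natural cf
  proof (rule sigma_sets_mono', rule subsetI)
    fix E assume "E \<in> {(\<lambda>\<omega>. measure (ext X \<omega>) ({0..fst p} \<times> {0..snd p})) -` A \<inter> space M |p A. p \<in> {0..t1} \<times> {0..t2} \<and> A \<in> sets borel}"
    then obtain p A where "E = (\<lambda>\<omega>. measure (ext X \<omega>) ({0..fst p} \<times> {0..snd p})) -` A \<inter> space M" "p \<in> {0..t1} \<times> {0..t2}" "A \<in> sets borel"
      by blast
    moreover from this have "p \<in> past s1 s2" using that by (auto simp: past_def)
    ultimately show "E \<in> sets G \<union> {(\<lambda>\<omega>. measure (ext X \<omega>) ({0..fst p} \<times> {0..snd p})) -` A \<inter> space M | p A. p \<in> past s1 s2 \<and> A \<in> sets borel}"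
      by blast
  qed
  have F: "sets (F t1 t2) \<subseteq> ?H" if "t1 \<le> s1 \<or> t2 \<le> s2" for t1 t2
    unfolding sets_F using nat[OF that] by (intro sigma_sets_mono) auto
  have "sets (F_inf_left M F s2) \<subseteq> ?H" "sets (F_inf_right M F s1) \<subseteq> ?H"
    unfolding sets_F_left sets_F_right by (intro sigma_sets_mono UN_least F; simp)+
  then show ?thesis unfolding sets_FS by (intro sigma_sets_mono) auto
qed

lemma box2_quadrant: "0 \<le> a \<Longrightarrow> 0 \<le> c \<Longrightarrow> box2 a b c d \<subseteq> quadrant"
  by (auto simp: box2_def quadrant_def)

text \<open>One proceeds along the cells in an order for which all earlier cells belong to the past
  \<open>F\<^sup>*\<close> of the current one; maximising the sum of the two indices selects a last cell.\<close>

lemma star_cells: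
  assumes V\<mu>: "AE \<omega> in M. \<forall>B. B \<in> sets borel \<longrightarrow> B \<subseteq> quadrant \<longrightarrow> lam * measure (\<mu> \<omega>) B = measure (V \<omega>) B"
    and star: "doubly_stochastic_poisson_star M F lam \<mu> X"
    and I: "finite I"
  shows "cond_poisson M G I (\<lambda>c \<omega>. measure (ext X \<omega>) (idx n -` {c})) (\<lambda>c \<omega>. measure (V \<omega>) (idx n -` {c}))"
  using I
proof (induction "card I" arbitrary: I)
  case 0
  then show ?case by (simp add: cond_poisson_def count_ind_def poisson_prod_def)
next
  case (Suc m)
  let ?Z = "\<lambda>c \<omega>. measure (ext X \<omega>) (idx n -` {c})" and ?V = "\<lambda>c \<omega>. measure (V \<omega>) (idx n -` {c})"
  have "I \<noteq> {}" using Suc.hyps(2) by auto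
  then have ne: "(\<lambda>c. fst c + snd c) ` I \<noteq> {}" by simp
  obtain c where c: "c \<in> I" "fst c + snd c = Max ((\<lambda>c. fst c + snd c) ` I)"
    using Max_in[OF finite_imageI[OF Suc.prems] ne] by (metis (no_types, lifting) imageE)
  define I' where "I' = I - {c}"
  have I': "finite I'" "c \<notin> I'" "I = insert c I'" using Suc.prems c(1) by (auto simp: I'_def)
  have IH: "cond_poisson M G I' ?Z ?V"
    using Suc.hyps(2) I' by (intro Suc.hyps(1)) auto
  have mZ: "?Z c' \<in> borel_measurable M" for c'
    by (intro lf_kernel_measurable XV.Z bounded_cell idx_vimage_borel)
  have mV: "?V c' \<in> borel_measurable G" for c'
    by (intro lf_kernel_measurable V_lf bounded_cell idx_vimage_borel)
  have mVM: "?V c' \<in> borel_measurable M" for c' by (rule G_measurable[OF mV])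
  define a where "a = (real_of_int (fst c) - 1) / 2 ^ n"
  define b where "b = real_of_int (fst c) / 2 ^ n"
  define a' where "a' = (real_of_int (snd c) - 1) / 2 ^ n"
  define b' where "b' = real_of_int (snd c) / 2 ^ n"
  have cell: "idx n -` {c} = box2 a b a' b'" unfolding cell_box2 a_def b_def a'_def b'_def ..
  have le: "a \<le> b" "a' \<le> b'" unfolding a_def b_def a'_def b'_def by (rule cell_le)+
  have step: "(\<integral>\<omega>. indicator A \<omega> * count_ind I' ?Z x \<omega> * indicator {real (x c)} (?Z c \<omega>) \<partial>M)
      = (\<integral>\<omega>. indicator A \<omega> * count_ind I' ?Z x \<omega> * poisson_weight (?V c \<omega>) (x c) \<partial>M)" if A: "A \<in> sets G" for A x
  proof (cases "fst c \<le> 0 \<or> snd c \<le> 0")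
    case True
    \<comment> \<open>A cell with a nonpositive index meets the quadrant at most in an axis. Its
      mean is 0 because the paths are nonpositive up to time 0, and its count is 0 by the clause on
      the axes.\<close>
    then have neg: "b \<le> 0 \<or> b' \<le> 0" by (auto simp: b_def b'_def divide_le_0_iff)
    have lt: "a < b" "a' < b'" by (simp_all add: a_def b_def a'_def b'_def divide_strict_right_mono)
    have V0: "?V c \<omega> = 0" for \<omega>
      using neg lt reg_pathD(3)[OF reg1, of _ \<omega>] reg_pathD(3)[OF reg2, of _ \<omega>]
      by (auto simp: cell V_box2[OF le])
    have "AE \<omega> in M. \<forall>t\<ge>0. count_field X t 0 \<omega> = 0 \<and> count_field X 0 t \<omega> = 0"
      using star unfolding doubly_stochastic_poisson_star_def by (elim conjE)
    then have Z0: "AE \<omega> in M. ?Z c \<omega> = 0"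
      using AE_space
    proof eventually_elim
      case (elim \<omega>)
      have z: "count0 X u v \<omega> = 0" if "u \<le> 0 \<or> v \<le> 0" for u v
        using elim(1) that by (cases "u = 0 \<or> v = 0") (auto simp: count0_def)
      show ?case using neg lt by (auto simp: cell measure_ext_box2[OF X elim(2) le] z)
    qed
    show ?thesis
    proof (rule integral_cong_AE)
      show "AE \<omega> in M. indicator A \<omega> * count_ind I' ?Z x \<omega> * indicator {real (x c)} (?Z c \<omega>)
          = indicator A \<omega> * count_ind I' ?Z x \<omega> * poisson_weight (?V c \<omega>) (x c)"
        using Z0 by eventually_elim (simp add: V0 poisson_weight_0)
    qed (use mZ mVM G_sets[OF A] in \<open>auto intro!: borel_measurable_times borel_measurable_indicator count_ind_measurable
        measurable_compose[OF mZ] measurable_compose[OF mVM poisson_weight_measurable]\<close>)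
  next
    case False
    then have pos: "0 \<le> a" "0 \<le> a'" by (auto simp: a_def a'_def)
    interpret FS: finite_measure_subalgebra M "FS a a'"
      by unfold_locales (rule subalgebra_FS)
    have c0: "count0 X u1 u2 \<in> borel_measurable (FS a a')" if "u1 \<le> a \<or> u2 \<le> a'" for u1 u2
      by (rule count0_measurable[where P = "\<lambda>u1 u2. u1 \<le> a \<or> u2 \<le> a'", OF count_field_FS that]) (simp add: past_def)
    have ZF: "?Z c' \<in> borel_measurable (FS a a')" if c': "c' \<in> I'" for c'
    proof -
      have "fst c' + snd c' \<le> fst c + snd c"
        unfolding c(2) using c' I' Suc.prems by (intro Max_ge) auto
      moreover have "c' \<noteq> c" using c' I' by blast
      \<comment> \<open>A different cell with no larger index sum must have a strictly smaller index
        in one coordinate, so it ends before the cell \<open>c\<close> begins there.\<close>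
      ultimately have "fst c' \<le> fst c - 1 \<or> snd c' \<le> snd c - 1"
        by (cases c; cases c') auto
      then have "real_of_int (fst c') \<le> real_of_int (fst c) - 1 \<or> real_of_int (snd c') \<le> real_of_int (snd c) - 1"
        by linarith
      then have "real_of_int (fst c') / 2 ^ n \<le> a \<or> real_of_int (snd c') / 2 ^ n \<le> a'"
        unfolding a_def a'_def by (auto intro: divide_right_mono)
      then have up: "u1 \<le> a \<or> u2 \<le> a'" if "u1 \<le> real_of_int (fst c') / 2 ^ n" "u2 \<le> real_of_int (snd c') / 2 ^ n" for u1 u2
        using that by linarith
      show ?thesis
        unfolding cell_box2[of n c']
        by (intro ext_box2_measurable[OF X space_FS] cell_le c0 up order_refl)
    qed
    \<comment> \<open>The event of G and the values of the earlier cells form one event of the past,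
      against which the conditional law of the increment can be integrated.\<close>
    define E where "E = A \<inter> {\<omega> \<in> space M. \<forall>c'\<in>I'. ?Z c' \<omega> = real (x c')}"
    have "{\<omega> \<in> space (FS a a'). \<forall>c'\<in>I'. ?Z c' \<omega> = real (x c')} \<in> sets (FS a a')"
      by (intro sets.sets_Collect_finite_All borel_measurable_eq ZF I') auto
    then have E: "E \<in> sets (FS a a')"
      unfolding E_def space_FS using A G_FS by (intro sets.Int) auto
    have indE: "indicator A \<omega> * count_ind I' ?Z x \<omega> = indicator E \<omega>" if "\<omega> \<in> space M" for \<omega>
      using that I' by (simp add: E_def count_ind_eq_indicator indicator_def)
    let ?D = "{\<omega> \<in> space M. increment X a a' b b' \<omega> = real (x c)}"
    have D: "?D = {\<omega> \<in> space M. ?Z c \<omega> = real (x c)}"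
      using increment_eq[OF X _ pos(1) le(1) pos(2) le(2)] by (auto simp: cell)
    have Dm: "?D \<in> events" unfolding D using mZ[of c] by measurable
    have "\<forall>s1\<ge>0. \<forall>s2\<ge>0. \<forall>t1\<ge>s1. \<forall>t2\<ge>s2. \<forall>k. AE \<omega> in M.
        cprob M (F_star M F s1 s2) {\<omega>' \<in> space M. increment X s1 s2 t1 t2 \<omega>' = real k} \<omega> =
          poisson_weight (lam * measure (\<mu> \<omega>) ({s1<..t1} \<times> {s2<..t2})) k"
      using star unfolding doubly_stochastic_poisson_star_def by (elim conjE)
    note inc = this[rule_format, OF pos le, of "x c"]
    have cp: "AE \<omega> in M. real_cond_exp M (FS a a') (indicator ?D) \<omega> = poisson_weight (lam * measure (\<mu> \<omega>) (box2 a b a' b')) (x c)"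
      unfolding FS_def box2_def by (rule inc[unfolded cprob_def])
    have cp': "AE \<omega> in M. real_cond_exp M (FS a a') (indicator ?D) \<omega> = poisson_weight (?V c \<omega>) (x c)"
      using cp V\<mu>
    proof eventually_elim
      case (elim \<omega>)
      have "lam * measure (\<mu> \<omega>) (box2 a b a' b') = measure (V \<omega>) (box2 a b a' b')"
        by (rule elim(2)[rule_format, OF box2_borel box2_quadrant[OF pos]])
      then show ?case using elim(1) by (simp only: cell)
    qed
    have EM: "E \<in> events" using E subalgebra_FS unfolding subalgebra_def by blast
    have "(\<integral>\<omega>. indicator A \<omega> * count_ind I' ?Z x \<omega> * indicator {real (x c)} (?Z c \<omega>) \<partial>M)
        = (\<integral>\<omega>. indicator E \<omega> * indicator ?D \<omega> \<partial>M)"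
      by (rule Bochner_Integration.integral_cong[OF refl], subst indE) (auto simp: D indicator_def)
    also have "\<dots> = (\<integral>\<omega>. indicator E \<omega> * real_cond_exp M (FS a a') (indicator ?D) \<omega> \<partial>M)"
      using FS.real_cond_exp_intA[of "indicator ?D" E] E Dm
      by (simp add: set_lebesgue_integral_def emeasure_eq_measure)
    also have "\<dots> = (\<integral>\<omega>. indicator A \<omega> * count_ind I' ?Z x \<omega> * poisson_weight (?V c \<omega>) (x c) \<partial>M)"
    proof (rule integral_cong_AE)
      show "AE \<omega> in M. indicator E \<omega> * real_cond_exp M (FS a a') (indicator ?D) \<omega>
          = indicator A \<omega> * count_ind I' ?Z x \<omega> * poisson_weight (?V c \<omega>) (x c)"
        using cp' AE_space by eventually_elim (simp only: indE)
      show "(\<lambda>\<omega>. indicator E \<omega> * real_cond_exp M (FS a a') (indicator ?D) \<omega>) \<in> borel_measurable M"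
        using EM by (intro borel_measurable_times borel_measurable_indicator borel_measurable_cond_exp2)
      show "(\<lambda>\<omega>. indicator A \<omega> * count_ind I' ?Z x \<omega> * poisson_weight (?V c \<omega>) (x c)) \<in> borel_measurable M"
        by (intro borel_measurable_times borel_measurable_indicator G_sets[OF A] count_ind_measurable mZ
            measurable_compose[OF mVM poisson_weight_measurable])
    qed
    finally show ?thesis .
  qed
  show ?case
    unfolding cond_poisson_def
  proof (intro ballI allI)
    fix A and x :: "int \<times> int \<Rightarrow> nat" assume A: "A \<in> sets G"
    have "(\<integral>\<omega>. indicator A \<omega> * count_ind I ?Z x \<omega> \<partial>M)
        = (\<integral>\<omega>. indicator A \<omega> * count_ind I' ?Z x \<omega> * indicator {real (x c)} (?Z c \<omega>) \<partial>M)"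
      unfolding I'(3) count_ind_def by (simp only: prod.insert[OF I'(1,2)] mult_ac)
    also have "\<dots> = (\<integral>\<omega>. (indicator A \<omega> * poisson_weight (?V c \<omega>) (x c)) * count_ind I' ?Z x \<omega> \<partial>M)"
      unfolding step[OF A] by (simp only: mult_ac)
    \<comment> \<open>The weight of the last cell is measurable for G, so the induction hypothesis
      applies in its weighted form.\<close>
    also have "\<dots> = (\<integral>\<omega>. (indicator A \<omega> * poisson_weight (?V c \<omega>) (x c)) * poisson_prod I' ?V x \<omega> \<partial>M)"
    proof (rule cond_poisson_weighted[OF IH mZ mV measure_nonneg])
      show "(\<lambda>\<omega>. indicator A \<omega> * poisson_weight (?V c \<omega>) (x c)) \<in> borel_measurable G"
        by (intro borel_measurable_times borel_measurable_indicator A measurable_compose[OF mV poisson_weight_measurable])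
      show "0 \<le> indicator A \<omega> * poisson_weight (?V c \<omega>) (x c)" for \<omega>
        by (intro mult_nonneg_nonneg poisson_weight_nonneg measure_nonneg) simp
      show "indicator A \<omega> * poisson_weight (?V c \<omega>) (x c) \<le> 1" for \<omega>
        by (intro mult_le_one poisson_weight_nonneg poisson_weight_le_1 measure_nonneg) (simp add: indicator_def)
    qed
    also have "\<dots> = (\<integral>\<omega>. indicator A \<omega> * poisson_prod I ?V x \<omega> \<partial>M)"
      unfolding I'(3) poisson_prod_def by (simp only: prod.insert[OF I'(1,2)] mult_ac)
    finally show "(\<integral>\<omega>. indicator A \<omega> * count_ind I ?Z x \<omega> \<partial>M) = (\<integral>\<omega>. indicator A \<omega> * poisson_prod I ?V x \<omega> \<partial>M)" .
  qed
qed

lemma star_imp_cond_poisson: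
  assumes "AE \<omega> in M. \<forall>B. B \<in> sets borel \<longrightarrow> B \<subseteq> quadrant \<longrightarrow> lam * measure (\<mu> \<omega>) B = measure (V \<omega>) B"
    and "doubly_stochastic_poisson_star M F lam \<mu> X"
  shows "cond_poisson_borel (ext X) V"
  by (rule XV.cells_imp_cond_poisson_borel[OF X_Nats star_cells[OF assms]])

section \<open>The conditional law of an increment given \<open>FS\<close>\<close>

text \<open>It suffices to test events that prescribe counts on disjoint sets missing the increment
  rectangle \<open>W\<close>. Then \<open>W\<close> is one more disjoint set, and its Poisson factor
  separates from the counts because it is measurable for G.\<close>

lemma past_integral:
  assumes cp: "cond_poisson_borel (ext X) V" and s: "0 \<le> s1" "0 \<le> s2" "s1 \<le> t1" "s2 \<le> t2"
    and E: "E \<in> sets (FS s1 s2)"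
  shows "(\<integral>\<omega>. indicator E \<omega> * indicator {real k} (measure (ext X \<omega>) (box2 s1 t1 s2 t2)) \<partial>M)
    = (\<integral>\<omega>. indicator E \<omega> * poisson_weight (measure (V \<omega>) (box2 s1 t1 s2 t2)) k \<partial>M)"
proof -
  define W where "W = box2 s1 t1 s2 t2"
  define f where "f \<omega> = (indicator {real k} (measure (ext X \<omega>) W) :: real)" for \<omega>
  define g where "g \<omega> = poisson_weight (measure (V \<omega>) W) k" for \<omega>
  have W: "W \<in> sets borel" "bounded W" by (simp_all add: W_def bounded_box2)
  have mZ: "(\<lambda>\<omega>. measure (ext X \<omega>) B) \<in> borel_measurable M" if "B \<in> sets borel" "bounded B" for B
    using that by (intro lf_kernel_measurable XV.Z)
  have mV: "(\<lambda>\<omega>. measure (V \<omega>) B) \<in> borel_measurable G" if "B \<in> sets borel" "bounded B" for B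
    using that by (intro lf_kernel_measurable V_lf)
  have gG: "g \<in> borel_measurable G"
    unfolding g_def[abs_def] by (rule measurable_compose[OF mV[OF W] poisson_weight_measurable])
  have [measurable]: "f \<in> borel_measurable M" "g \<in> borel_measurable M"
    using mZ[OF W] G_measurable[OF gG] unfolding f_def[abs_def] by measurable
  have fb: "0 \<le> f \<omega>" "f \<omega> \<le> 1" and gb: "0 \<le> g \<omega>" "g \<omega> \<le> 1" for \<omega>
    by (simp_all add: f_def g_def indicator_def poisson_weight_nonneg poisson_weight_le_1)
  define \<Phi> where "\<Phi> E \<longleftrightarrow> (\<integral>\<omega>. indicator E \<omega> * f \<omega> \<partial>M) = (\<integral>\<omega>. indicator E \<omega> * g \<omega> \<partial>M)" for E
  have int: "integrable M (\<lambda>\<omega>. indicator E \<omega> * f \<omega>)" "integrable M (\<lambda>\<omega>. indicator E \<omega> * g \<omega>)" if "E \<in> events" for E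
    using that fb gb by (auto intro!: integrable_unit mult_le_one)
  have base: "\<Phi> (A \<inter> {\<omega> \<in> space M. \<forall>i<n. measure (ext X \<omega>) (B i) = real (x i)})"
    if A: "A \<in> sets G" and B: "\<And>i. i < n \<Longrightarrow> B i \<in> sets borel" "\<And>i. i < n \<Longrightarrow> bounded (B i)" "\<And>i. i < n \<Longrightarrow> B i \<inter> W = {}"
      "disjoint_family_on B {..<n}" for A n and B :: "nat \<Rightarrow> (real \<times> real) set" and x :: "nat \<Rightarrow> nat"
  proof -
    \<comment> \<open>The rectangle \<open>W\<close> is appended as the last set, with index
      \<open>n\<close> and prescribed count \<open>k\<close>.\<close>
    define B' where "B' i = (if i < n then B i else W)" for i
    define x' where "x' i = (if i < n then x i else k)" for i
    have B': "B' i \<in> sets borel" "bounded (B' i)" for i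
      using B W by (auto simp: B'_def)
    have dis': "disjoint_family_on B' {..<Suc n}"
      unfolding disjoint_family_on_def
    proof (intro ballI impI)
      fix i j assume "i \<in> {..<Suc n}" "j \<in> {..<Suc n}" "i \<noteq> j"
      then consider "i < n" "j < n" | "i < n" "j = n" | "i = n" "j < n" by (auto simp: less_Suc_eq)
      then show "B' i \<inter> B' j = {}"
      proof cases
        case 1
        then show ?thesis using B(4) \<open>i \<noteq> j\<close> by (simp add: B'_def disjoint_family_on_def)
      next
        case 2
        then show ?thesis using B(3)[of i] by (simp add: B'_def)
      next
        case 3
        then show ?thesis using B(3)[of j] by (simp add: B'_def Int_commute)
      qed
    qed
    have cpS: "cond_poisson M G {..<Suc n} (\<lambda>i \<omega>. measure (ext X \<omega>) (B' i)) (\<lambda>i \<omega>. measure (V \<omega>) (B' i))"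
      by (rule cond_poisson_borelD[OF cp _ B' dis']) simp
    have cpn: "cond_poisson M G {..<n} (\<lambda>i \<omega>. measure (ext X \<omega>) (B i)) (\<lambda>i \<omega>. measure (V \<omega>) (B i))"
      by (rule cond_poisson_borelD[OF cp _ _ _ B(4)]) (use B in auto)
    let ?c = "count_ind {..<n} (\<lambda>i \<omega>. measure (ext X \<omega>) (B i)) x"
    let ?p = "poisson_prod {..<n} (\<lambda>i \<omega>. measure (V \<omega>) (B i)) x"
    have c': "count_ind {..<Suc n} (\<lambda>i \<omega>. measure (ext X \<omega>) (B' i)) x' \<omega> = ?c \<omega> * f \<omega>" for \<omega>
      unfolding count_ind_def lessThan_Suc by (simp add: B'_def x'_def f_def)
    have p': "poisson_prod {..<Suc n} (\<lambda>i \<omega>. measure (V \<omega>) (B' i)) x' \<omega> = ?p \<omega> * g \<omega>" for \<omega>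
      unfolding poisson_prod_def lessThan_Suc by (simp add: B'_def x'_def g_def)
    have ind: "indicator (A \<inter> {\<omega> \<in> space M. \<forall>i<n. measure (ext X \<omega>) (B i) = real (x i)}) \<omega> = indicator A \<omega> * ?c \<omega>"
      if "\<omega> \<in> space M" for \<omega>
      using that by (auto simp: count_ind_eq_indicator indicator_def)
    have "(\<integral>\<omega>. indicator (A \<inter> {\<omega> \<in> space M. \<forall>i<n. measure (ext X \<omega>) (B i) = real (x i)}) \<omega> * f \<omega> \<partial>M)
        = (\<integral>\<omega>. indicator A \<omega> * count_ind {..<Suc n} (\<lambda>i \<omega>. measure (ext X \<omega>) (B' i)) x' \<omega> \<partial>M)"
      by (rule Bochner_Integration.integral_cong[OF refl]) (simp only: ind c' mult.assoc)
    also have "\<dots> = (\<integral>\<omega>. indicator A \<omega> * poisson_prod {..<Suc n} (\<lambda>i \<omega>. measure (V \<omega>) (B' i)) x' \<omega> \<partial>M)"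
      using cpS A unfolding cond_poisson_def by blast
    also have "\<dots> = (\<integral>\<omega>. (indicator A \<omega> * g \<omega>) * ?p \<omega> \<partial>M)"
      by (simp only: p' mult_ac)
    \<comment> \<open>The joint law of the sets \<open>B i\<close> alone, now with the weight
      \<open>g\<close>, is read backwards to turn their Poisson weights into counts again.\<close>
    also have "\<dots> = (\<integral>\<omega>. (indicator A \<omega> * g \<omega>) * ?c \<omega> \<partial>M)"
    proof (rule cond_poisson_weighted[OF cpn, symmetric])
      show "(\<lambda>\<omega>. measure (ext X \<omega>) (B i)) \<in> borel_measurable M" "(\<lambda>\<omega>. measure (V \<omega>) (B i)) \<in> borel_measurable G" if "i \<in> {..<n}" for i
        using that B by (intro mZ mV; simp)+
      show "(\<lambda>\<omega>. indicator A \<omega> * g \<omega>) \<in> borel_measurable G"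
        by (intro borel_measurable_times borel_measurable_indicator A gG)
      show "0 \<le> indicator A \<omega> * g \<omega>" "indicator A \<omega> * g \<omega> \<le> 1" for \<omega>
        using gb[of \<omega>] by (auto simp: indicator_def)
    qed simp
    also have "\<dots> = (\<integral>\<omega>. indicator (A \<inter> {\<omega> \<in> space M. \<forall>i<n. measure (ext X \<omega>) (B i) = real (x i)}) \<omega> * g \<omega> \<partial>M)"
      by (rule Bochner_Integration.integral_cong[OF refl]) (simp only: ind mult_ac)
    finally show ?thesis by (simp only: \<Phi>_def)
  qed
  have "\<Phi> E"
  proof (rule counting_sigma_induct[OF X, where ?G0.0 = "sets G" and Q = "past s1 s2" and W = W
        and R = "\<lambda>p. {0..fst p} \<times> {0..snd p}"])
    show "Int_stable (sets G)" by (rule sets.Int_stable)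
    show "sets G \<subseteq> events" using G_sets by blast
    show "space M \<in> sets G" using sets.top[of G] G_space by simp
    show "{0..fst p} \<times> {0..snd p} \<in> sets borel" "bounded ({0..fst p} \<times> {0..snd p})" for p :: "real \<times> real"
      using bounded_borel_setsD[OF Icc_Times_bounded_borel] by auto
    show "({0..fst p} \<times> {0..snd p}) \<inter> W = {}" if "p \<in> past s1 s2" for p
      using that by (auto simp: past_def W_def box2_def)
    show "E \<in> sigma_sets (space M) (sets G \<union> {(\<lambda>\<omega>. measure (ext X \<omega>) ({0..fst p} \<times> {0..snd p})) -` C \<inter> space M | p C. p \<in> past s1 s2 \<and> C \<in> sets borel})"
      using FS_generated E by blast
    show "\<Phi> {}" by (simp add: \<Phi>_def)
  next
    fix A n B and x :: "nat \<Rightarrow> nat"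
    assume "A \<in> sets G" "\<And>i. i < n \<Longrightarrow> B i \<in> sets borel" "\<And>i. i < n \<Longrightarrow> bounded (B i)" "\<And>i. i < n \<Longrightarrow> B i \<inter> W = {}"
      "disjoint_family_on B {..<n::nat}"
    then show "\<Phi> (A \<inter> {\<omega> \<in> space M. \<forall>i<n. measure (ext X \<omega>) (B i) = real (x i)})" by (rule base)
  next
    fix E assume E: "E \<in> events" "\<Phi> E"
    \<comment> \<open>Complements need the identity for the whole space, which is the case of no
      prescribed counts.\<close>
    have tot: "\<Phi> (space M)"
      using base[of "space M" 0 "\<lambda>_. {}" "\<lambda>_. 0"] sets.top[of G] G_space by (simp add: disjoint_family_on_def)
    have split: "indicator (space M - E) \<omega> * h = indicator (space M) \<omega> * h - indicator E \<omega> * (h::real)" for \<omega> h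
      using sets.sets_into_space[OF E(1)] by (auto simp: indicator_def)
    show "\<Phi> (space M - E)"
      unfolding \<Phi>_def split
      using E tot int[OF E(1)] int[OF sets.top] by (simp only: Bochner_Integration.integral_diff \<Phi>_def)
  next
    fix E :: "nat \<Rightarrow> 'a set"
    assume E: "range E \<subseteq> events" "disjoint_family E" "\<And>i. \<Phi> (E i)"
    have lim: "(\<lambda>n. \<integral>\<omega>. (\<Sum>i<n. indicator (E i) \<omega> * h \<omega>) \<partial>M) \<longlonglongrightarrow> (\<integral>\<omega>. indicator (\<Union>i. E i) \<omega> * h \<omega> \<partial>M)"
      if [measurable]: "h \<in> borel_measurable M" and hb: "\<And>\<omega>. 0 \<le> h \<omega>" "\<And>\<omega>. h \<omega> \<le> (1::real)" for h
    proof (rule integral_dominated_convergence[where w = "\<lambda>_. 1"])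
      have [measurable]: "E i \<in> events" for i using E(1) by blast
      show "(\<lambda>\<omega>. \<Sum>i<n. indicator (E i) \<omega> * h \<omega>) \<in> borel_measurable M" for n by measurable
      show "(\<lambda>\<omega>. indicator (\<Union>i. E i) \<omega> * h \<omega>) \<in> borel_measurable M" by measurable
      have eq: "(\<Sum>i<n. indicator (E i) \<omega> * h \<omega>) = indicator (\<Union>i<n. E i) \<omega> * h \<omega>" for n \<omega>
      proof -
        have "(\<Sum>i<n. indicator (E i) \<omega> :: real) = indicator (\<Union>i<n. E i) \<omega>"
          by (rule indicator_UN_disjoint[symmetric]) (use E(2) in \<open>auto simp: disjoint_family_on_def\<close>)
        then show ?thesis by (simp only: sum_distrib_right[symmetric])
      qed
      show "AE \<omega> in M. (\<lambda>n. \<Sum>i<n. indicator (E i) \<omega> * h \<omega>) \<longlonglongrightarrow> indicator (\<Union>i. E i) \<omega> * h \<omega>"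
        unfolding eq by (intro AE_I2 tendsto_mult LIMSEQ_indicator_UN tendsto_const)
      show "AE \<omega> in M. norm (\<Sum>i<n. indicator (E i) \<omega> * h \<omega>) \<le> 1" for n
        unfolding eq using hb by (intro AE_I2) (auto simp: indicator_def)
    qed simp
    have "(\<integral>\<omega>. (\<Sum>i<n. indicator (E i) \<omega> * f \<omega>) \<partial>M) = (\<integral>\<omega>. (\<Sum>i<n. indicator (E i) \<omega> * g \<omega>) \<partial>M)" for n
    proof -
      have Ei: "E i \<in> events" for i using E(1) by blast
      show ?thesis
        unfolding Bochner_Integration.integral_sum[OF int(1)[OF Ei]] Bochner_Integration.integral_sum[OF int(2)[OF Ei]]
        using E(3) by (intro sum.cong) (simp_all only: \<Phi>_def)
    qed
    then show "\<Phi> (\<Union>i. E i)"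
      unfolding \<Phi>_def using lim[of f] lim[of g] fb gb by (auto intro: LIMSEQ_unique)
  qed
  then show ?thesis by (simp only: \<Phi>_def f_def g_def W_def)
qed

text \<open>\<open>past_integral\<close> identifies the conditional probability, since the Poisson
  weight is measurable for G and hence for \<open>FS\<close>. The clause on the axes holds because
  the intensity does not charge them.\<close>

lemma cond_poisson_imp_star:
  assumes V\<mu>: "AE \<omega> in M. \<forall>B. B \<in> sets borel \<longrightarrow> B \<subseteq> quadrant \<longrightarrow> lam * measure (\<mu> \<omega>) B = measure (V \<omega>) B"
    and cp: "cond_poisson_borel (ext X) V"
  shows "doubly_stochastic_poisson_star M F lam \<mu> X"
  unfolding doubly_stochastic_poisson_star_def
proof (intro conjI allI impI filtration_F)
  show "count_field X t1 t2 \<in> borel_measurable (F t1 t2)" if "0 \<le> t1" "0 \<le> t2" for t1 t2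
    using that by (intro count_field_F) auto
next
  fix s1 s2 t1 t2 :: real and k :: nat
  assume s: "0 \<le> s1" "0 \<le> s2" "s1 \<le> t1" "s2 \<le> t2"
  let ?D = "{\<omega> \<in> space M. increment X s1 s2 t1 t2 \<omega> = real k}"
  let ?Z = "\<lambda>\<omega>. measure (ext X \<omega>) (box2 s1 t1 s2 t2)" and ?g = "\<lambda>\<omega>. poisson_weight (measure (V \<omega>) (box2 s1 t1 s2 t2)) k"
  interpret FS: finite_measure_subalgebra M "FS s1 s2"
    by unfold_locales (rule subalgebra_FS)
  have mZ: "?Z \<in> borel_measurable M"
    by (intro lf_kernel_measurable XV.Z bounded_box2 box2_borel)
  have mV: "(\<lambda>\<omega>. measure (V \<omega>) (box2 s1 t1 s2 t2)) \<in> borel_measurable G"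
    by (intro lf_kernel_measurable V_lf bounded_box2 box2_borel)
  have gG: "?g \<in> borel_measurable G"
    by (rule measurable_compose[OF mV poisson_weight_measurable])
  have D: "?D = {\<omega> \<in> space M. ?Z \<omega> = real k}"
    using increment_eq[OF X _ s(1,3,2,4)] by auto
  have Dm: "?D \<in> events" unfolding D using mZ by measurable
  have ce: "AE \<omega> in M. real_cond_exp M (FS s1 s2) (indicator ?D) \<omega> = ?g \<omega>"
  proof (rule FS.real_cond_exp_charact)
    fix E assume E: "E \<in> sets (FS s1 s2)"
    have "(\<integral>\<omega>\<in>E. (indicator ?D \<omega> :: real) \<partial>M) = (\<integral>\<omega>. indicator E \<omega> * indicator {real k} (?Z \<omega>) \<partial>M)"
      unfolding set_lebesgue_integral_def by (rule Bochner_Integration.integral_cong) (auto simp: D indicator_def)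
    also have "\<dots> = (\<integral>\<omega>\<in>E. ?g \<omega> \<partial>M)"
      unfolding set_lebesgue_integral_def real_scaleR_def by (rule past_integral[OF cp s E])
    finally show "(\<integral>\<omega>\<in>E. (indicator ?D \<omega> :: real) \<partial>M) = (\<integral>\<omega>\<in>E. ?g \<omega> \<partial>M)" .
  next
    show "integrable M (indicator ?D :: 'a \<Rightarrow> real)" using Dm by (simp add: emeasure_eq_measure)
    show "integrable M ?g"
      by (rule integrable_unit[OF G_measurable[OF gG]]) (simp_all add: poisson_weight_nonneg poisson_weight_le_1)
    show "?g \<in> borel_measurable (FS s1 s2)"
      using gG by (rule measurable_from_subalg[rotated]) (use G_FS G_space space_FS in \<open>auto simp: subalgebra_def\<close>)
  qed
  show "AE \<omega> in M. cprob M (F_star M F s1 s2) ?D \<omega> = poisson_weight (lam * measure (\<mu> \<omega>) ({s1<..t1} \<times> {s2<..t2})) k"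
    using ce V\<mu>
  proof eventually_elim
    case (elim \<omega>)
    have "lam * measure (\<mu> \<omega>) (box2 s1 t1 s2 t2) = measure (V \<omega>) (box2 s1 t1 s2 t2)"
      by (rule elim(2)[rule_format, OF box2_borel box2_quadrant[OF s(1,2)]])
    then show ?case using elim(1) by (simp only: cprob_def FS_def box2_def)
  qed
next
  \<comment> \<open>Countably many segments cover both axes, so one null set serves all times
    \<open>t\<close>.\<close>
  have "AE \<omega> in M. measure (ext X \<omega>) (Pair \<omega> -` (space G \<times> ({0..real n} \<times> {0..0}))) = 0"
    "AE \<omega> in M. measure (ext X \<omega>) (Pair \<omega> -` (space G \<times> ({0..0} \<times> {0..real n}))) = 0" for n :: nat
  proof -
    have B: "{0..a} \<times> {0..b} \<in> sets borel" "bounded ({0..a} \<times> {0..b})" for a b :: real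
      using bounded_borel_setsD[OF Icc_Times_bounded_borel] by auto
    have sec: "Pair \<omega> -` (space G \<times> B) = B" if "\<omega> \<in> space M" for \<omega> B
      using that by (auto simp: G_space)
    have null: "measure (V \<omega>) ({0..a} \<times> {0..b}) = 0" if "a \<le> 0 \<or> b \<le> 0" for a b \<omega>
    proof -
      let ?s = "stieltjes2 (\<lambda>t. y1 t \<omega>) (\<lambda>t. y2 t \<omega>)"
      have n: "{..0} \<times> UNIV \<in> null_sets ?s" "UNIV \<times> {..0} \<in> null_sets ?s"
        using stieltjes2_null[OF reg1 reg2, of "{..0}"] stieltjes_nonpos[OF reg1] stieltjes_nonpos[OF reg2] by auto
      have "{0..a} \<times> {0..b} \<in> null_sets ?s"
        by (rule null_sets_subset[OF null_sets.Un[OF n]]) (use that B in auto)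
      then show ?thesis by (simp add: measure_V measure_eq_0_null_sets)
    qed
    have axis: "AE \<omega> in M. measure (ext X \<omega>) (Pair \<omega> -` (space G \<times> ({0..a} \<times> {0..b}))) = 0" if "a \<le> 0 \<or> b \<le> 0" for a b
      by (rule null_random_set[OF cp]) (use B null[OF that] in \<open>auto simp only: sec intro!: pair_measureI sets.top\<close>)
    show "AE \<omega> in M. measure (ext X \<omega>) (Pair \<omega> -` (space G \<times> ({0..real n} \<times> {0..0}))) = 0"
      "AE \<omega> in M. measure (ext X \<omega>) (Pair \<omega> -` (space G \<times> ({0..0} \<times> {0..real n}))) = 0"
      by (rule axis, simp)+
  qed
  then have "AE \<omega> in M. \<forall>n. measure (ext X \<omega>) (Pair \<omega> -` (space G \<times> ({0..real n} \<times> {0..0}))) = 0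
      \<and> measure (ext X \<omega>) (Pair \<omega> -` (space G \<times> ({0..0} \<times> {0..real n}))) = 0"
    by (simp only: AE_all_countable AE_conj_iff simp_thms)
  then show "AE \<omega> in M. \<forall>t\<ge>0. count_field X t 0 \<omega> = 0 \<and> count_field X 0 t \<omega> = 0"
    using AE_space
  proof eventually_elim
    case (elim \<omega>)
    have sec: "Pair \<omega> -` (space G \<times> B) = B" for B
      using elim(2) by (auto simp: G_space)
    show ?case
    proof (intro allI impI)
      fix t :: real assume "0 \<le> t"
      obtain n :: nat where n: "t \<le> real n" using real_arch_simple by blast
      have B: "{0..a} \<times> {0..b} \<in> sets borel" "bounded ({0..a} \<times> {0..b})" for a b :: real
        using bounded_borel_setsD[OF Icc_Times_bounded_borel] by auto
      \<comment> \<open>A count of 0 on a bounded set means measure 0 in the extended sense, so it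
        passes to shorter segments.\<close>
      have mono: "measure (ext X \<omega>) A = 0" if "A \<subseteq> B'" "measure (ext X \<omega>) B' = 0" "A \<in> sets borel" "B' \<in> sets borel" "bounded B'" for A B'
      proof -
        obtain k :: nat where k: "emeasure (ext X \<omega>) B' = of_nat k" "measure (ext X \<omega>) B' = real k"
          using counting_ext_nat[OF X elim(2) \<open>B' \<in> sets borel\<close> \<open>bounded B'\<close>] by blast
        then have "emeasure (ext X \<omega>) B' = 0" using that(2) by simp
        then have "emeasure (ext X \<omega>) A = 0" using emeasure_mono[OF that(1), of "ext X \<omega>"] that(4) by simp
        then show ?thesis by (simp add: measure_def)
      qed
      have "measure (ext X \<omega>) ({0..t} \<times> {0..0}) = 0"
      proof (rule mono[OF _ _ B(1) B(1) B(2)])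
        show "{0..t} \<times> {0..0::real} \<subseteq> {0..real n} \<times> {0..0}" using n by auto
        show "measure (ext X \<omega>) ({0..real n} \<times> {0..0}) = 0" using elim(1) unfolding sec by blast
      qed
      moreover have "measure (ext X \<omega>) ({0..0} \<times> {0..t}) = 0"
      proof (rule mono[OF _ _ B(1) B(1) B(2)])
        show "{0..0::real} \<times> {0..t} \<subseteq> {0..0} \<times> {0..real n}" using n by auto
        show "measure (ext X \<omega>) ({0..0} \<times> {0..real n}) = 0" using elim(1) unfolding sec by blast
      qed
      ultimately show "count_field X t 0 \<omega> = 0 \<and> count_field X 0 t \<omega> = 0"
        by (simp only: count_field_ext[OF X elim(2)])
    qed
  qed
qed

end

section \<open>The sigma-algebra of the two subordinators and the conclusion\<close>

lemma subalgebra_sigma_process: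
  assumes "\<And>t. 0 \<le> t \<Longrightarrow> Y t \<in> borel_measurable M"
  shows "sets (sigma_process M Y) \<subseteq> sets M"
  unfolding sigma_process_def sigma_gen_sets
  by (rule sets.sigma_sets_subset) (use assms in \<open>auto intro: measurable_sets\<close>)

lemma sigma_pair_sets:
  assumes "\<And>t. 0 \<le> t \<Longrightarrow> Y1 t \<in> borel_measurable M" "\<And>t. 0 \<le> t \<Longrightarrow> Y2 t \<in> borel_measurable M"
  shows "subalgebra M (sigma_pair M Y1 Y2)" "subalgebra (sigma_pair M Y1 Y2) (sigma_process M Y1)"
    "subalgebra (sigma_pair M Y1 Y2) (sigma_process M Y2)"
proof -
  have sub: "sets (sigma_process M Y1) \<union> sets (sigma_process M Y2) \<subseteq> sets M"
    using subalgebra_sigma_process assms by blast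
  then have sub': "sets (sigma_process M Y1) \<union> sets (sigma_process M Y2) \<subseteq> Pow (space M)"
    using sets.sets_into_space by blast
  have s: "sets (sigma_pair M Y1 Y2) = sigma_sets (space M) (sets (sigma_process M Y1) \<union> sets (sigma_process M Y2))"
    "space (sigma_pair M Y1 Y2) = space M"
    unfolding sigma_pair_def sigma_join_def using sub' by (simp_all add: sets_measure_of space_measure_of)
  show "subalgebra M (sigma_pair M Y1 Y2)"
    unfolding subalgebra_def s using sets.sigma_sets_subset[OF sub] by simp
  show "subalgebra (sigma_pair M Y1 Y2) (sigma_process M Y1)" "subalgebra (sigma_pair M Y1 Y2) (sigma_process M Y2)"
    unfolding subalgebra_def s by (auto simp: sigma_process_def intro: sigma_sets.Basic)
qed

theorem proposition4p2:
  fixes M :: "'a measure"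
    and Y1 Y2 :: "real \<Rightarrow> 'a \<Rightarrow> real"
    and \<alpha>1 \<alpha>2 lam :: real
    and X :: "'a \<Rightarrow> (real \<times> real) measure"
  defines "G \<equiv> sigma_pair M Y1 Y2"
    and "\<mu> \<equiv> product_path_measure Y1 Y2"
  assumes "prob_space M"
    and "0 < \<alpha>1" "\<alpha>1 < 1" "0 < \<alpha>2" "\<alpha>2 < 1" "0 < lam"
    and "inverse_stable_subordinator M \<alpha>1 Y1"
    and "inverse_stable_subordinator M \<alpha>2 Y2"
    and "prob_space.indep_set M (sets (sigma_process M Y1)) (sets (sigma_process M Y2))"
    and "simple_counting_process M X"
  shows "(fractional_poisson_random_field M Y1 Y2 lam X \<longleftrightarrow>
            doubly_stochastic_poisson_star M (enlarged_filtration M G X) lam \<mu> X) \<and>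
         (fractional_poisson_random_field M Y1 Y2 lam X \<longleftrightarrow>
            (\<forall>n (B :: nat \<Rightarrow> (real \<times> real) set) (x :: nat \<Rightarrow> nat).
               (\<forall>i<n. B i \<in> bounded_borel_sets) \<and> disjoint_family_on B {..<n} \<longrightarrow>
               (AE \<omega> in M.
                  cprob M G {\<omega>' \<in> space M. \<forall>i<n. measure (X \<omega>') (B i) = real (x i)} \<omega> =
                  (\<Prod>i<n. exp (- lam * measure (\<mu> \<omega>) (B i)) *
                           (lam * measure (\<mu> \<omega>) (B i)) ^ x i / fact (x i)))))"
proof -
  interpret prob_space M by fact
  obtain y1 where r1: "\<And>\<omega>. reg_path (\<lambda>t. y1 t \<omega>)" "\<And>t. y1 t \<in> borel_measurable (sigma_process M Y1)"
    "AE \<omega> in M. \<forall>t\<ge>0. Y1 t \<omega> = y1 t \<omega>"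
    using regular_version[OF \<open>inverse_stable_subordinator M \<alpha>1 Y1\<close> \<open>0 < \<alpha>1\<close>] by blast
  obtain y2 where r2: "\<And>\<omega>. reg_path (\<lambda>t. y2 t \<omega>)" "\<And>t. y2 t \<in> borel_measurable (sigma_process M Y2)"
    "AE \<omega> in M. \<forall>t\<ge>0. Y2 t \<omega> = y2 t \<omega>"
    using regular_version[OF \<open>inverse_stable_subordinator M \<alpha>2 Y2\<close> \<open>0 < \<alpha>2\<close>] by blast
  have Ym: "Y1 t \<in> borel_measurable M" "Y2 t \<in> borel_measurable M" if "0 \<le> t" for t
    using assms(9,10) that by (simp_all add: inverse_stable_subordinator_def)
  have sub: "subalgebra M G" "subalgebra G (sigma_process M Y1)" "subalgebra G (sigma_process M Y2)"
    unfolding G_def by (rule sigma_pair_sets[OF Ym]; assumption)+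
  interpret fprf_setting M G X y1 y2 lam
  proof (intro fprf_setting.intro cond_prob.intro cond_prob_axioms.intro fprf_setting_axioms.intro prob_space_axioms sub(1))
    show "counting_process M X" using assms(12) by (simp add: simple_counting_process_def)
    show "y1 t \<in> borel_measurable G" "y2 t \<in> borel_measurable G" for t
      using measurable_from_subalg[OF sub(2) r1(2)] measurable_from_subalg[OF sub(3) r2(2)] .
  qed (use r1 r2 assms in auto)
  \<comment> \<open>The exceptional set is where the processes differ from their regular versions;
    it does not depend on \<open>B\<close>, so the identity holds for all Borel sets at
    once.\<close>
  have V\<mu>: "AE \<omega> in M. \<forall>B. B \<in> sets borel \<longrightarrow> B \<subseteq> quadrant \<longrightarrow> lam * measure (\<mu> \<omega>) B = measure (V \<omega>) B"
    using r1(3) r2(3)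
  proof eventually_elim
    case (elim \<omega>)
    then show ?case
      using product_path_measure_eq[OF r1(1) r2(1), of Y1 \<omega> \<omega> Y2 \<omega>] by (simp add: \<mu>_def measure_V)
  qed
  have star: "doubly_stochastic_poisson_star M (enlarged_filtration M G X) lam \<mu> X \<longleftrightarrow> cond_poisson_borel (ext X) V"
    using star_imp_cond_poisson[OF V\<mu>] cond_poisson_imp_star[OF V\<mu>] unfolding F_def by blast
  have fprf: "fractional_poisson_random_field M Y1 Y2 lam X \<longleftrightarrow> cond_poisson_borel (ext X) V"
  proof
    assume "fractional_poisson_random_field M Y1 Y2 lam X"
    then obtain N' where N': "poisson_random_field M lam N'" "indep_set (sets (sigma_count_field M N')) (sets G)"
      "AE \<omega> in M. \<forall>t1\<ge>0. \<forall>t2\<ge>0. count_field X t1 t2 \<omega> = count_field N' (Y1 t1 \<omega>) (Y2 t2 \<omega>) \<omega>"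
      unfolding fractional_poisson_random_field_def G_def by blast
    have "AE \<omega> in M. \<forall>t1\<ge>0. \<forall>t2\<ge>0. count_field X t1 t2 \<omega> = count_field N' (y1 t1 \<omega>) (y2 t2 \<omega>) \<omega>"
      using N'(3) r1(3) r2(3) by eventually_elim simp
    then show "cond_poisson_borel (ext X) V" by (rule time_changed_cond_poisson[OF N'(1,2)])
  next
    assume cp: "cond_poisson_borel (ext X) V"
    \<comment> \<open>Here \<open>N\<close> is the image field built from \<open>X\<close> on the
      given probability space, so no extension of that space is required.\<close>
    have "AE \<omega> in M. \<forall>t1\<ge>0. \<forall>t2\<ge>0. count_field X t1 t2 \<omega> = count_field N (Y1 t1 \<omega>) (Y2 t2 \<omega>) \<omega>"
      using count_field_N[OF cp] r1(3) r2(3) by eventually_elim simp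
    then show "fractional_poisson_random_field M Y1 Y2 lam X"
      unfolding fractional_poisson_random_field_def
      using poisson_random_field_N[OF cp] indep_N[OF cp] unfolding G_def by blast
  qed
  show ?thesis
    unfolding star fprf cond_poisson_borel_iff[OF V\<mu>] by blast
qed

end
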